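(* Let $M_1,M_2$ be fixed positive integers and let $\alpha\in(0,1)$ with $\alpha\le\frac12$. Let $\eta_t$ and $\tilde\eta_t$ be the one-shock half-line open TASEPs with boundary rate $\alpha$ described in the context, let $f(t)$ be the position of the unique second-class particle of $\eta_t$, and let $\mathbf{N}_2(1,t)$ be the number of second-class particles present in $\tilde\eta_t$ at time $t$. Then $$\lim_{t\to\infty}\mathbb{P}(f(t)>0)=\sum_{n=0}^{M_1}\binom{M_1+M_2+1}{n}\alpha^n(1-\alpha)^{M_1+M_2+1-n}.$$ Moreover, for every integer $0\le m\le M_2$, $$\lim_{t\to\infty}\mathbb{P}(\mathbf{N}_{2}(1,t)=m)=\binom{M_1+M_2+1}{M_1+M_2+1-m}\alpha^{M_1+M_2+1-m}(1-\alpha)^{m}.$$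
   Context: Multi-color half-line open TASEP: a continuous-time Markov process on configurations $\eta:\mathbb{Z}_{>0}\to\{1,2,+\infty\}$, where $1$ denotes a first-class particle, $2$ a second-class particle and $+\infty$ a hole. Dynamics: independently for each $x\ge1$, at rate $1$ the contents of sites $x$ and $x+1$ are exchanged if $\eta(x)<\eta(x+1)$ (nothing happens otherwise); at rate $\alpha$, if $\eta(1)>1$, the content of site $1$ is replaced by a first-class particle (nothing happens otherwise). In particular, a second-class particle at site $1$ that is replaced in this way leaves the system permanently. Initial condition of $\eta_t$: $\eta_0(x)=+\infty$ for $1\le x\le M_1$; $\eta_0(M_1+1)=2$; $\eta_0(x)=1$ for $M_1+2\le x\le M_1+M_2+1$; $\eta_0(x)=+\infty$ for $x>M_1+M_2+1$. Initial condition of $\tilde\eta_t$ (same dynamics): $\tilde\eta_0(x)=2$ for $M_1+1\le x\le M_1+M_2+1$ and $\tilde\eta_0(x)=+\infty$ for all other $x\ge1$. $f(t)$ is the position of the unique second-class particle of $\eta_t$; $f(t)>0$ means that this particle is still in the system at time $t$, and $f(t)<0$ means that it has left (disappeared from) the system by time $t$. $\mathbf{N}_c(x,t)$ is the number of particles of color $c$ in $\tilde\eta_t$ at time $t$ located at sites $\ge x$. *)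

theory Defs
  imports "HOL-Probability.Probability"
begin

text \<open>
  Colors are the extended naturals \<open>1\<close> (first class), \<open>2\<close> (second class) and \<open>\<infinity>\<close> (hole), with
  the order of \<^typ>\<open>enat\<close>. A configuration is an extensional function on the sites \<open>1, 2, 3, \<dots>\<close>,
  so index \<open>0\<close> carries no information.
\<close>

type_synonym config = "nat \<Rightarrow> enat"

definition config_space :: "config measure" where
  "config_space = PiM {1..} (\<lambda>_. count_space {1, 2, \<infinity>})"

definition exchange :: "nat \<Rightarrow> config \<Rightarrow> config" where
  "exchange x \<eta> = \<eta>(x := \<eta> (x + 1), x + 1 := \<eta> x)"

definition inject :: "config \<Rightarrow> config" where
  "inject \<eta> = \<eta>(1 := 1)"

definition local_function :: "(config \<Rightarrow> real) \<Rightarrow> bool" where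
  "local_function g \<longleftrightarrow>
     (\<exists>n. \<forall>\<eta>\<in>space config_space. \<forall>\<zeta>\<in>space config_space.
        (\<forall>x\<in>{1..n}. \<eta> x = \<zeta> x) \<longrightarrow> g \<eta> = g \<zeta>)"

text \<open>
  The generator is only applied to local functions, for which all but finitely many terms of the
  sum over the bonds vanish.
\<close>

definition tasep_generator :: "real \<Rightarrow> (config \<Rightarrow> real) \<Rightarrow> config \<Rightarrow> real" where
  "tasep_generator \<alpha> g \<eta> =
     \<alpha> * (if \<eta> 1 > 1 then g (inject \<eta>) - g \<eta> else 0) +
     (\<Sum>\<^sub>\<infinity>x\<in>{1..}. if \<eta> x < \<eta> (x + 1) then g (exchange x \<eta>) - g \<eta> else 0)"

text \<open>
  Infinitely many bonds may be active at once, so the rates are imposed through the action of the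
  generator on local functions, as is standard for interacting particle systems. The local
  functions form a core, hence for times \<open>t \<ge> 0\<close> and
  states in \<^const>\<open>config_space\<close> the semigroup is determined by this predicate.
\<close>

definition tasep_semigroup :: "real \<Rightarrow> (real \<Rightarrow> config \<Rightarrow> config measure) \<Rightarrow> bool" where
  "tasep_semigroup \<alpha> S \<longleftrightarrow>
     (\<forall>t\<ge>0. S t \<in> config_space \<rightarrow>\<^sub>M prob_algebra config_space) \<and>
     (\<forall>\<eta>\<in>space config_space. S 0 \<eta> = return config_space \<eta>) \<and>
     (\<forall>s\<ge>0. \<forall>t\<ge>0. \<forall>\<eta>\<in>space config_space. S (s + t) \<eta> = S s \<eta> \<bind> S t) \<and>
     (\<forall>g. local_function g \<longrightarrow>
        uniform_limit (space config_space)
          (\<lambda>h \<eta>. ((\<integral>\<zeta>. g \<zeta> \<partial>S h \<eta>) - g \<eta>) / h) (tasep_generator \<alpha> g) (at_right 0))"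

definition natural_filtration ::
    "'w measure \<Rightarrow> (real \<Rightarrow> 'w \<Rightarrow> config) \<Rightarrow> real \<Rightarrow> 'w measure" where
  "natural_filtration M X s =
     sigma (space M) {X u -` A \<inter> space M | u A. 0 \<le> u \<and> u \<le> s \<and> A \<in> sets config_space}"

text \<open>
  Only the times \<open>t \<ge> 0\<close> matter. The last conjunct says that almost every path is
  right-continuous with left limits for the product of the discrete topologies.
\<close>

definition half_line_tasep ::
    "real \<Rightarrow> config \<Rightarrow> 'w measure \<Rightarrow> (real \<Rightarrow> 'w \<Rightarrow> config) \<Rightarrow> bool" where
  "half_line_tasep \<alpha> \<eta>\<^sub>0 M X \<longleftrightarrow>
     prob_space M \<and>
     (\<forall>t\<ge>0. X t \<in> M \<rightarrow>\<^sub>M config_space) \<and>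
     (AE \<omega> in M. X 0 \<omega> = \<eta>\<^sub>0) \<and>
     (\<exists>S. tasep_semigroup \<alpha> S \<and>
        (\<forall>s\<ge>0. \<forall>t\<ge>0. \<forall>A\<in>sets config_space.
           AE \<omega> in M. real_cond_exp M (natural_filtration M X s)
                          (\<lambda>\<omega>'. indicator A (X (s + t) \<omega>')) \<omega>
                       = measure (S t (X s \<omega>)) A)) \<and>
     (AE \<omega> in M. \<forall>t\<ge>0. \<forall>x\<ge>1.
        (\<forall>\<^sub>F s in at_right t. X s \<omega> x = X t \<omega> x) \<and>
        (t > 0 \<longrightarrow> (\<exists>c. \<forall>\<^sub>F s in at_left t. X s \<omega> x = c)))"

definition init_shock :: "nat \<Rightarrow> nat \<Rightarrow> config" where
  "init_shock M1 M2 = (\<lambda>x\<in>{1..}.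
     if x \<le> M1 then \<infinity>
     else if x = M1 + 1 then 2
     else if x \<le> M1 + M2 + 1 then 1
     else \<infinity>)"

definition init_second :: "nat \<Rightarrow> nat \<Rightarrow> config" where
  "init_second M1 M2 = (\<lambda>x\<in>{1..}. if M1 + 1 \<le> x \<and> x \<le> M1 + M2 + 1 then 2 else \<infinity>)"

text \<open>
  The value \<open>-1\<close> encodes that the second-class particle has left the system. Almost surely there is
  at most one second-class particle when the process starts from \<^const>\<open>init_shock\<close>; the least site
  is taken only so that the function is measurable on all configurations.
\<close>

definition second_class_position :: "config \<Rightarrow> int" where
  "second_class_position \<eta> =
     (if \<exists>x\<ge>1. \<eta> x = 2 then int (LEAST x. x \<ge> 1 \<and> \<eta> x = 2) else -1)"

text \<open>
  For the color \<open>2\<close> and the initial state \<^const>\<open>init_second\<close> the counted set is almost surely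
  finite, with at most \<open>M2 + 1\<close> elements, so the value \<open>0\<close> of \<^const>\<open>card\<close> on infinite sets plays
  no role.
\<close>

definition color_count :: "enat \<Rightarrow> nat \<Rightarrow> config \<Rightarrow> nat" where
  "color_count c x \<eta> = card {y. y \<ge> 1 \<and> y \<ge> x \<and> \<eta> y = c}"

end

theory Submission
  imports Defs
begin

text \<open>
  Both initial states are projections of one packed state on the sites \<open>1, \<dots>, N\<close>, \<open>N = M1 + M2 + 1\<close>, and
  the dynamics applies random elementary maps (exchange at a bond, injection at site 1) that act
  monotonically after thresholding the colors. With \<open>h\<close> and \<open>o\<close> the indicators of the sites of \<open>\<eta>\<close> with
  color at least \<open>c\<close> and of the particles of \<open>\<xi>\<close>, the minimum over \<open>x\<close> of the sums of \<open>o - h\<close> over the sites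
  beyond \<open>x\<close> does not change when an elementary map is moved from \<open>\<eta>\<close> to \<open>\<xi>\<close>. As reversing a random word of maps preserves
  its law, the number of surviving second-class particles at time \<open>t\<close> has the law of
  a function of the number \<open>k\<close> of particles in \<open>1, \<dots>, N\<close> at time \<open>t\<close> for the process started empty, namely
  \<open>min (M2 + 1) (N - k)\<close> for \<open>init_second\<close> and the truth value of \<open>k \<le> M1\<close> for \<open>init_shock\<close>.

  Started empty, the process converges to the Bernoulli(\<open>\<alpha>\<close>) product measure when \<open>\<alpha> \<le> 1/2\<close>. The upper
  bound comes from the finite open TASEP with exit rate \<open>1 - \<alpha>\<close>, whose stationary law is this product measure, and the lower bound from the finite
  open TASEP with exit rate \<open>1\<close>, which loses more particles; by the matrix ansatz its stationary law near site 1 is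
  governed by ballot numbers and tends to Bernoulli(\<open>\<alpha>\<close>) as the length grows. A given semigroup is
  reached from these finite chains through Taylor expansions of local functions, on which the generators
  of all long chains agree.
\<close>

section \<open>Finite jump chains\<close>

text \<open>No graphical construction is at hand: a process enters only through a semigroup
  prescribed on local functions. So probabilistic steps become statements on powers of a generator:
  a coupling is a relation kept by each elementary map, and reversing a word is a symmetry of a sum
  over all words. A local function does not see the exit rate \<beta> of a long chain, so this rate
  is set according to need: 0 for the duality, because removal at the last site does not pass
  through the dual function; \<open>1 - \<alpha>\<close> for the upper bound; 1 for the lower bound,
  because the exit then has the rate of the bond it replaces. The number of second-class particles
  is not local, so a weight doubling with the site bounds the chance that one has travelled far by
  time t, uniformly in the chain length. The condition \<open>\<alpha> \<le> 1/2\<close> enters with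
  the lower bound: the left vector is evaluation at \<open>(1 - \<alpha>) / \<alpha>\<close>, and at
  points not below 1 the normalization is at least a middle binomial coefficient, against which the
  constant coefficient, the only defect from the product form, is smaller by a factor of order
  1/L.\<close>

definition gen :: "(nat \<Rightarrow> real) \<Rightarrow> (nat \<Rightarrow> 's \<Rightarrow> 's) \<Rightarrow> nat \<Rightarrow> ('s \<Rightarrow> real) \<Rightarrow> 's \<Rightarrow> real" where
  "gen r A R g x = (\<Sum>i\<le>R. r i * (g (A i x) - g x))"

text \<open>The exponential series of the bounded operator \<open>gen\<close>. Only expectations of
  bounded functions are needed, so no process is built for the finite chains.\<close>

definition evol ::
    "(nat \<Rightarrow> real) \<Rightarrow> (nat \<Rightarrow> 's \<Rightarrow> 's) \<Rightarrow> nat \<Rightarrow> real \<Rightarrow> ('s \<Rightarrow> real) \<Rightarrow> 's \<Rightarrow> real" where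
  "evol r A R t g x = (\<Sum>k. (gen r A R ^^ k) g x / fact k * t ^ k)"

text \<open>Uniformization: \<open>gen\<close> without its diagonal. For nonnegative rates this
  operator is positive; it is the total rate times the one-step operator of the embedded discrete
  chain.\<close>

definition jump :: "(nat \<Rightarrow> real) \<Rightarrow> (nat \<Rightarrow> 's \<Rightarrow> 's) \<Rightarrow> nat \<Rightarrow> ('s \<Rightarrow> real) \<Rightarrow> 's \<Rightarrow> real" where
  "jump r A R g x = (\<Sum>i\<le>R. r i * g (A i x))"

lemma jump_eq_gen: "jump r A R g x = gen r A R g x + (\<Sum>i\<le>R. r i) * g x"
  by (simp add: jump_def gen_def sum_distrib_right right_diff_distrib sum_subtractf)

lemma gen_linear:
  "gen r A R (\<lambda>y. a * g y + b * h y) x = a * gen r A R g x + b * gen r A R h x"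
  by (simp add: gen_def sum_distrib_left sum.distrib[symmetric] algebra_simps)

lemma gen_pow_linear:
  "(gen r A R ^^ k) (\<lambda>y. a * g y + b * h y) x
     = a * (gen r A R ^^ k) g x + b * (gen r A R ^^ k) h x"
proof (induction k arbitrary: x)
  case (Suc k)
  have "(gen r A R ^^ k) (\<lambda>y. a * g y + b * h y)
      = (\<lambda>x. a * (gen r A R ^^ k) g x + b * (gen r A R ^^ k) h x)"
    using Suc.IH by blast
  then show ?case by (simp add: gen_linear)
qed simp

lemma gen_pow_sum:
  assumes "finite I"
  shows "(gen r A R ^^ k) (\<lambda>y. \<Sum>i\<in>I. c i * g i y) x = (\<Sum>i\<in>I. c i * (gen r A R ^^ k) (g i) x)"
  using assms
proof (induction I arbitrary: x rule: finite_induct)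
  case empty
  then show ?case using gen_pow_linear[where a = 0 and b = 0] by simp
next
  case (insert j I)
  then show ?case
    using gen_pow_linear[where a = "c j" and g = "g j" and b = 1 and h = "\<lambda>y. \<Sum>i\<in>I. c i * g i y"] by simp
qed

lemma gen_pow_Suc_right: "(gen r A R ^^ Suc k) g x = (gen r A R ^^ k) (gen r A R g) x"
  by (simp only: funpow_Suc_right o_apply)

lemma gen_const: "gen r A R (\<lambda>_. c) x = 0"
  by (simp add: gen_def)

lemma gen_pow_const: "(gen r A R ^^ k) (\<lambda>_. c) x = (if k = 0 then c else 0)"
proof (induction k arbitrary: x)
  case (Suc k)
  have "(gen r A R ^^ k) (\<lambda>_. c) = (\<lambda>_. if k = 0 then c else 0)" using Suc.IH by blast
  then show ?case by (simp add: gen_const)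
qed simp

lemma evol_0 [simp]: "evol r A R 0 g x = g x"
  unfolding evol_def by (subst suminf_finite[of "{0}"]) auto

lemma evol_const [simp]: "evol r A R t (\<lambda>_. c) x = c"
  unfolding evol_def gen_pow_const by (subst suminf_finite[of "{0}"]) auto

context
  fixes r :: "nat \<Rightarrow> real" and R :: nat
  assumes r_nonneg: "\<And>i. i \<le> R \<Longrightarrow> 0 \<le> r i"
begin

lemma gen_bounded:
  assumes "\<And>x. \<bar>g x\<bar> \<le> B"
  shows "\<bar>gen r A R g x\<bar> \<le> 2 * (\<Sum>i\<le>R. r i) * B"
proof -
  have "\<bar>gen r A R g x\<bar> \<le> (\<Sum>i\<le>R. \<bar>r i * (g (A i x) - g x)\<bar>)"
    unfolding gen_def by (rule sum_abs)
  also have "\<dots> \<le> (\<Sum>i\<le>R. r i * (2 * B))"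
  proof (rule sum_mono)
    fix i assume i: "i \<in> {..R}"
    have "\<bar>g (A i x) - g x\<bar> \<le> 2 * B" using assms[of "A i x"] assms[of x] by linarith
    then show "\<bar>r i * (g (A i x) - g x)\<bar> \<le> r i * (2 * B)"
      using r_nonneg[of i] i by (simp add: abs_mult mult_left_mono)
  qed
  finally show ?thesis by (simp add: sum_distrib_right[symmetric])
qed

lemma gen_pow_bounded:
  assumes "\<And>x. \<bar>g x\<bar> \<le> B"
  shows "\<bar>(gen r A R ^^ k) g x\<bar> \<le> (2 * (\<Sum>i\<le>R. r i)) ^ k * B"
proof (induction k arbitrary: x)
  case (Suc k)
  show ?case using gen_bounded[of "(gen r A R ^^ k) g", OF Suc.IH] by (simp add: mult.assoc)
qed (use assms in simp)

lemma summable_exp_bound: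
  fixes a :: "nat \<Rightarrow> real"
  assumes "\<And>k. \<bar>a k\<bar> \<le> q ^ k * B"
  shows "summable (\<lambda>k. \<bar>a k / fact k * t ^ k\<bar>)"
proof (rule summable_comparison_test')
  show "summable (\<lambda>k. B * (inverse (fact k) * \<bar>q * t\<bar> ^ k))"
    using summable_exp[of "\<bar>q * t\<bar>"] by (intro summable_mult)
next
  fix k :: nat
  have "\<bar>a k\<bar> \<le> \<bar>q\<bar> ^ k * B"
  proof -
    have "0 \<le> B" using assms[of 0] by simp
    then have "q ^ k * B \<le> \<bar>q ^ k\<bar> * B" by (intro mult_right_mono) auto
    then show ?thesis using assms[of k] by (simp add: power_abs)
  qed
  then have "\<bar>a k\<bar> * (\<bar>t\<bar> ^ k / fact k) \<le> \<bar>q\<bar> ^ k * B * (\<bar>t\<bar> ^ k / fact k)"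
    by (intro mult_right_mono) auto
  then show "norm \<bar>a k / fact k * t ^ k\<bar> \<le> B * (inverse (fact k) * \<bar>q * t\<bar> ^ k)"
    by (simp add: abs_mult power_abs power_mult_distrib field_simps)
qed

lemma evol_abs_summable:
  assumes "\<And>x. \<bar>g x\<bar> \<le> B"
  shows "summable (\<lambda>k. \<bar>(gen r A R ^^ k) g x / fact k * t ^ k\<bar>)"
  using summable_exp_bound[OF gen_pow_bounded[OF assms]] .

lemma evol_summable:
  assumes "\<And>x. \<bar>g x\<bar> \<le> B"
  shows "summable (\<lambda>k. (gen r A R ^^ k) g x / fact k * t ^ k)"
  using summable_rabs_cancel[OF evol_abs_summable[OF assms]] .

lemma evol_linear:
  assumes g: "\<And>x. \<bar>g x\<bar> \<le> B" and h: "\<And>x. \<bar>h x\<bar> \<le> C"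
  shows "evol r A R t (\<lambda>y. a * g y + b * h y) x = a * evol r A R t g x + b * evol r A R t h x"
proof -
  have "(\<lambda>k. a * ((gen r A R ^^ k) g x / fact k * t ^ k)
           + b * ((gen r A R ^^ k) h x / fact k * t ^ k))
        sums (a * evol r A R t g x + b * evol r A R t h x)"
    unfolding evol_def
    by (intro sums_add sums_mult summable_sums evol_summable[of g B] evol_summable[of h C] assms)
  then show ?thesis
    unfolding evol_def gen_pow_linear by (intro sums_unique[symmetric]) (simp add: field_simps)
qed

lemma evol_has_derivative:
  assumes "\<And>x. \<bar>g x\<bar> \<le> B"
  shows "((\<lambda>t. evol r A R t g x) has_real_derivative evol r A R t (gen r A R g) x) (at t within T)"
proof -
  define c where "c k = (gen r A R ^^ k) g x / fact k" for k
  have "((\<lambda>t. \<Sum>k. c k * t ^ k) has_field_derivative (\<Sum>k. diffs c k * t ^ k)) (at t)"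
    by (rule termdiffs_strong_converges_everywhere)
      (use evol_summable[OF assms] in \<open>simp add: c_def\<close>)
  moreover have "diffs c k = (gen r A R ^^ k) (gen r A R g) x / fact k" for k
    unfolding diffs_def c_def gen_pow_Suc_right fact_Suc by simp
  ultimately show ?thesis
    by (simp add: evol_def c_def has_field_derivative_at_within)
qed

text \<open>The binomial theorem for \<open>gen\<close> plus a multiple of the identity, which
  commute.\<close>

lemma jump_pow_eq:
  "(jump r A R ^^ k) g x
     = (\<Sum>j\<le>k. real (k choose j) * (\<Sum>i\<le>R. r i) ^ (k - j) * (gen r A R ^^ j) g x)"
proof (induction k arbitrary: x)
  case (Suc k)
  let ?l = "\<Sum>i\<le>R. r i" and ?G = "\<lambda>j. (gen r A R ^^ j) g"
  have "(jump r A R ^^ k) g = (\<lambda>x. \<Sum>j\<le>k. real (k choose j) * ?l ^ (k - j) * ?G j x)"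
    using Suc.IH by blast
  then have "(jump r A R ^^ Suc k) g x
      = gen r A R (\<lambda>x. \<Sum>j\<le>k. real (k choose j) * ?l ^ (k - j) * ?G j x) x
        + ?l * (\<Sum>j\<le>k. real (k choose j) * ?l ^ (k - j) * ?G j x)"
    by (simp add: jump_eq_gen)
  also have "gen r A R (\<lambda>x. \<Sum>j\<le>k. real (k choose j) * ?l ^ (k - j) * ?G j x) x
      = (\<Sum>j\<le>k. real (k choose j) * ?l ^ (k - j) * ?G (Suc j) x)"
    using gen_pow_sum[OF finite_atMost, where k = 1 and c = "\<lambda>j. real (k choose j) * ?l ^ (k - j)" and g = ?G] by simp
  also have "\<dots> = (\<Sum>j\<le>Suc k. (if j = 0 then 0 else real (k choose (j - 1))) * ?l ^ (Suc k - j) * ?G j x)"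
    by (subst sum.atMost_Suc_shift) simp
  also have "?l * (\<Sum>j\<le>k. real (k choose j) * ?l ^ (k - j) * ?G j x)
      = (\<Sum>j\<le>k. real (k choose j) * ?l ^ (Suc k - j) * ?G j x)"
    by (auto simp: sum_distrib_left Suc_diff_le intro!: sum.cong)
  also have "\<dots> = (\<Sum>j\<le>Suc k. real (k choose j) * ?l ^ (Suc k - j) * ?G j x)" by simp
  finally show ?case
  proof -
    assume *: "(jump r A R ^^ Suc k) g x = 
      (\<Sum>j\<le>Suc k. (if j = 0 then 0 else real (k choose (j - 1))) * ?l ^ (Suc k - j) * ?G j x)
      + (\<Sum>j\<le>Suc k. real (k choose j) * ?l ^ (Suc k - j) * ?G j x)"
    show ?thesis unfolding * sum.distrib[symmetric]
    proof (rule sum.cong[OF refl])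
      fix j assume "j \<in> {..Suc k}"
      have "(if j = 0 then 0 else real (k choose (j - 1))) + real (k choose j)
        = real (Suc k choose j)" by (cases j) auto
      then show "(if j = 0 then 0 else real (k choose (j - 1))) * ?l ^ (Suc k - j) * ?G j x
        + real (k choose j) * ?l ^ (Suc k - j) * ?G j x = real (Suc k choose j) * ?l ^ (Suc k - j) * ?G j x"
        by (metis (no_types, lifting) distrib_right)
    qed
  qed
qed simp

text \<open>Cauchy product of the series of \<open>evol\<close> and of the exponential of the total
  rate. Sign arguments go through these powers, since the terms of \<open>evol\<close> itself have
  no sign.\<close>

lemma evol_sums_jump:
  assumes "\<And>x. \<bar>g x\<bar> \<le> B"
  shows "(\<lambda>k. (jump r A R ^^ k) g x / fact k * t ^ k)
           sums (exp ((\<Sum>i\<le>R. r i) * t) * evol r A R t g x)"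
proof -
  let ?l = "\<Sum>i\<le>R. r i"
  let ?a = "\<lambda>k. (gen r A R ^^ k) g x / fact k * t ^ k" and ?b = "\<lambda>k. ?l ^ k / fact k * t ^ k"
  have 1: "summable (\<lambda>k. norm (?a k))" using evol_abs_summable[OF assms] by simp
  have 2: "summable (\<lambda>k. norm (?b k))"
    using summable_exp_bound[of "\<lambda>k. ?l ^ k" "\<bar>?l\<bar>" 1 t] by (simp add: power_abs)
  have "(\<lambda>k. \<Sum>j\<le>k. ?a j * ?b (k - j)) sums (suminf ?a * suminf ?b)"
    using Cauchy_product_sums[OF 1 2] .
  moreover have "suminf ?b = exp (?l * t)"
    unfolding exp_def by (simp add: power_mult_distrib field_simps)
  moreover have "(\<Sum>j\<le>k. ?a j * ?b (k - j)) = (jump r A R ^^ k) g x / fact k * t ^ k" for k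
    unfolding jump_pow_eq sum_distrib_right sum_divide_distrib
  proof (rule sum.cong[OF refl])
    fix j assume "j \<in> {..k}"
    then have j: "j \<le> k" by simp
    then have "t ^ k = t ^ j * t ^ (k - j)" by (simp flip: power_add)
    then show "?a j * ?b (k - j)
        = real (k choose j) * ?l ^ (k - j) * (gen r A R ^^ j) g x / fact k * t ^ k"
      using j by (simp add: binomial_fact field_simps)
  qed
  ultimately show ?thesis unfolding evol_def by (simp add: mult.commute)
qed

text \<open>A coupling without probability: both chains use the same index \<open>i\<close> at the
  same rate, so the relation \<open>Q\<close> survives each letter. The two families of maps may
  differ, which later compares chains of different length.\<close>

lemma jump_pow_mono:
  assumes rel: "\<And>i x y. i \<le> R \<Longrightarrow> Q x y \<Longrightarrow> Q (A i x) (A' i y)"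
    and le: "\<And>x y. Q x y \<Longrightarrow> g x \<le> h y" and "Q x y"
  shows "(jump r A R ^^ k) g x \<le> (jump r A' R ^^ k) h y"
  using \<open>Q x y\<close>
proof (induction k arbitrary: x y)
  case (Suc k)
  then show ?case
    by (auto simp: jump_def intro!: sum_mono mult_left_mono r_nonneg rel)
qed (use le in simp)

lemma evol_mono:
  assumes g: "\<And>x. \<bar>g x\<bar> \<le> B" and h: "\<And>x. \<bar>h x\<bar> \<le> C" and t: "0 \<le> t"
    and rel: "\<And>i x y. i \<le> R \<Longrightarrow> Q x y \<Longrightarrow> Q (A i x) (A' i y)"
    and le: "\<And>x y. Q x y \<Longrightarrow> g x \<le> h y" and "Q x y"
  shows "evol r A R t g x \<le> evol r A' R t h y"
proof -
  have "exp ((\<Sum>i\<le>R. r i) * t) * evol r A R t g x \<le> exp ((\<Sum>i\<le>R. r i) * t) * evol r A' R t h y"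
  proof (rule sums_le)
    show "(\<lambda>k. (jump r A R ^^ k) g x / fact k * t ^ k)
        sums (exp ((\<Sum>i\<le>R. r i) * t) * evol r A R t g x)"
      by (rule evol_sums_jump[of g B, OF g])
    show "(\<lambda>k. (jump r A' R ^^ k) h y / fact k * t ^ k)
        sums (exp ((\<Sum>i\<le>R. r i) * t) * evol r A' R t h y)"
      by (rule evol_sums_jump[of h C, OF h])
    show "\<And>k. (jump r A R ^^ k) g x / fact k * t ^ k \<le> (jump r A' R ^^ k) h y / fact k * t ^ k"
      using jump_pow_mono[of Q A A' g h, OF rel le \<open>Q x y\<close>] t
      by (intro mult_right_mono divide_right_mono) auto
  qed
  then show ?thesis by simp
qed

lemma evol_mono_same:
  assumes g: "\<And>x. \<bar>g x\<bar> \<le> B" and h: "\<And>x. \<bar>h x\<bar> \<le> C" and t: "0 \<le> t"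
    and le: "\<And>x. g x \<le> h x"
  shows "evol r A R t g x \<le> evol r A R t h x"
  by (rule evol_mono[of g B h C t "(=)"]) (use assms in auto)

lemma evol_bounded:
  assumes g: "\<And>x. \<bar>g x\<bar> \<le> B" and t: "0 \<le> t"
  shows "\<bar>evol r A R t g x\<bar> \<le> B"
proof -
  have B: "g x \<le> B" "- B \<le> g x" "\<bar>B\<bar> \<le> B" "\<bar>- B\<bar> \<le> B" for x
    using g[of x] by linarith+
  have "evol r A R t g x \<le> evol r A R t (\<lambda>_. B) x"
    by (rule evol_mono_same[where B = B and C = B]) (use g t B in auto)
  moreover have "evol r A R t (\<lambda>_. - B) x \<le> evol r A R t g x"
    by (rule evol_mono_same[where B = B and C = B]) (use g t B in auto)
  ultimately show ?thesis by simp
qed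

text \<open>Gronwall's inequality on powers: the assumption says that \<open>jump\<close> maps
  \<open>g\<close> below (total rate + 1) times \<open>g\<close>; iterating and cancelling the
  exponential of the total rate leaves \<open>exp t\<close>.\<close>

lemma evol_le_exp:
  assumes g: "\<And>x. \<bar>g x\<bar> \<le> B" and t: "0 \<le> t" and gen: "\<And>x. gen r A R g x \<le> g x"
  shows "evol r A R t g x \<le> exp t * g x"
proof -
  let ?l = "\<Sum>i\<le>R. r i"
  have l: "0 \<le> ?l" by (intro sum_nonneg) (use r_nonneg in auto)
  have pow: "(jump r A R ^^ k) g x \<le> (?l + 1) ^ k * g x" for k x
  proof (induction k arbitrary: x)
    case (Suc k)
    have "(jump r A R ^^ Suc k) g x \<le> (\<Sum>i\<le>R. r i * ((?l + 1) ^ k * g (A i x)))"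
      by (simp add: jump_def) (intro sum_mono mult_left_mono r_nonneg Suc.IH; simp)
    also have "\<dots> = (?l + 1) ^ k * jump r A R g x"
      by (simp add: jump_def sum_distrib_left mult_ac)
    also have "\<dots> \<le> (?l + 1) ^ k * ((?l + 1) * g x)"
      using gen[of x] l by (intro mult_left_mono) (auto simp: jump_eq_gen algebra_simps)
    finally show ?case by (simp add: mult_ac)
  qed simp
  have "exp (?l * t) * evol r A R t g x \<le> exp ((?l + 1) * t) * g x"
  proof (rule sums_le)
    show "(\<lambda>k. (jump r A R ^^ k) g x / fact k * t ^ k) sums (exp (?l * t) * evol r A R t g x)"
      by (rule evol_sums_jump[of g B, OF g])
    show "(\<lambda>k. ((?l + 1) * t) ^ k /\<^sub>R fact k * g x) sums (exp ((?l + 1) * t) * g x)"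
      by (intro sums_mult2 exp_converges)
    show "\<And>k. (jump r A R ^^ k) g x / fact k * t ^ k \<le> ((?l + 1) * t) ^ k /\<^sub>R fact k * g x"
    proof -
      fix k
      have "(jump r A R ^^ k) g x * (t ^ k / fact k) \<le> ((?l + 1) ^ k * g x) * (t ^ k / fact k)"
        using pow[of k x] t by (intro mult_right_mono) auto
      then show "(jump r A R ^^ k) g x / fact k * t ^ k \<le> ((?l + 1) * t) ^ k /\<^sub>R fact k * g x"
        by (simp only: power_mult_distrib scaleR_conv_of_real) (simp add: field_simps)
    qed
  qed
  then show ?thesis by (simp add: distrib_right exp_add)
qed

end

text \<open>Expanded, a power of \<open>gen\<close> is a sum over words. Peeling off the factor next
  to \<open>H\<close> hands its map to \<open>y\<close>, so a word reaches \<open>y\<close> in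
  reverse order, and the sum contains every word and its reverse with the same weight. Maps of rate
  zero are exempt, so an exit of rate 0 needs no dual.\<close>

lemma gen_pow_dual:
  assumes "\<And>i x y. i \<le> R \<Longrightarrow> r i \<noteq> 0 \<Longrightarrow> H (A i x) y = H x (A' i y)"
  shows "(gen r A R ^^ k) (\<lambda>x. H x y) x = (gen r A' R ^^ k) (\<lambda>y. H x y) y"
proof (induction k arbitrary: x y)
  case (Suc k)
  have 1: "gen r A R (\<lambda>x. H x y) = (\<lambda>x. \<Sum>i\<le>R. r i * (H x (A' i y) - H x y))"
    unfolding gen_def using assms by (intro ext sum.cong) auto
  have "(gen r A R ^^ Suc k) (\<lambda>x. H x y) x
      = (gen r A R ^^ k) (\<lambda>x. \<Sum>i\<le>R. r i * (1 * H x (A' i y) + (-1) * H x y)) x"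
    unfolding gen_pow_Suc_right 1 by simp
  also have "\<dots> = (\<Sum>i\<le>R. r i * (1 * (gen r A R ^^ k) (\<lambda>x. H x (A' i y)) x
      + (-1) * (gen r A R ^^ k) (\<lambda>x. H x y) x))"
    unfolding gen_pow_sum[OF finite_atMost] gen_pow_linear ..
  also have "\<dots> = gen r A' R ((gen r A' R ^^ k) (\<lambda>y. H x y)) y"
    unfolding Suc.IH by (simp add: gen_def)
  finally show ?case by simp
qed simp

lemma evol_dual:
  assumes "\<And>i x y. i \<le> R \<Longrightarrow> r i \<noteq> 0 \<Longrightarrow> H (A i x) y = H x (A' i y)"
  shows "evol r A R t (\<lambda>x. H x y) x = evol r A' R t (\<lambda>y. H x y) y"
  unfolding evol_def using gen_pow_dual[of R r H A A', OF assms] by simp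

section \<open>Finite approximations of the half-line process\<close>

definition letter :: "nat \<Rightarrow> config \<Rightarrow> config" where
  "letter i \<eta> = (if i = 0 then if \<eta> 1 > 1 then inject \<eta> else \<eta>
                 else if \<eta> i < \<eta> (i + 1) then exchange i \<eta> else \<eta>)"

text \<open>The bond from \<open>R\<close> to \<open>R + 1\<close> is replaced by removal at
  \<open>R\<close>, so the sites \<open>1, ..., R\<close> form a closed system.\<close>

definition chain_letter :: "nat \<Rightarrow> nat \<Rightarrow> config \<Rightarrow> config" where
  "chain_letter R i \<eta> = (if i = R then \<eta>(R := \<infinity>) else letter i \<eta>)"

definition chain_rate :: "real \<Rightarrow> real \<Rightarrow> nat \<Rightarrow> nat \<Rightarrow> real" where
  "chain_rate \<alpha> \<beta> R i = (if i = 0 then \<alpha> else if i = R then \<beta> else 1)"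

abbreviation chain_gen where
  "chain_gen \<alpha> \<beta> R \<equiv> gen (chain_rate \<alpha> \<beta> R) (chain_letter R) R"

abbreviation chain_evol where
  "chain_evol \<alpha> \<beta> R \<equiv> evol (chain_rate \<alpha> \<beta> R) (chain_letter R) R"

text \<open>Unlike \<open>local_function\<close>, this ranges over all functions, so no membership
  in \<open>config_space\<close> has to be carried through the chains; it also names the number of
  sites.\<close>

definition depends_on :: "nat \<Rightarrow> (config \<Rightarrow> real) \<Rightarrow> bool" where
  "depends_on n g \<longleftrightarrow> (\<forall>\<eta> \<zeta>. (\<forall>x\<in>{1..n}. \<eta> x = \<zeta> x) \<longrightarrow> g \<eta> = g \<zeta>)"

lemma depends_onD: "depends_on n g \<Longrightarrow> (\<And>x. 1 \<le> x \<Longrightarrow> x \<le> n \<Longrightarrow> \<eta> x = \<zeta> x) \<Longrightarrow> g \<eta> = g \<zeta>"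
  by (auto simp: depends_on_def)

lemma depends_on_mono: "depends_on n g \<Longrightarrow> n \<le> m \<Longrightarrow> depends_on m g"
  by (auto simp: depends_on_def)

lemma depends_on_local: "depends_on n g \<Longrightarrow> local_function g"
  by (auto simp: depends_on_def local_function_def)

lemma chain_rate_nonneg: "0 \<le> \<alpha> \<Longrightarrow> 0 \<le> \<beta> \<Longrightarrow> 0 \<le> chain_rate \<alpha> \<beta> R i"
  by (simp add: chain_rate_def)

text \<open>Thresholding commutes with the dynamics: the sites with color below \<open>c\<close> evolve autonomously.\<close>

lemma letter_less:
  assumes "1 < c" "1 \<le> s"
  shows "letter i \<eta> s < c \<longleftrightarrow>
    (if i = 0 then s = 1 \<or> \<eta> s < c
     else if s = i then \<eta> i < c \<and> \<eta> (i + 1) < c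
     else if s = i + 1 then \<eta> i < c \<or> \<eta> (i + 1) < c
     else \<eta> s < c)"
  using assms by (auto simp: letter_def inject_def exchange_def)

lemma letter_other: "x \<noteq> i \<Longrightarrow> x \<noteq> i + 1 \<Longrightarrow> letter i \<eta> x = \<eta> x"
  by (auto simp: letter_def inject_def exchange_def)

lemma letter_cong:
  assumes "\<And>x. 1 \<le> x \<Longrightarrow> x \<le> n \<Longrightarrow> \<eta> x = \<zeta> x" "i < n" "1 \<le> x" "x \<le> n"
  shows "letter i \<eta> x = letter i \<zeta> x"
proof (cases "i = 0")
  case False
  then have "\<eta> i = \<zeta> i" "\<eta> (i + 1) = \<zeta> (i + 1)" "\<eta> x = \<zeta> x"
    using assms(1)[of i] assms(1)[of "i + 1"] assms(1)[of x] assms(2-) by auto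
  then show ?thesis using False by (auto simp: letter_def exchange_def)
next
  case True
  then have "\<eta> 1 = \<zeta> 1" "\<eta> x = \<zeta> x" using assms(1)[of 1] assms(1)[of x] assms(2-) by auto
  then show ?thesis using True by (auto simp: letter_def inject_def)
qed

lemma depends_on_letter_eq: "depends_on n g \<Longrightarrow> n < i \<Longrightarrow> g (letter i \<eta>) = g \<eta>"
  by (rule depends_onD[of n g]) (auto simp: letter_other)

text \<open>Bonds beyond \<open>n\<close> leave \<open>g\<close> unchanged, and so does removal at
  \<open>R > n\<close>. Hence the exit rate \<beta> can be anything.\<close>

lemma chain_gen_eq_tasep_generator:
  assumes "depends_on n g" "n < R"
  shows "chain_gen \<alpha> \<beta> R g = tasep_generator \<alpha> g"
proof
  fix \<eta>
  let ?f = "\<lambda>x. if \<eta> x < \<eta> (x + 1) then g (exchange x \<eta>) - g \<eta> else 0"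
  have f: "?f x = g (letter x \<eta>) - g \<eta>" if "1 \<le> x" for x
    using that by (auto simp: letter_def)
  have "infsum ?f {1..} = infsum ?f {1..<R}"
  proof (rule infsum_cong_neutral)
    fix x assume "x \<in> {1..} - {1..<R}"
    then show "?f x = 0" using f[of x] depends_on_letter_eq[OF assms(1), of x \<eta>] assms(2) by force
  qed auto
  also have "\<dots> = (\<Sum>x\<in>{1..<R}. g (letter x \<eta>) - g \<eta>)"
    using f by simp
  finally have *: "infsum ?f {1..} = (\<Sum>x\<in>{1..<R}. g (letter x \<eta>) - g \<eta>)" .
  have R: "{..R} = insert 0 (insert R {1..<R})" using assms(2) by auto
  have "g (\<eta>(R := \<infinity>)) = g \<eta>" using assms by (intro depends_onD[of n g]) auto
  then have "chain_gen \<alpha> \<beta> R g \<eta>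
      = \<alpha> * (g (letter 0 \<eta>) - g \<eta>) + (\<Sum>x\<in>{1..<R}. g (letter x \<eta>) - g \<eta>)"
    using assms(2) unfolding gen_def R by (simp add: chain_rate_def chain_letter_def)
  then show "chain_gen \<alpha> \<beta> R g \<eta> = tasep_generator \<alpha> g \<eta>"
    unfolding tasep_generator_def * by (simp add: letter_def)
qed

text \<open>The bond at \<open>n\<close> reads site \<open>n + 1\<close>, so the support grows by
  one site; the chain of length \<open>n + 1\<close> exhibits the generator as a finite sum.\<close>

lemma depends_on_tasep_generator:
  assumes "depends_on n g"
  shows "depends_on (Suc n) (tasep_generator \<alpha> g)"
  unfolding depends_on_def
proof (intro allI impI)
  fix \<eta> \<zeta> :: config assume eq: "\<forall>x\<in>{1..Suc n}. \<eta> x = \<zeta> x"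
  have "g (chain_letter (Suc n) i \<eta>) = g (chain_letter (Suc n) i \<zeta>)" if "i \<le> Suc n" for i
    using that eq by (intro depends_onD[OF assms])
      (auto simp: chain_letter_def intro!: letter_cong[of "Suc n"])
  moreover have "g \<eta> = g \<zeta>" using eq by (intro depends_onD[OF assms]) auto
  ultimately show "tasep_generator \<alpha> g \<eta> = tasep_generator \<alpha> g \<zeta>"
    unfolding chain_gen_eq_tasep_generator[OF assms lessI, of \<alpha> 0, symmetric] gen_def
    by (intro sum.cong) auto
qed

lemma tasep_generator_bounded:
  assumes "depends_on n g" "\<And>\<eta>. \<bar>g \<eta>\<bar> \<le> B" "0 \<le> \<alpha>" "\<alpha> \<le> 1"
  shows "\<bar>tasep_generator \<alpha> g \<eta>\<bar> \<le> 2 * real (Suc n) * B"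
proof -
  \<comment> \<open>With exit rate 0 only the letters \<open>0, ..., n\<close> contribute, each at
    rate at most 1.\<close>
  let ?l = "\<Sum>i\<le>Suc n. chain_rate \<alpha> 0 (Suc n) i"
  have "?l = (\<Sum>i\<le>n. chain_rate \<alpha> 0 (Suc n) i)" by (simp add: chain_rate_def)
  also have "\<dots> \<le> (\<Sum>i\<le>n. 1)" by (intro sum_mono) (use assms in \<open>auto simp: chain_rate_def\<close>)
  finally have l: "?l \<le> real (Suc n)" by simp
  have "\<bar>tasep_generator \<alpha> g \<eta>\<bar> \<le> 2 * ?l * B"
    unfolding chain_gen_eq_tasep_generator[OF assms(1) lessI, of \<alpha> 0, symmetric]
    by (intro gen_bounded chain_rate_nonneg assms) simp
  also have "0 \<le> B" using assms(2)[of \<eta>] by simp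
  then have "2 * ?l * B \<le> 2 * real (Suc n) * B" using l by (intro mult_right_mono) auto
  finally show ?thesis by simp
qed

lemma depends_on_pow:
  assumes "depends_on n g"
  shows "depends_on (n + k) ((tasep_generator \<alpha> ^^ k) g)"
  by (induction k) (use assms depends_on_tasep_generator in auto)

text \<open>The j-th application costs a factor \<open>2 * (n + j)\<close>, because the support has
  grown meanwhile. With this factorial growth the Taylor series is controlled only on a bounded time
  interval, which forces the short time steps below.\<close>

lemma tasep_generator_pow_bounded:
  assumes "depends_on n g" "\<And>\<eta>. \<bar>g \<eta>\<bar> \<le> B" "0 \<le> \<alpha>" "\<alpha> \<le> 1"
  shows "\<bar>(tasep_generator \<alpha> ^^ k) g \<eta>\<bar> \<le> 2 ^ k * (fact (n + k) / fact n) * B"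
proof (induction k arbitrary: \<eta>)
  case (Suc k)
  have "\<bar>(tasep_generator \<alpha> ^^ Suc k) g \<eta>\<bar>
      \<le> 2 * real (Suc (n + k)) * (2 ^ k * (fact (n + k) / fact n) * B)"
    using tasep_generator_bounded[OF depends_on_pow[OF assms(1)] Suc.IH assms(3,4)] by simp
  then show ?case by (simp add: field_simps)
qed (use assms in simp)

text \<open>On time intervals of length \<open>1/8\<close> the Taylor remainder decays geometrically in the order.\<close>

lemma taylor_remainder_bound:
  assumes "0 \<le> h" "h \<le> 1/8" "0 \<le> B"
  shows "(2 ^ Suc k * (fact (n + Suc k) / fact n) * B) * h ^ Suc k / fact k
           \<le> B * real (Suc n) * 2 ^ n * (1/2) ^ Suc k"
proof -
  have "fact (n + Suc k) / (fact n * fact k) = real (Suc n) * real (Suc n + k choose k)"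
  proof -
    have "real (Suc n + k choose k) = fact (n + Suc k) / (fact k * fact (Suc n))"
      using binomial_fact[of k "Suc n + k", where ?'a = real] by simp
    also have "\<dots> = fact (n + Suc k) / (fact k * (real (Suc n) * fact n))"
      unfolding fact_Suc of_nat_mult ..
    finally show ?thesis by (simp del: fact_Suc of_nat_Suc)
  qed
  also have "\<dots> \<le> real (Suc n) * 2 ^ (Suc n + k)"
  proof (intro mult_left_mono)
    show "real (Suc n + k choose k) \<le> 2 ^ (Suc n + k)"
      using binomial_le_pow2[of "Suc n + k" k] by (metis of_nat_le_iff of_nat_numeral of_nat_power)
  qed simp
  finally have 1: "fact (n + Suc k) / (fact n * fact k) \<le> real (Suc n) * 2 ^ (Suc n + k)" .
  \<comment> \<open>Of the three factors 2 in 8, one absorbs the constant of the generator bound,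
    one the power of 2 bounding the binomial coefficient, and one leaves the decay.\<close>
  have 2: "h ^ Suc k \<le> (1/8) ^ Suc k" using assms by (intro power_mono) auto
  have "(2 ^ Suc k * (fact (n + Suc k) / fact n) * B) * h ^ Suc k / fact k
      = B * (fact (n + Suc k) / (fact n * fact k)) * (2 ^ Suc k * h ^ Suc k)"
    by (simp add: field_simps)
  also have "\<dots> \<le> B * (real (Suc n) * 2 ^ (Suc n + k)) * (2 ^ Suc k * (1/8) ^ Suc k)"
    using assms 1 2 by (intro mult_mono mult_left_mono) auto
  also have "\<dots> = B * real (Suc n) * 2 ^ n * (2 ^ Suc k * (2 ^ Suc k * (1/8) ^ Suc k))"
    by (simp add: power_add algebra_simps)
  also have "2 ^ Suc k * (2 ^ Suc k * (1/8) ^ Suc k) = (1/2 :: real) ^ Suc k"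
    by (simp only: power_mult_distrib[symmetric]) simp
  finally show ?thesis by simp
qed

text \<open>Finitely many sites with finitely many colors form a finite discrete space, on which
  every function is measurable.\<close>

lemma depends_on_measurable:
  assumes "depends_on n g"
  shows "g \<in> borel_measurable config_space"
proof -
  let ?C = "count_space {1, 2, \<infinity> :: enat}"
  have "(\<lambda>\<eta>. restrict \<eta> {1..n}) \<in> config_space \<rightarrow>\<^sub>M PiM {1..n} (\<lambda>_. ?C)"
    unfolding config_space_def by (intro measurable_restrict_subset) auto
  also have "PiM {1..n} (\<lambda>_. ?C) = count_space (PiE {1..n} (\<lambda>_. {1, 2, \<infinity>}))"
    by (intro count_space_PiM_finite) auto
  finally have "(\<lambda>\<eta>. g (restrict \<eta> {1..n})) \<in> borel_measurable config_space"
    by (rule measurable_compose) simp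
  moreover have "g (restrict \<eta> {1..n}) = g \<eta>" for \<eta>
    by (intro depends_onD[OF assms]) auto
  ultimately show ?thesis by simp
qed

section \<open>The Kolmogorov equation for a given semigroup\<close>

lemma tasep_semigroup_kernel:
  assumes "tasep_semigroup \<alpha> S" "0 \<le> t" "\<eta> \<in> space config_space"
  shows "prob_space (S t \<eta>)" "sets (S t \<eta>) = sets config_space"
proof -
  have "S t \<in> config_space \<rightarrow>\<^sub>M prob_algebra config_space"
    using assms by (simp add: tasep_semigroup_def)
  from measurable_space[OF this assms(3)]
  show "prob_space (S t \<eta>)" "sets (S t \<eta>) = sets config_space"
    by (auto simp: space_prob_algebra)
qed

lemma tasep_semigroup_integrable:
  fixes g :: "config \<Rightarrow> real"
  assumes "tasep_semigroup \<alpha> S" "0 \<le> t" "\<eta> \<in> space config_space"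
    and "g \<in> borel_measurable config_space" "\<And>\<zeta>. \<zeta> \<in> space config_space \<Longrightarrow> \<bar>g \<zeta>\<bar> \<le> B"
  shows "integrable (S t \<eta>) g" "\<bar>\<integral>\<zeta>. g \<zeta> \<partial>S t \<eta>\<bar> \<le> B"
proof -
  interpret prob_space "S t \<eta>" by (rule tasep_semigroup_kernel[OF assms(1-3)])
  note [measurable_cong] = tasep_semigroup_kernel(2)[OF assms(1-3)]
  have sp: "space (S t \<eta>) = space config_space"
    by (rule sets_eq_imp_space_eq) (rule tasep_semigroup_kernel[OF assms(1-3)])
  show i: "integrable (S t \<eta>) g"
    by (rule integrable_const_bound[where B = B]) (use assms(4,5) sp in auto)
  have "\<bar>\<integral>\<zeta>. g \<zeta> \<partial>S t \<eta>\<bar> \<le> (\<integral>\<zeta>. \<bar>g \<zeta>\<bar> \<partial>S t \<eta>)" by (rule integral_abs_bound)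
  also have "\<dots> \<le> (\<integral>\<zeta>. B \<partial>S t \<eta>)"
    by (intro integral_mono integrable_abs i) (use assms(5) sp in auto)
  finally show "\<bar>\<integral>\<zeta>. g \<zeta> \<partial>S t \<eta>\<bar> \<le> B" by (simp add: prob_space)
qed

lemma tasep_semigroup_add:
  fixes g :: "config \<Rightarrow> real"
  assumes S: "tasep_semigroup \<alpha> S" and st: "0 \<le> s" "0 \<le> t" and \<eta>: "\<eta> \<in> space config_space"
    and g: "g \<in> borel_measurable config_space" "\<And>\<zeta>. \<zeta> \<in> space config_space \<Longrightarrow> \<bar>g \<zeta>\<bar> \<le> B"
  shows "(\<integral>\<zeta>. g \<zeta> \<partial>S (s + t) \<eta>) = (\<integral>\<xi>. (\<integral>\<zeta>. g \<zeta> \<partial>S t \<xi>) \<partial>S s \<eta>)"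
    and "(\<lambda>\<xi>. \<integral>\<zeta>. g \<zeta> \<partial>S t \<xi>) \<in> borel_measurable config_space"
proof -
  have St [measurable]: "S t \<in> config_space \<rightarrow>\<^sub>M subprob_algebra config_space"
    using S st by (auto simp: tasep_semigroup_def intro: measurable_prob_algebraD)
  note K = tasep_semigroup_kernel[OF S st(1) \<eta>]
  interpret prob_space "S s \<eta>" by (rule K)
  note [measurable_cong] = K(2)
  note [measurable] = g(1)
  have sp: "space (S s \<eta>) = space config_space"
    by (rule sets_eq_imp_space_eq) (rule K)
  have "S (s + t) \<eta> = S s \<eta> \<bind> S t" using S st \<eta> by (simp add: tasep_semigroup_def)
  moreover have "(\<integral>\<zeta>. g \<zeta> \<partial>(S s \<eta> \<bind> S t)) = (\<integral>\<xi>. (\<integral>\<zeta>. g \<zeta> \<partial>S t \<xi>) \<partial>S s \<eta>)"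
  proof (rule integral_bind[where K = config_space and B = B and B' = 1])
    show "S t \<in> S s \<eta> \<rightarrow>\<^sub>M subprob_algebra config_space" by measurable
    show "AE x in S s \<eta>. emeasure (S t x) (space (S t x)) \<le> ennreal 1"
      using tasep_semigroup_kernel(1)[OF S st(2)] sp
      by (auto intro!: AE_I2 simp: prob_space.emeasure_space_1)
  qed (use g sp finite_measure_axioms in auto)
  ultimately show "(\<integral>\<zeta>. g \<zeta> \<partial>S (s + t) \<eta>) = (\<integral>\<xi>. (\<integral>\<zeta>. g \<zeta> \<partial>S t \<xi>) \<partial>S s \<eta>)" by simp
  show "(\<lambda>\<xi>. \<integral>\<zeta>. g \<zeta> \<partial>S t \<xi>) \<in> borel_measurable config_space" by measurable
qed

text \<open>Integrating the uniform generator limit against the law at time \<open>s\<close> gives a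
  step size \<open>d\<close> that works for all \<open>s\<close> at once. This uniformity yields
  left derivatives as well.\<close>

lemma tasep_semigroup_increment:
  assumes S: "tasep_semigroup \<alpha> S" and \<alpha>: "0 \<le> \<alpha>" "\<alpha> \<le> 1" and \<eta>: "\<eta> \<in> space config_space"
    and g: "depends_on n g" "\<And>\<eta>. \<bar>g \<eta>\<bar> \<le> B" and e: "0 < e"
  shows "\<exists>d>0. \<forall>s\<ge>0. \<forall>h. 0 \<le> h \<and> h < d \<longrightarrow>
    \<bar>(\<integral>\<zeta>. g \<zeta> \<partial>S (s + h) \<eta>) - (\<integral>\<zeta>. g \<zeta> \<partial>S s \<eta>) - h * (\<integral>\<zeta>. tasep_generator \<alpha> g \<zeta> \<partial>S s \<eta>)\<bar> \<le> e * h"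
proof -
  let ?L = "tasep_generator \<alpha> g" and ?u = "\<lambda>h \<xi>. \<integral>\<zeta>. g \<zeta> \<partial>S h \<xi>"
  have "uniform_limit (space config_space) (\<lambda>h \<eta>. (?u h \<eta> - g \<eta>) / h) ?L (at_right 0)"
    using S depends_on_local[OF g(1)] by (simp add: tasep_semigroup_def)
  from uniform_limitD[OF this e] obtain d where d: "d > 0"
    "\<And>h \<xi>. 0 < h \<Longrightarrow> h < d \<Longrightarrow> \<xi> \<in> space config_space \<Longrightarrow> dist ((?u h \<xi> - g \<xi>) / h) (?L \<xi>) < e"
    unfolding eventually_at_right_field by blast
  note gm = depends_on_measurable[OF g(1)]
  have Lm: "?L \<in> borel_measurable config_space"
    by (rule depends_on_measurable[OF depends_on_tasep_generator[OF g(1)]])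
  have Lb: "\<bar>?L \<xi>\<bar> \<le> 2 * real (Suc n) * B" for \<xi>
    by (rule tasep_generator_bounded[OF g \<alpha>])
  show ?thesis
  proof (intro exI[of _ d] conjI allI impI \<open>d > 0\<close>)
    fix s h :: real assume s: "s \<ge> 0" and h: "0 \<le> h \<and> h < d"
    show "\<bar>?u (s + h) \<eta> - ?u s \<eta> - h * (\<integral>\<zeta>. ?L \<zeta> \<partial>S s \<eta>)\<bar> \<le> e * h"
    proof (cases "h = 0")
      case False
      with h have h: "0 < h" "h < d" by auto
      note um = tasep_semigroup_add[OF S s less_imp_le[OF h(1)] \<eta> gm g(2)]
      have ub: "\<bar>?u h \<xi>\<bar> \<le> B" if "\<xi> \<in> space config_space" for \<xi>
        using tasep_semigroup_integrable(2)[OF S less_imp_le[OF h(1)] that gm g(2)] .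
      note int = tasep_semigroup_integrable[OF S s \<eta>]
      have i: "integrable (S s \<eta>) (?u h)" "integrable (S s \<eta>) g" "integrable (S s \<eta>) ?L"
        using int(1)[OF um(2) ub] int(1)[OF gm g(2)] int(1)[OF Lm Lb] by auto
      have "?u (s + h) \<eta> - ?u s \<eta> - h * (\<integral>\<zeta>. ?L \<zeta> \<partial>S s \<eta>)
          = (\<integral>\<xi>. ?u h \<xi> - g \<xi> - h * ?L \<xi> \<partial>S s \<eta>)"
        using i by (simp add: um(1))
      also have "\<bar>\<dots>\<bar> \<le> e * h"
      proof (rule int(2))
        show "(\<lambda>\<xi>. ?u h \<xi> - g \<xi> - h * ?L \<xi>) \<in> borel_measurable config_space"
          using um(2) gm Lm by measurable
        fix \<xi> assume "\<xi> \<in> space config_space"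
        from d(2)[OF h this] have "\<bar>(?u h \<xi> - g \<xi>) / h - ?L \<xi>\<bar> * h \<le> e * h"
          using h by (intro mult_right_mono) (auto simp: dist_real_def)
        also have "\<bar>(?u h \<xi> - g \<xi>) / h - ?L \<xi>\<bar> * h = \<bar>((?u h \<xi> - g \<xi>) / h - ?L \<xi>) * h\<bar>"
          using h by (simp add: abs_mult)
        also have "((?u h \<xi> - g \<xi>) / h - ?L \<xi>) * h = ?u h \<xi> - g \<xi> - h * ?L \<xi>"
          using h by (simp add: field_simps)
        finally show "\<bar>?u h \<xi> - g \<xi> - h * ?L \<xi>\<bar> \<le> e * h" .
      qed
      finally show ?thesis .
    qed simp
  qed
qed

text \<open>From the right this is \<open>tasep_semigroup_increment\<close> at \<open>t\<close>.
  From the left the increment starts at \<open>y < t\<close> and has the slope at \<open>y\<close>;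
  that slope may be replaced by the one at \<open>t\<close> because the same lemma, applied to the
  image of \<open>g\<close> under the generator, makes slopes Lipschitz at short range with constant
  \<open>1 + C\<close>.\<close>

lemma tasep_semigroup_has_derivative:
  assumes S: "tasep_semigroup \<alpha> S" and \<alpha>: "0 \<le> \<alpha>" "\<alpha> \<le> 1" and \<eta>: "\<eta> \<in> space config_space"
    and g: "depends_on n g" "\<And>\<eta>. \<bar>g \<eta>\<bar> \<le> B" and t: "0 \<le> t"
  shows "((\<lambda>t. \<integral>\<zeta>. g \<zeta> \<partial>S t \<eta>) has_real_derivative (\<integral>\<zeta>. tasep_generator \<alpha> g \<zeta> \<partial>S t \<eta>))
    (at t within {0..})"
proof -
  let ?L = "tasep_generator \<alpha>"
  let ?u = "\<lambda>t. \<integral>\<zeta>. g \<zeta> \<partial>S t \<eta>" and ?v = "\<lambda>t. \<integral>\<zeta>. ?L g \<zeta> \<partial>S t \<eta>"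
    and ?w = "\<lambda>t. \<integral>\<zeta>. ?L (?L g) \<zeta> \<partial>S t \<eta>"
  note L = depends_on_tasep_generator[OF g(1), of \<alpha>] tasep_generator_bounded[OF g \<alpha>]
  note LL = depends_on_tasep_generator[OF L(1), of \<alpha>] tasep_generator_bounded[OF L \<alpha>]
  define C where "C = 2 * real (Suc (Suc n)) * (2 * real (Suc n) * B)"
  have C: "\<bar>?w s\<bar> \<le> C" if "0 \<le> s" for s
    using tasep_semigroup_integrable(2)[OF S that \<eta> depends_on_measurable[OF LL(1)] LL(2)]
    by (simp add: C_def)
  show ?thesis
    unfolding has_field_derivative_def has_derivative_within_alt
  proof (intro conjI allI impI bounded_linear_mult_right)
    fix e :: real assume e: "0 < e"
    then have e2: "0 < e / 2" by simp
    obtain d where d: "d > 0"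
      "\<And>s h. 0 \<le> s \<Longrightarrow> 0 \<le> h \<Longrightarrow> h < d \<Longrightarrow> \<bar>?u (s + h) - ?u s - h * ?v s\<bar> \<le> e / 2 * h"
      using tasep_semigroup_increment[OF S \<alpha> \<eta> g e2] by blast
    obtain d' where d': "d' > 0"
      "\<And>s h. 0 \<le> s \<Longrightarrow> 0 \<le> h \<Longrightarrow> h < d' \<Longrightarrow> \<bar>?v (s + h) - ?v s - h * ?w s\<bar> \<le> 1 * h"
      using tasep_semigroup_increment[OF S \<alpha> \<eta> L zero_less_one] by blast
    have C0: "0 \<le> C" using C[OF t] by simp
    define D where "D = min (min d d') (e / (2 * (1 + C)))"
    have D: "0 < D" "D \<le> d" "D \<le> d'" "D * (1 + C) \<le> e / 2"
    proof -
      show "0 < D" "D \<le> d" "D \<le> d'" using d d' e C0 by (auto simp: D_def)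
      have "D \<le> e / (2 * (1 + C))" by (simp add: D_def)
      then show "D * (1 + C) \<le> e / 2" using C0 by (simp add: field_simps)
    qed
    show "\<exists>d>0. \<forall>y\<in>{0..}. norm (y - t) < d \<longrightarrow>
        norm (?u y - ?u t - ?v t * (y - t)) \<le> e * norm (y - t)"
    proof (intro exI[of _ D] conjI ballI impI D)
      fix y :: real assume y: "y \<in> {0..}" "norm (y - t) < D"
      show "norm (?u y - ?u t - ?v t * (y - t)) \<le> e * norm (y - t)"
      proof (cases "t \<le> y")
        case True
        then have "\<bar>?u y - ?u t - (y - t) * ?v t\<bar> \<le> e / 2 * (y - t)"
          using d(2)[OF t, of "y - t"] y D by simp
        also have "\<dots> \<le> e * (y - t)" using True e by simp
        finally show ?thesis using True by (simp add: mult.commute)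
      next
        case False
        define h where "h = t - y"
        have h: "0 \<le> h" "h < D" "0 \<le> y" "t = y + h" using y False by (auto simp: h_def)
        have 1: "\<bar>?u t - ?u y - h * ?v y\<bar> \<le> e / 2 * h" using d(2)[OF h(3,1)] h D by simp
        have "\<bar>?v t - ?v y\<bar> \<le> \<bar>?v (y + h) - ?v y - h * ?w y\<bar> + \<bar>h * ?w y\<bar>" using h by simp
        also have "\<dots> \<le> 1 * h + h * C"
          using d'(2)[OF h(3,1)] h D C[OF h(3)] by (intro add_mono) (auto simp: abs_mult mult_left_mono)
        also have "\<dots> = h * (1 + C)" by (simp add: algebra_simps)
        also have "\<dots> \<le> D * (1 + C)" using h C0 by (intro mult_right_mono) auto
        finally have "\<bar>?v t - ?v y\<bar> \<le> e / 2" using D by simp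
        then have 2: "h * \<bar>?v t - ?v y\<bar> \<le> h * (e / 2)" using h by (intro mult_left_mono) auto
        have "?u y - ?u t - ?v t * (y - t) = - (?u t - ?u y - h * ?v y) + h * (?v t - ?v y)"
          by (simp add: h_def algebra_simps)
        moreover have "\<bar>- a + h * b\<bar> \<le> e * h"
          if "\<bar>a\<bar> \<le> e / 2 * h" "h * \<bar>b\<bar> \<le> h * (e / 2)" for a b
        proof -
          have "\<bar>- a + h * b\<bar> \<le> \<bar>a\<bar> + h * \<bar>b\<bar>"
            using abs_triangle_ineq[of "- a" "h * b"] h(1) by (simp add: abs_mult)
          also have "\<dots> \<le> e / 2 * h + h * (e / 2)" using that by (rule add_mono)
          finally show ?thesis by simp
        qed
        ultimately have "\<bar>?u y - ?u t - ?v t * (y - t)\<bar> \<le> e * h" using 1 2 by metis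
        then show ?thesis using False by (simp only: real_norm_def) (simp add: h_def)
      qed
    qed
  qed
qed

text \<open>Over a step of length at most 1/8 both sides have Taylor expansions whose coefficients
  are expectations of iterated generators at the start of the step, with a remainder bound
  independent of \<open>R\<close>. The induction over steps treats all local functions together
  because these iterates are again local.\<close>

lemma chain_evol_tendsto:
  assumes S: "tasep_semigroup \<alpha> S" and \<alpha>: "0 \<le> \<alpha>" "\<alpha> \<le> 1" and \<beta>: "0 \<le> \<beta>"
    and \<eta>: "\<eta> \<in> space config_space"
    and g: "depends_on n g" "\<And>\<eta>. \<bar>g \<eta>\<bar> \<le> B" and t: "0 \<le> t"
  shows "(\<lambda>R. chain_evol \<alpha> \<beta> R t g \<eta>) \<longlonglongrightarrow> (\<integral>\<zeta>. g \<zeta> \<partial>S t \<eta>)"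
proof -
  let ?L = "tasep_generator \<alpha>"
  have step: "(\<lambda>R. chain_evol \<alpha> \<beta> R t g \<eta>) \<longlonglongrightarrow> (\<integral>\<zeta>. g \<zeta> \<partial>S t \<eta>)"
    if g: "depends_on n g" "\<And>\<eta>. \<bar>g \<eta>\<bar> \<le> B" and s: "0 \<le> s" "s \<le> t" "t \<le> s + 1/8"
      and IH: "\<And>n B g. depends_on n g \<Longrightarrow> (\<And>\<eta>. \<bar>g \<eta>\<bar> \<le> B) \<Longrightarrow>
        (\<lambda>R. chain_evol \<alpha> \<beta> R s g \<eta>) \<longlonglongrightarrow> (\<integral>\<zeta>. g \<zeta> \<partial>S s \<eta>)" for n B g s t
  proof (rule LIMSEQ_I)
    fix e :: real assume e: "0 < e"
    have B: "0 \<le> B" using g(2)[of \<eta>] by simp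
    define \<epsilon> where "\<epsilon> k = B * real (Suc n) * 2 ^ n * (1/2) ^ Suc k" for k :: nat
    have "(\<lambda>k. B * real (Suc n) * 2 ^ n * (1/2) ^ Suc k) \<longlonglongrightarrow> B * real (Suc n) * 2 ^ n * 0"
      by (intro tendsto_mult_left LIMSEQ_Suc LIMSEQ_power_zero) auto
    then have "\<epsilon> \<longlonglongrightarrow> 0" by (simp add: \<epsilon>_def[abs_def])
    then obtain k where k: "\<epsilon> k < e / 3"
      using order_tendstoD(2)[of \<epsilon> 0 sequentially "e / 3"] e
      by (auto simp: eventually_sequentially)
    note gk = depends_on_pow[OF g(1), of _ \<alpha>] tasep_generator_pow_bounded[OF g \<alpha>]
    let ?C = "2 ^ Suc k * (fact (n + Suc k) / fact n) * B"
    define F where "F R = (\<Sum>i\<le>k. chain_evol \<alpha> \<beta> R s ((?L ^^ i) g) \<eta> * (t - s) ^ i / fact i)" for R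
    define F0 where "F0 = (\<Sum>i\<le>k. (\<integral>\<zeta>. (?L ^^ i) g \<zeta> \<partial>S s \<eta>) * (t - s) ^ i / fact i)"
    have rem: "?C * norm (t - s) ^ Suc k / fact k \<le> \<epsilon> k"
      using taylor_remainder_bound[of "t - s" B k n] s B unfolding \<epsilon>_def by simp
    have t0: "norm ((\<integral>\<zeta>. g \<zeta> \<partial>S t \<eta>) - F0) \<le> \<epsilon> k"
    proof -
      have "norm ((\<integral>\<zeta>. (?L ^^ 0) g \<zeta> \<partial>S t \<eta>) - F0) \<le> ?C * norm (t - s) ^ Suc k / fact k"
        unfolding F0_def
      proof (rule field_Taylor[of "{0..}"])
        fix i x assume "x \<in> {0::real..}" "i \<le> k"
        then show "((\<lambda>t. \<integral>\<zeta>. (?L ^^ i) g \<zeta> \<partial>S t \<eta>) has_real_derivative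
            (\<integral>\<zeta>. (?L ^^ Suc i) g \<zeta> \<partial>S x \<eta>)) (at x within {0..})"
          using tasep_semigroup_has_derivative[OF S \<alpha> \<eta> gk[of i], of x] by simp
      next
        fix x assume "x \<in> {0::real..}"
        then show "norm (\<integral>\<zeta>. (?L ^^ Suc k) g \<zeta> \<partial>S x \<eta>) \<le> ?C"
          unfolding real_norm_def
          by (intro tasep_semigroup_integrable(2)[OF S _ \<eta> depends_on_measurable[OF gk(1)]] gk(2)) simp
      qed (use s in auto)
      then show ?thesis using rem by simp
    qed
    \<comment> \<open>All iterates up to order \<open>k\<close> depend on fewer than
      \<open>R\<close> sites, so the chain generator acts on them as the true one.\<close>
    have tR: "norm (chain_evol \<alpha> \<beta> R t g \<eta> - F R) \<le> \<epsilon> k" if R: "n + Suc k \<le> R" for R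
    proof -
      have nn: "\<And>i. i \<le> R \<Longrightarrow> 0 \<le> chain_rate \<alpha> \<beta> R i" using \<alpha> \<beta> by (simp add: chain_rate_nonneg)
      have "norm (chain_evol \<alpha> \<beta> R t ((?L ^^ 0) g) \<eta> - F R) \<le> ?C * norm (t - s) ^ Suc k / fact k"
        unfolding F_def
      proof (rule field_Taylor[of "{0..}"])
        fix i x assume x: "x \<in> {0::real..}" "i \<le> k"
        have "chain_gen \<alpha> \<beta> R ((?L ^^ i) g) = (?L ^^ Suc i) g"
          using chain_gen_eq_tasep_generator[OF gk(1), of i R \<alpha> \<beta>] R x by simp
        moreover have "((\<lambda>t. chain_evol \<alpha> \<beta> R t ((?L ^^ i) g) \<eta>) has_real_derivative
            (chain_evol \<alpha> \<beta> R x (chain_gen \<alpha> \<beta> R ((?L ^^ i) g)) \<eta>)) (at x within {0..})"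
          by (rule evol_has_derivative[OF nn gk(2)[of i]])
        ultimately show "((\<lambda>t. chain_evol \<alpha> \<beta> R t ((?L ^^ i) g) \<eta>) has_real_derivative
            (chain_evol \<alpha> \<beta> R x ((?L ^^ Suc i) g) \<eta>)) (at x within {0..})" by (simp only:)
      next
        fix x assume "x \<in> {0::real..}"
        then show "norm (chain_evol \<alpha> \<beta> R x ((?L ^^ Suc k) g) \<eta>) \<le> ?C"
          unfolding real_norm_def by (intro evol_bounded[OF nn gk(2)[of "Suc k"]]) simp_all
      qed (use s in auto)
      then show ?thesis using rem by simp
    qed
    have "F \<longlonglongrightarrow> F0" unfolding F_def[abs_def] F0_def
      by (intro tendsto_sum tendsto_divide tendsto_mult_right tendsto_const IH[OF gk]) auto
    then obtain R0 where R0: "\<And>R. R0 \<le> R \<Longrightarrow> norm (F R - F0) < e / 3"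
      using LIMSEQ_D[of F F0 "e / 3"] e by auto
    show "\<exists>R1. \<forall>R\<ge>R1. norm (chain_evol \<alpha> \<beta> R t g \<eta> - (\<integral>\<zeta>. g \<zeta> \<partial>S t \<eta>)) < e"
    proof (intro exI[of _ "max R0 (n + Suc k)"] allI impI)
      fix R assume "max R0 (n + Suc k) \<le> R"
      then have "norm (F R - F0) < e / 3" "norm (chain_evol \<alpha> \<beta> R t g \<eta> - F R) \<le> \<epsilon> k"
        using R0 tR by auto
      with k t0 show "norm (chain_evol \<alpha> \<beta> R t g \<eta> - (\<integral>\<zeta>. g \<zeta> \<partial>S t \<eta>)) < e"
        unfolding real_norm_def by linarith
    qed
  qed
  have "(\<lambda>R. chain_evol \<alpha> \<beta> R t g \<eta>) \<longlonglongrightarrow> (\<integral>\<zeta>. g \<zeta> \<partial>S t \<eta>)"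
    if "0 \<le> t" "t \<le> real j / 8" "depends_on n g" "\<And>\<eta>. \<bar>g \<eta>\<bar> \<le> B" for j t n B g
    using that
  proof (induction j arbitrary: t n B g)
    case 0
    have "S 0 \<eta> = return config_space \<eta>" using S \<eta> by (simp add: tasep_semigroup_def)
    then have "(\<integral>\<zeta>. g \<zeta> \<partial>S 0 \<eta>) = g \<eta>"
      using \<eta> depends_on_measurable[OF 0(3)] by (simp add: integral_return)
    with 0 show ?case by simp
  next
    case (Suc j)
    define s where "s = max 0 (t - 1/8)"
    have s: "0 \<le> s" "s \<le> t" "t \<le> s + 1/8" "s \<le> real j / 8"
      using Suc.prems(1,2) by (auto simp: s_def max_def)
    show ?case by (rule step[OF Suc.prems(3,4) s(1-3) Suc.IH[OF s(1,4)]])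
  qed
  moreover have "t \<le> real (nat \<lceil>8 * t\<rceil>) / 8"
    using real_nat_ceiling_ge[of "8 * t"] by simp
  ultimately show ?thesis using t g by blast
qed

section \<open>Duality\<close>

definition suffix_excess :: "enat \<Rightarrow> nat \<Rightarrow> config \<Rightarrow> config \<Rightarrow> nat \<Rightarrow> int" where
  "suffix_excess c R \<eta> \<xi> x = (\<Sum>y\<in>{x<..R}. of_bool (\<xi> y < 2) - of_bool (c \<le> \<eta> y))"

text \<open>By Hall's theorem, minus this number counts the sites of \<eta> in
  \<open>1, ..., R\<close> of color at least \<open>c\<close> left over by a largest matching that
  pairs such a site with a particle of \<xi> at the same site or to its right, up to
  \<open>R\<close>. The index \<open>R\<close> contributes the empty sum 0.\<close>

definition duality_fun :: "enat \<Rightarrow> nat \<Rightarrow> config \<Rightarrow> config \<Rightarrow> int" where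
  "duality_fun c R \<eta> \<xi> = Min (suffix_excess c R \<eta> \<xi> ` {..R})"

lemma sum_split_greaterThanAtMost:
  fixes f :: "nat \<Rightarrow> int"
  assumes "a \<le> b" "b \<le> c"
  shows "sum f {a<..c} = sum f {a<..b} + sum f {b<..c}"
proof -
  have "{a<..c} = {a<..b} \<union> {b<..c}" using assms by auto
  then show ?thesis by (simp add: sum.union_disjoint)
qed

lemma Min_image_le:
  fixes f g :: "nat \<Rightarrow> int"
  assumes "\<And>x. x \<le> R \<Longrightarrow> \<exists>j\<le>R. f j \<le> g x"
  shows "Min (f ` {..R}) \<le> Min (g ` {..R})"
proof (rule Min.boundedI)
  fix z assume "z \<in> g ` {..R}"
  then obtain x where "x \<le> R" "z = g x" by auto
  with assms obtain j where "j \<le> R" "f j \<le> z" by blast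
  then show "Min (f ` {..R}) \<le> z" by (intro Min.coboundedI[THEN order_trans]) auto
qed auto

lemma Min_image_eq:
  fixes f g :: "nat \<Rightarrow> int"
  assumes eq: "\<And>x. x \<noteq> i \<Longrightarrow> f x = g x"
    and i: "f i = g i \<or> (\<exists>j\<le>R. j \<noteq> i \<and> f j \<le> f i) \<and> (\<exists>j\<le>R. j \<noteq> i \<and> f j \<le> g i)"
  shows "Min (f ` {..R}) = Min (g ` {..R})"
proof (rule antisym; rule Min_image_le)
  show "\<exists>j\<le>R. f j \<le> g x" if "x \<le> R" for x
    using that eq[of x] i by (cases "x = i") auto
  show "\<exists>j\<le>R. g j \<le> f x" if "x \<le> R" for x
  proof (cases "x = i")
    case True
    then show ?thesis using that i eq by (metis order.refl)
  next
    case False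
    then show ?thesis using that eq[of x] by auto
  qed
qed

text \<open>Mass \<open>d\<close> moves from site \<open>i\<close> to \<open>i + 1\<close>; only the
  suffix starting just after \<open>i\<close> contains one of the two sites without the other. For
  \<open>i = 0\<close> the mass comes from outside, as in an injection.\<close>

lemma sum_suffix_transfer:
  fixes b b' :: "nat \<Rightarrow> int"
  assumes "i < R" "b' (i + 1) = b (i + 1) + d" "1 \<le> i \<Longrightarrow> b' i = b i - d"
    and other: "\<And>y. 1 \<le> y \<Longrightarrow> y \<noteq> i \<Longrightarrow> y \<noteq> i + 1 \<Longrightarrow> b' y = b y"
  shows "sum b' {x<..R} = sum b {x<..R} + (if x = i then d else 0)"
proof -
  have "sum b' {x<..R} - sum b {x<..R} = (\<Sum>y\<in>{x<..R}. b' y - b y)"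
    by (simp add: sum_subtractf)
  also have "\<dots> = (\<Sum>y\<in>{x<..R}. (if y = i + 1 then d else 0) + (if y = i then - d else 0))"
    using assms by (intro sum.cong) auto
  also have "\<dots> = (if i + 1 \<in> {x<..R} then d else 0) + (if i \<in> {x<..R} then - d else 0)"
    by (simp add: sum.distrib)
  finally show ?thesis using assms(1) by (cases "x < i"; cases "x = i") auto
qed

lemma suffix_excess_letter_left:
  assumes "1 < c" "i < R"
  shows "suffix_excess c R (letter i \<eta>) \<xi> x = suffix_excess c R \<eta> \<xi> x
    + (if x = i then of_bool ((i = 0 \<or> \<eta> i < c) \<and> c \<le> \<eta> (i + 1)) else 0)"
  unfolding suffix_excess_def
  by (rule sum_suffix_transfer[OF assms(2)])
     (use assms(1) in \<open>auto simp: letter_less not_less[symmetric]\<close>)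

lemma suffix_excess_letter_right:
  assumes "i < R"
  shows "suffix_excess c R \<eta> (letter i \<xi>) x = suffix_excess c R \<eta> \<xi> x
    + (if x = i then of_bool ((i = 0 \<or> \<xi> i < 2) \<and> \<not> \<xi> (i + 1) < 2) else 0)"
  unfolding suffix_excess_def
  by (rule sum_suffix_transfer[OF assms]) (auto simp: letter_less)

lemma suffix_excess_step:
  assumes "x < R"
  shows "suffix_excess c R \<eta> \<xi> x
    = suffix_excess c R \<eta> \<xi> (x + 1) + of_bool (\<xi> (x + 1) < 2) - of_bool (c \<le> \<eta> (x + 1))"
proof -
  have "{x<..R} = insert (x + 1) {x + 1<..R}" using assms by auto
  then show ?thesis by (simp add: suffix_excess_def)
qed

text \<open>Either use of the letter can only raise the excess at index \<open>i\<close>, by one.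
  When just one of them does, a neighboring index already lies at or below the unraised value, so
  the minimum does not notice.\<close>

lemma duality_fun_letter:
  assumes c: "1 < c" and i: "i < R"
  shows "duality_fun c R (letter i \<eta>) \<xi> = duality_fun c R \<eta> (letter i \<xi>)"
  unfolding duality_fun_def
proof (rule Min_image_eq[of i])
  let ?s = "suffix_excess c R \<eta> \<xi>"
  let ?f = "suffix_excess c R (letter i \<eta>) \<xi>" and ?g = "suffix_excess c R \<eta> (letter i \<xi>)"
  note simps = suffix_excess_letter_left[OF c i] suffix_excess_letter_right[OF i]
  show "?f x = ?g x" if "x \<noteq> i" for x using that by (simp add: simps)
  note st = suffix_excess_step[OF i, of c \<eta> \<xi>]
  have st': "i \<noteq> 0 \<Longrightarrow> ?s (i - 1) = ?s i + of_bool (\<xi> i < 2) - of_bool (c \<le> \<eta> i)"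
    using suffix_excess_step[of "i - 1" R c \<eta> \<xi>] i by simp
  have ex: "P (i + 1) \<Longrightarrow> \<exists>j\<le>R. j \<noteq> i \<and> P j" "i \<noteq> 0 \<Longrightarrow> P (i - 1) \<Longrightarrow> \<exists>j\<le>R. j \<noteq> i \<and> P j" for P
    subgoal using i by (intro exI[of _ "i + 1"]) simp
    subgoal using i by (intro exI[of _ "i - 1"]) auto
    done
  let ?A = "(i = 0 \<or> \<eta> i < c) \<and> c \<le> \<eta> (i + 1)"
    and ?B = "(i = 0 \<or> \<xi> i < 2) \<and> \<not> \<xi> (i + 1) < 2"
  have "?f i = ?s i + of_bool ?A" "?g i = ?s i + of_bool ?B" by (simp_all add: simps)
  then consider (same) "?f i = ?g i" | (left) ?A "\<not> ?B" | (right) "\<not> ?A" ?B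
    by (cases ?A; cases ?B) auto
  then show "?f i = ?g i \<or> (\<exists>j\<le>R. j \<noteq> i \<and> ?f j \<le> ?f i) \<and> (\<exists>j\<le>R. j \<noteq> i \<and> ?f j \<le> ?g i)"
  proof cases
    case left
    have "?f (i + 1) \<le> ?f i" using left st by (simp add: simps)
    \<comment> \<open>A particle of \<xi> at \<open>i + 1\<close> balances the site of \<eta> there,
      so the indices \<open>i\<close> and \<open>i + 1\<close> agree; otherwise site
      \<open>i\<close> contributes nothing and the indices \<open>i - 1\<close> and \<open>i\<close>
      agree.\<close>
    moreover have "(\<exists>j\<le>R. j \<noteq> i \<and> ?f j \<le> ?g i)"
    proof (cases "\<xi> (i + 1) < 2")
      case True
      then show ?thesis using st left by (intro ex(1)) (simp add: simps)
    next
      case False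
      then have "i \<noteq> 0" "i - 1 \<noteq> i" "\<not> \<xi> i < 2" "\<not> c \<le> \<eta> i" using left by auto
      then show ?thesis using st' False by (intro ex(2)) (simp_all add: simps)
    qed
    ultimately show ?thesis using ex(1)[of "\<lambda>j. ?f j \<le> ?f i"] by blast
  next
    case right
    have "?f (i + 1) \<le> ?g i" using right st by (simp add: simps)
    moreover have "(\<exists>j\<le>R. j \<noteq> i \<and> ?f j \<le> ?f i)"
    proof (cases "c \<le> \<eta> (i + 1)")
      case False
      then show ?thesis using st right by (intro ex(1)) (simp add: simps)
    next
      case True
      then have "i \<noteq> 0" "i - 1 \<noteq> i" "\<xi> i < 2" "c \<le> \<eta> i" using right by auto
      then show ?thesis using st' True by (intro ex(2)) (simp_all add: simps)
    qed
    ultimately show ?thesis using ex(1)[of "\<lambda>j. ?f j \<le> ?g i"] by blast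
  qed simp
qed

definition empty_config :: config where
  "empty_config = (\<lambda>x\<in>{1..}. \<infinity>)"

definition particles :: "nat \<Rightarrow> config \<Rightarrow> nat" where
  "particles n \<xi> = card {y\<in>{1..n}. \<xi> y < 2}"

text \<open>Stated with the two thresholds \<open>2\<close> and \<open>\<infinity>\<close>, for which the duality holds on all configurations; on
  \<^const>\<open>config_space\<close> this counts the sites of color \<open>2\<close>.\<close>

definition seconds :: "nat \<Rightarrow> config \<Rightarrow> nat" where
  "seconds n \<eta> = card {y\<in>{1..n}. 2 \<le> \<eta> y \<and> \<eta> y \<noteq> \<infinity>}"

lemma particles_le: "particles n \<xi> \<le> n"
  unfolding particles_def by (rule order_trans[OF card_mono[of "{1..n}"]]) auto

lemma particles_eq_sum: "int (particles n \<xi>) = (\<Sum>y\<in>{0<..n}. of_bool (\<xi> y < 2))"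
proof -
  have "{0<..n} \<inter> {y. \<xi> y < 2} = {y\<in>{1..n}. \<xi> y < 2}" by auto
  then show ?thesis by (simp add: particles_def sum_of_bool_eq)
qed

text \<open>Without particles every suffix sum is minus a count, and the longest suffix is the
  smallest.\<close>

lemma duality_fun_empty:
  "duality_fun c R \<eta> empty_config = - (\<Sum>y\<in>{0<..R}. of_bool (c \<le> \<eta> y))"
proof -
  have s: "suffix_excess c R \<eta> empty_config x = - (\<Sum>y\<in>{x<..R}. of_bool (c \<le> \<eta> y))" for x
    unfolding suffix_excess_def sum_negf[symmetric]
    by (rule sum.cong) (auto simp: empty_config_def)
  show ?thesis unfolding duality_fun_def
  proof (rule Min_eqI)
    fix z assume "z \<in> suffix_excess c R \<eta> empty_config ` {..R}"
    then obtain x where "z = suffix_excess c R \<eta> empty_config x" by auto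
    then show "- (\<Sum>y\<in>{0<..R}. of_bool (c \<le> \<eta> y)) \<le> z"
      by (auto simp: s intro!: card_mono)
  qed (use s in \<open>auto intro!: image_eqI[of _ _ 0]\<close>)
qed

lemma seconds_eq_duality_fun:
  "int (seconds R \<eta>) = duality_fun \<infinity> R \<eta> empty_config - duality_fun 2 R \<eta> empty_config"
proof -
  have "duality_fun \<infinity> R \<eta> empty_config - duality_fun 2 R \<eta> empty_config
      = (\<Sum>y\<in>{0<..R}. of_bool (2 \<le> \<eta> y) - of_bool (\<infinity> \<le> \<eta> y))"
    unfolding duality_fun_empty by (simp add: sum_subtractf)
  also have "\<dots> = (\<Sum>y\<in>{0<..R}. of_bool (2 \<le> \<eta> y \<and> \<eta> y \<noteq> \<infinity>))"
    by (rule sum.cong) (auto simp: of_bool_def)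
  also have "\<dots> = int (card ({0<..R} \<inter> {y. 2 \<le> \<eta> y \<and> \<eta> y \<noteq> \<infinity>}))"
    by (simp add: sum_of_bool_eq)
  also have "{0<..R} \<inter> {y. 2 \<le> \<eta> y \<and> \<eta> y \<noteq> \<infinity>} = {y\<in>{1..R}. 2 \<le> \<eta> y \<and> \<eta> y \<noteq> \<infinity>}" by auto
  finally show ?thesis by (simp add: seconds_def)
qed

text \<open>As the index decreases, the excess weakly falls beyond \<open>N\<close>, rises between
  \<open>N\<close> and \<open>a\<close> and falls again below \<open>a\<close>, so its minimum sits
  at \<open>N\<close> or at 0.\<close>

lemma duality_fun_block:
  assumes aN: "a \<le> N" "N \<le> R"
    and \<eta>: "\<And>y. 1 \<le> y \<Longrightarrow> c \<le> \<eta> y \<longleftrightarrow> y \<le> a \<or> N < y"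
  shows "duality_fun c R \<eta> \<xi>
    = suffix_excess c R \<eta> \<xi> N + min 0 (int (particles N \<xi>) - int a)"
proof -
  let ?s = "suffix_excess c R \<eta> \<xi>" and ?e = "\<lambda>y. of_bool (\<xi> y < 2) - of_bool (c \<le> \<eta> y) :: int"
  have split: "?s x = sum ?e {x<..y} + ?s y" if "x \<le> y" "y \<le> R" for x y
    unfolding suffix_excess_def using sum_split_greaterThanAtMost[OF that] .
  have "sum ?e {0<..N} = int (particles N \<xi>) - (\<Sum>y\<in>{0<..N}. of_bool (c \<le> \<eta> y))"
    by (simp add: sum_subtractf particles_eq_sum)
  also have "(\<Sum>y\<in>{0<..N}. of_bool (c \<le> \<eta> y)) = (\<Sum>y\<in>{0<..N}. of_bool (y \<le> a) :: int)"
    by (rule sum.cong) (use \<eta> in auto)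
  also have "\<dots> = int (card ({0<..N} \<inter> {y. y \<le> a}))" by (simp add: sum_of_bool_eq)
  also have "{0<..N} \<inter> {y. y \<le> a} = {0<..a}" using aN by auto
  finally have s0: "?s 0 = ?s N + (int (particles N \<xi>) - int a)"
    using split[of 0 N] aN by simp
  have lb: "?s N \<le> ?s x \<or> ?s 0 \<le> ?s x" if "x \<le> R" for x
  proof -
    consider "N \<le> x" | "a \<le> x" "x \<le> N" | "x \<le> a" by linarith
    then show ?thesis
    proof cases
      case 1
      have "sum ?e {N<..x} \<le> 0" by (rule sum_nonpos) (use \<eta> in auto)
      then show ?thesis using split[of N x] 1 that by simp
    next
      case 2
      have "0 \<le> sum ?e {x<..N}" by (rule sum_nonneg) (use \<eta> 2 in auto)
      then show ?thesis using split[of x N] 2 aN by simp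
    next
      case 3
      have "sum ?e {0<..x} \<le> 0" by (rule sum_nonpos) (use \<eta> 3 in auto)
      then show ?thesis using split[of 0 x] 3 that by simp
    qed
  qed
  show ?thesis unfolding duality_fun_def
  proof (rule Min_eqI)
    show "?s N + min 0 (int (particles N \<xi>) - int a) \<in> ?s ` {..R}"
    proof (cases "int a \<le> int (particles N \<xi>)")
      case True
      then show ?thesis using aN by (intro image_eqI[of _ _ N]) auto
    next
      case False
      then show ?thesis using s0 by (intro image_eqI[of _ _ 0]) auto
    qed
  next
    fix z assume "z \<in> ?s ` {..R}"
    then obtain x where "x \<le> R" "z = ?s x" by auto
    then show "?s N + min 0 (int (particles N \<xi>) - int a) \<le> z"
      using lb[of x] s0 by linarith
  qed auto
qed

lemma suffix_excess_cong:
  assumes "\<And>y. N < y \<Longrightarrow> c \<le> \<eta> y \<longleftrightarrow> c' \<le> \<eta> y"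
  shows "suffix_excess c R \<eta> \<xi> N = suffix_excess c' R \<eta> \<xi> N"
  unfolding suffix_excess_def by (rule sum.cong) (use assms in auto)

lemma evol_seconds:
  "chain_evol \<alpha> 0 R t (\<lambda>\<eta>. \<phi> (int (seconds R \<eta>))) \<eta>
   = chain_evol \<alpha> 0 R t (\<lambda>\<xi>. \<phi> (duality_fun \<infinity> R \<eta> \<xi> - duality_fun 2 R \<eta> \<xi>)) empty_config"
  unfolding seconds_eq_duality_fun
proof (rule evol_dual[where H = "\<lambda>\<eta> \<xi>. \<phi> (duality_fun \<infinity> R \<eta> \<xi> - duality_fun 2 R \<eta> \<xi>)"])
  fix i \<eta> \<xi> assume i: "i \<le> R" "chain_rate \<alpha> 0 R i \<noteq> 0"
  have "duality_fun c R (chain_letter R i \<eta>) \<xi> = duality_fun c R \<eta> (chain_letter R i \<xi>)"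
    if "1 < c" for c
  proof (cases "i = R")
    case True
    \<comment> \<open>The exit has rate 0, so this case survives only in the degenerate chain
      without sites, where the letter is also number 0.\<close>
    then have "R = 0" using i by (simp add: chain_rate_def split: if_splits)
    then show ?thesis by (simp add: duality_fun_def suffix_excess_def)
  next
    case False
    then show ?thesis using duality_fun_letter[OF that, of i R] i by (simp add: chain_letter_def)
  qed
  then show "\<phi> (duality_fun \<infinity> R (chain_letter R i \<eta>) \<xi> - duality_fun 2 R (chain_letter R i \<eta>) \<xi>)
    = \<phi> (duality_fun \<infinity> R \<eta> (chain_letter R i \<xi>) - duality_fun 2 R \<eta> (chain_letter R i \<xi>))"
    by simp
qed

text \<open>Let \<open>N = M1 + M2 + 1\<close>. The block bound \<open>a\<close> is
  \<open>M1\<close> at threshold \<infinity> and \<open>N\<close> at threshold 2, so with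
  \<open>k\<close> particles the difference is \<open>min 0 (k - M1) - (k - N)\<close>; the
  contributions beyond \<open>N\<close> cancel.\<close>

lemma evol_seconds_init_second:
  assumes "M1 + M2 + 1 \<le> R"
  shows "chain_evol \<alpha> 0 R t (\<lambda>\<eta>. \<phi> (int (seconds R \<eta>))) (init_second M1 M2)
    = chain_evol \<alpha> 0 R t
        (\<lambda>\<xi>. \<phi> (min (int (M2 + 1)) (int (M1 + M2 + 1) - int (particles (M1 + M2 + 1) \<xi>)))) empty_config"
proof -
  let ?\<eta> = "init_second M1 M2" and ?N = "M1 + M2 + 1"
  have "duality_fun \<infinity> R ?\<eta> \<xi> = suffix_excess \<infinity> R ?\<eta> \<xi> ?N + min 0 (int (particles ?N \<xi>) - int M1)" for \<xi>
    by (rule duality_fun_block) (use assms in \<open>auto simp: init_second_def\<close>)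
  moreover have "duality_fun 2 R ?\<eta> \<xi> = suffix_excess 2 R ?\<eta> \<xi> ?N + min 0 (int (particles ?N \<xi>) - int ?N)" for \<xi>
    by (rule duality_fun_block) (use assms in \<open>auto simp: init_second_def\<close>)
  moreover have "suffix_excess \<infinity> R ?\<eta> \<xi> ?N = suffix_excess 2 R ?\<eta> \<xi> ?N" for \<xi>
    by (rule suffix_excess_cong) (auto simp: init_second_def)
  moreover have "particles ?N \<xi> \<le> ?N" for \<xi> by (rule particles_le)
  ultimately have "duality_fun \<infinity> R ?\<eta> \<xi> - duality_fun 2 R ?\<eta> \<xi>
      = min (int (M2 + 1)) (int ?N - int (particles ?N \<xi>))" for \<xi>
    by (smt (verit, best) of_nat_add of_nat_mono)
  then show ?thesis unfolding evol_seconds by simp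
qed

text \<open>The block bounds \<open>M1\<close> and \<open>M1 + 1\<close> differ by the single
  second-class site, and \<open>min 0 (k - M1) - min 0 (k - M1 - 1)\<close> is 1 for
  \<open>k \<le> M1\<close> and 0 otherwise.\<close>

lemma evol_seconds_init_shock:
  assumes "M1 + M2 + 1 \<le> R"
  shows "chain_evol \<alpha> 0 R t (\<lambda>\<eta>. \<phi> (int (seconds R \<eta>))) (init_shock M1 M2)
    = chain_evol \<alpha> 0 R t (\<lambda>\<xi>. \<phi> (of_bool (particles (M1 + M2 + 1) \<xi> \<le> M1))) empty_config"
proof -
  let ?\<eta> = "init_shock M1 M2" and ?N = "M1 + M2 + 1"
  have "duality_fun \<infinity> R ?\<eta> \<xi> = suffix_excess \<infinity> R ?\<eta> \<xi> ?N + min 0 (int (particles ?N \<xi>) - int M1)" for \<xi>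
    by (rule duality_fun_block) (use assms in \<open>auto simp: init_shock_def\<close>)
  moreover have "duality_fun 2 R ?\<eta> \<xi>
      = suffix_excess 2 R ?\<eta> \<xi> ?N + min 0 (int (particles ?N \<xi>) - int (M1 + 1))" for \<xi>
    by (rule duality_fun_block) (use assms in \<open>auto simp: init_shock_def\<close>)
  moreover have "suffix_excess \<infinity> R ?\<eta> \<xi> ?N = suffix_excess 2 R ?\<eta> \<xi> ?N" for \<xi>
    by (rule suffix_excess_cong) (auto simp: init_shock_def)
  ultimately have "duality_fun \<infinity> R ?\<eta> \<xi> - duality_fun 2 R ?\<eta> \<xi>
      = of_bool (particles ?N \<xi> \<le> M1)" for \<xi>
    by (auto simp: of_bool_def)
  then show ?thesis unfolding evol_seconds by simp
qed

section \<open>Passage to the infinite system\<close>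

text \<open>A Lyapunov function: a move to the right from site \<open>i\<close>, at rate 1, gains
  \<open>2 ^ i\<close>, exactly the weight already carried there, so the generator is bounded by the
  function itself, independently of \<open>R\<close>.\<close>

definition tail_weight :: "nat \<Rightarrow> config \<Rightarrow> real" where
  "tail_weight R \<eta> = (\<Sum>x\<in>{1..R}. of_bool (2 \<le> \<eta> x \<and> \<eta> x \<noteq> \<infinity>) * 2 ^ x)"

lemma tail_weight_letter:
  assumes "1 \<le> i" "i < R"
  shows "tail_weight R (letter i \<eta>) - tail_weight R \<eta> \<le> of_bool (2 \<le> \<eta> i \<and> \<eta> i \<noteq> \<infinity>) * 2 ^ i"
proof (cases "\<eta> i < \<eta> (i + 1)")
  case True
  let ?f = "\<lambda>\<eta> x. of_bool (2 \<le> \<eta> x \<and> \<eta> x \<noteq> \<infinity>) * 2 ^ x :: real" and ?\<zeta> = "letter i \<eta>"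
  have \<zeta>: "?\<zeta> i = \<eta> (i + 1)" "?\<zeta> (i + 1) = \<eta> i"
    using True assms by (auto simp: letter_def exchange_def)
  have "tail_weight R ?\<zeta> - tail_weight R \<eta> = (\<Sum>x\<in>{1..R}. ?f ?\<zeta> x - ?f \<eta> x)"
    by (simp only: tail_weight_def sum_subtractf)
  also have "\<dots> = (\<Sum>x\<in>{1..R}. (if x = i then ?f ?\<zeta> i - ?f \<eta> i else 0)
      + (if x = i + 1 then ?f ?\<zeta> (i + 1) - ?f \<eta> (i + 1) else 0))"
    by (intro sum.cong) (auto simp: letter_other)
  also have "\<dots> = (?f ?\<zeta> i - ?f \<eta> i) + (?f ?\<zeta> (i + 1) - ?f \<eta> (i + 1))"
    using assms by (simp add: sum.distrib)
  also have "\<dots> \<le> ?f \<eta> i" unfolding \<zeta> by auto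
  finally show ?thesis .
next
  case False
  then show ?thesis using assms by (simp add: letter_def)
qed

lemma tail_weight_gen:
  assumes "0 \<le> \<alpha>" "1 \<le> R"
  shows "chain_gen \<alpha> 0 R (tail_weight R) \<eta> \<le> tail_weight R \<eta>"
proof -
  let ?d = "\<lambda>i. chain_rate \<alpha> 0 R i * (tail_weight R (chain_letter R i \<eta>) - tail_weight R \<eta>)"
  have R: "{..R} = insert 0 (insert R {1..<R})" using assms by auto
  have "tail_weight R (letter 0 \<eta>) \<le> tail_weight R \<eta>"
    unfolding tail_weight_def by (intro sum_mono) (auto simp: letter_def inject_def)
  then have "?d 0 \<le> 0"
    using assms by (auto simp: chain_rate_def chain_letter_def mult_nonneg_nonpos)
  moreover have "?d R = 0" using assms by (simp add: chain_rate_def)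
  moreover have "(\<Sum>i\<in>{1..<R}. ?d i)
      \<le> (\<Sum>i\<in>{1..<R}. of_bool (2 \<le> \<eta> i \<and> \<eta> i \<noteq> \<infinity>) * 2 ^ i)"
    using tail_weight_letter by (intro sum_mono) (auto simp: chain_rate_def chain_letter_def)
  moreover have "\<dots> \<le> tail_weight R \<eta>"
    unfolding tail_weight_def by (intro sum_mono2) auto
  moreover have "sum ?d (insert 0 (insert R {1..<R})) = ?d 0 + (?d R + sum ?d {1..<R})"
    using assms by simp
  ultimately show ?thesis unfolding gen_def R by linarith
qed

lemma tail_weight_bounded: "\<bar>tail_weight R \<eta>\<bar> \<le> (\<Sum>x\<in>{1..R}. 2 ^ x)"
proof -
  have "0 \<le> tail_weight R \<eta>" unfolding tail_weight_def by (intro sum_nonneg) auto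
  moreover have "tail_weight R \<eta> \<le> (\<Sum>x\<in>{1..R}. 2 ^ x)"
    unfolding tail_weight_def by (intro sum_mono) auto
  ultimately show ?thesis by simp
qed

lemma seconds_mono: "n \<le> R \<Longrightarrow> seconds n \<eta> \<le> seconds R \<eta>"
  unfolding seconds_def by (intro card_mono) auto

text \<open>A Markov-type inequality: the two counts differ only if a second-class particle sits
  beyond \<open>n\<close>, and then the weight is at least \<open>2 ^ n\<close>.\<close>

lemma seconds_le_tail_weight:
  assumes "n \<le> R"
  shows "of_bool (m \<le> seconds R \<eta>) \<le> of_bool (m \<le> seconds n \<eta>) + 1 / 2 ^ n * tail_weight R \<eta>"
proof (cases "\<exists>x\<in>{n<..R}. 2 \<le> \<eta> x \<and> \<eta> x \<noteq> \<infinity>")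
  case True
  then obtain x where x: "n < x" "x \<le> R" "2 \<le> \<eta> x \<and> \<eta> x \<noteq> \<infinity>" by auto
  have "(2::real) ^ n \<le> 2 ^ x" using x by (intro power_increasing) auto
  also have "\<dots> = (\<Sum>y\<in>{x}. of_bool (2 \<le> \<eta> y \<and> \<eta> y \<noteq> \<infinity>) * 2 ^ y)" using x by simp
  also have "\<dots> \<le> tail_weight R \<eta>"
    unfolding tail_weight_def using x by (intro sum_mono2) auto
  finally have "1 \<le> 1 / 2 ^ n * tail_weight R \<eta>" by (simp add: field_simps)
  moreover have "of_bool (m \<le> seconds R \<eta>) \<le> (1::real)" "0 \<le> (of_bool (m \<le> seconds n \<eta>) :: real)"
    by simp_all
  ultimately show ?thesis by linarith
next
  case False
  then have "{y\<in>{1..R}. 2 \<le> \<eta> y \<and> \<eta> y \<noteq> \<infinity>} = {y\<in>{1..n}. 2 \<le> \<eta> y \<and> \<eta> y \<noteq> \<infinity>}"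
    using assms by auto
  then have "seconds R \<eta> = seconds n \<eta>" by (simp add: seconds_def)
  moreover have "0 \<le> tail_weight R \<eta>" unfolding tail_weight_def by (intro sum_nonneg) auto
  ultimately show ?thesis by simp
qed

lemma depends_on_seconds: "depends_on n (\<lambda>\<eta>. \<phi> (seconds n \<eta>))"
  unfolding depends_on_def
proof (intro allI impI)
  fix \<eta> \<zeta> :: config assume "\<forall>x\<in>{1..n}. \<eta> x = \<zeta> x"
  then have "{y\<in>{1..n}. 2 \<le> \<eta> y \<and> \<eta> y \<noteq> \<infinity>} = {y\<in>{1..n}. 2 \<le> \<zeta> y \<and> \<zeta> y \<noteq> \<infinity>}" by auto
  then show "\<phi> (seconds n \<eta>) = \<phi> (seconds n \<zeta>)" by (simp add: seconds_def)
qed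

lemma depends_on_particles: "depends_on n (\<lambda>\<eta>. \<phi> (particles n \<eta>))"
  unfolding depends_on_def
proof (intro allI impI)
  fix \<eta> \<zeta> :: config assume "\<forall>x\<in>{1..n}. \<eta> x = \<zeta> x"
  then have "{y\<in>{1..n}. \<eta> y < 2} = {y\<in>{1..n}. \<zeta> y < 2}" by auto
  then show "\<phi> (particles n \<eta>) = \<phi> (particles n \<zeta>)" by (simp add: particles_def)
qed

lemma empty_config_in_space: "empty_config \<in> space config_space"
  by (auto simp: empty_config_def config_space_def space_PiM)

lemma seconds_event_sets: "{\<zeta> \<in> space config_space. m \<le> seconds n \<zeta>} \<in> sets config_space"
proof -
  have "(\<lambda>\<zeta>. of_bool (m \<le> seconds n \<zeta>) :: real) \<in> borel_measurable config_space"
    by (rule depends_on_measurable[OF depends_on_seconds])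
  then have "{\<zeta> \<in> space config_space. of_bool (m \<le> seconds n \<zeta>) = (1::real)} \<in> sets config_space"
    by measurable
  then show ?thesis by simp
qed

text \<open>Stated through finite windows so that it is an increasing union of local events.
  Configurations with infinitely many second-class particles belong to it, which \<open>card\<close>
  would not give.\<close>

definition many_seconds :: "nat \<Rightarrow> config set" where
  "many_seconds m = {\<zeta> \<in> space config_space. \<exists>n. m \<le> seconds n \<zeta>}"

lemma many_seconds_eq: "many_seconds m = (\<Union>n. {\<zeta> \<in> space config_space. m \<le> seconds n \<zeta>})"
  by (auto simp: many_seconds_def)

lemma many_seconds_sets [measurable]: "many_seconds m \<in> sets config_space"
  unfolding many_seconds_eq by (intro sets.countable_UN) (use seconds_event_sets in auto)

text \<open>First the chain length tends to infinity for a fixed window \<open>n\<close>: the local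
  count falls short of the dual value by at most \<open>exp t * C / 2 ^ n\<close>. Then the window
  grows.\<close>

lemma measure_many_seconds:
  assumes S: "tasep_semigroup \<alpha> S" and \<alpha>: "0 \<le> \<alpha>" "\<alpha> \<le> 1"
    and \<eta>: "\<eta> \<in> space config_space" and t: "0 \<le> t"
    and C: "\<And>R. tail_weight R \<eta> \<le> C"
    and dual: "\<And>R. N \<le> R \<Longrightarrow> chain_evol \<alpha> 0 R t (\<lambda>\<eta>. of_bool (m \<le> seconds R \<eta>)) \<eta>
      = chain_evol \<alpha> 0 R t h empty_config"
    and h: "depends_on N h" "\<And>\<xi>. \<bar>h \<xi>\<bar> \<le> B"
  shows "measure (S t \<eta>) (many_seconds m) = (\<integral>\<xi>. h \<xi> \<partial>S t empty_config)"
proof -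
  interpret prob_space "S t \<eta>" by (rule tasep_semigroup_kernel[OF S t \<eta>])
  note sets = tasep_semigroup_kernel(2)[OF S t \<eta>]
  have sp: "space (S t \<eta>) = space config_space" using sets by (rule sets_eq_imp_space_eq)
  let ?I = "\<integral>\<xi>. h \<xi> \<partial>S t empty_config"
  let ?E = "\<lambda>n. {\<zeta> \<in> space config_space. m \<le> seconds n \<zeta>}"
  let ?g = "\<lambda>n \<eta>. of_bool (m \<le> seconds n \<eta>) :: real"
  have g1: "\<bar>?g n \<zeta>\<bar> \<le> 1" for n \<zeta> by simp
  have Eint: "measure (S t \<eta>) (?E n) = (\<integral>\<zeta>. ?g n \<zeta> \<partial>S t \<eta>)" for n
  proof -
    have "(\<integral>\<zeta>. ?g n \<zeta> \<partial>S t \<eta>) = (\<integral>\<zeta>. indicator (?E n) \<zeta> \<partial>S t \<eta>)"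
      by (intro Bochner_Integration.integral_cong refl) (simp add: sp indicator_def)
    also have "\<dots> = measure (S t \<eta>) (?E n)"
      using seconds_event_sets[of m n] sets sp by (simp add: Int_absorb2)
    finally show ?thesis ..
  qed
  have lim_g: "(\<lambda>R. chain_evol \<alpha> 0 R t (?g n) \<eta>) \<longlonglongrightarrow> measure (S t \<eta>) (?E n)" for n
    unfolding Eint
    by (rule chain_evol_tendsto[OF S \<alpha> order.refl \<eta> _ g1 t])
       (rule depends_on_seconds[where \<phi> = "\<lambda>k. of_bool (m \<le> k)"])
  have lim_h: "(\<lambda>R. chain_evol \<alpha> 0 R t h empty_config) \<longlonglongrightarrow> ?I"
    by (rule chain_evol_tendsto[OF S \<alpha> order.refl empty_config_in_space h t])
  have nn: "\<And>R i. 0 \<le> chain_rate \<alpha> 0 R i" using \<alpha> by (simp add: chain_rate_nonneg)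
  have lower: "measure (S t \<eta>) (?E n) \<le> ?I" for n
  proof (rule LIMSEQ_le[OF lim_g lim_h], intro exI[of _ "max N n"] allI impI)
    fix R assume R: "max N n \<le> R"
    have "chain_evol \<alpha> 0 R t (?g n) \<eta> \<le> chain_evol \<alpha> 0 R t (?g R) \<eta>"
    proof (rule evol_mono_same[OF nn g1 g1 t])
      fix \<zeta> show "?g n \<zeta> \<le> ?g R \<zeta>" using seconds_mono[of n R \<zeta>] R by (auto simp: of_bool_def)
    qed
    then show "chain_evol \<alpha> 0 R t (?g n) \<eta> \<le> chain_evol \<alpha> 0 R t h empty_config"
      using dual R by simp
  qed
  have upper: "?I \<le> measure (S t \<eta>) (?E n) + exp t * C / 2 ^ n" for n
  proof (rule LIMSEQ_le[OF lim_h tendsto_add[OF lim_g tendsto_const]],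
      intro exI[of _ "max 1 (max N n)"] allI impI)
    fix R assume R: "max 1 (max N n) \<le> R"
    have tb: "\<bar>1 / 2 ^ n * tail_weight R \<zeta>\<bar> \<le> 1 / 2 ^ n * (\<Sum>x\<in>{1..R}. 2 ^ x)" for \<zeta>
      unfolding abs_mult using tail_weight_bounded[of R \<zeta>] by (intro mult_mono) auto
    have bb: "\<bar>1 * ?g n \<zeta> + 1 / 2 ^ n * tail_weight R \<zeta>\<bar> \<le> 1 + 1 / 2 ^ n * (\<Sum>x\<in>{1..R}. 2 ^ x)" for \<zeta>
      using abs_triangle_ineq[of "?g n \<zeta>" "1 / 2 ^ n * tail_weight R \<zeta>"] tb[of \<zeta>] g1[of n \<zeta>]
      unfolding mult_1 by linarith
    have "chain_evol \<alpha> 0 R t (?g R) \<eta>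
        \<le> chain_evol \<alpha> 0 R t (\<lambda>\<zeta>. 1 * ?g n \<zeta> + 1 / 2 ^ n * tail_weight R \<zeta>) \<eta>"
    proof (rule evol_mono_same[OF nn g1 bb t])
      fix \<zeta> show "?g R \<zeta> \<le> 1 * ?g n \<zeta> + 1 / 2 ^ n * tail_weight R \<zeta>"
        using seconds_le_tail_weight[of n R m \<zeta>] R by simp
    qed
    also have "\<dots> = 1 * chain_evol \<alpha> 0 R t (?g n) \<eta> + 1 / 2 ^ n * chain_evol \<alpha> 0 R t (tail_weight R) \<eta>"
      by (rule evol_linear[OF nn g1 tail_weight_bounded])
    finally have 1: "chain_evol \<alpha> 0 R t h empty_config
        \<le> chain_evol \<alpha> 0 R t (?g n) \<eta> + 1 / 2 ^ n * chain_evol \<alpha> 0 R t (tail_weight R) \<eta>"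
      using dual[of R] R by simp
    have "chain_evol \<alpha> 0 R t (tail_weight R) \<eta> \<le> exp t * tail_weight R \<eta>"
      by (rule evol_le_exp[OF nn tail_weight_bounded t tail_weight_gen]) (use \<alpha> R in auto)
    also have "\<dots> \<le> exp t * C" using C by (intro mult_left_mono) auto
    finally have "1 / 2 ^ n * chain_evol \<alpha> 0 R t (tail_weight R) \<eta> \<le> 1 / 2 ^ n * (exp t * C)"
      by (intro mult_left_mono) auto
    with 1 show "chain_evol \<alpha> 0 R t h empty_config
        \<le> chain_evol \<alpha> 0 R t (?g n) \<eta> + exp t * C / 2 ^ n" by simp
  qed
  have "(\<lambda>n. measure (S t \<eta>) (?E n)) \<longlonglongrightarrow> measure (S t \<eta>) (\<Union>n. ?E n)"
  proof (rule finite_Lim_measure_incseq)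
    show "range ?E \<subseteq> sets (S t \<eta>)" using seconds_event_sets sets by auto
    show "incseq ?E" by (intro incseq_SucI) (use seconds_mono in \<open>auto intro: order_trans\<close>)
  qed
  moreover have "(\<lambda>n. measure (S t \<eta>) (?E n)) \<longlonglongrightarrow> ?I"
  proof (rule tendsto_sandwich)
    show "\<forall>\<^sub>F n in sequentially. ?I - exp t * C / 2 ^ n \<le> measure (S t \<eta>) (?E n)"
      using upper by (intro always_eventually) (auto simp: diff_le_eq)
    show "\<forall>\<^sub>F n in sequentially. measure (S t \<eta>) (?E n) \<le> ?I"
      using lower by (intro always_eventually) auto
    have "(\<lambda>n. ?I - exp t * C * (1 / 2) ^ n) \<longlonglongrightarrow> ?I - exp t * C * 0"
      by (intro tendsto_diff tendsto_const tendsto_mult_left LIMSEQ_power_zero) auto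
    then show "(\<lambda>n. ?I - exp t * C / 2 ^ n) \<longlonglongrightarrow> ?I" by (simp add: power_one_over)
  qed simp
  ultimately show ?thesis unfolding many_seconds_eq using LIMSEQ_unique by blast
qed

section \<open>From events to the observables of the theorem\<close>

lemma color_two_iff:
  assumes "\<zeta> \<in> space config_space" "1 \<le> x"
  shows "2 \<le> \<zeta> x \<and> \<zeta> x \<noteq> \<infinity> \<longleftrightarrow> \<zeta> x = 2"
proof -
  have "\<zeta> x \<in> {1, 2, \<infinity>}" using assms by (auto simp: config_space_def space_PiM)
  then have "\<zeta> x = 1 \<or> \<zeta> x = 2 \<or> \<zeta> x = \<infinity>" by simp
  then show ?thesis
  proof (elim disjE)
    assume 2: "\<zeta> x = 2"
    have "(2::enat) \<noteq> \<infinity>" by simp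
    then show ?thesis unfolding 2 by (simp only: order.refl simp_thms)
  qed simp_all
qed

lemma seconds_eq_card:
  assumes "\<zeta> \<in> space config_space"
  shows "seconds n \<zeta> = card {y \<in> {1..n}. \<zeta> y = 2}"
proof -
  have "{y \<in> {1..n}. 2 \<le> \<zeta> y \<and> \<zeta> y \<noteq> \<infinity>} = {y \<in> {1..n}. \<zeta> y = 2}"
    using color_two_iff[OF assms] by auto
  then show ?thesis by (simp add: seconds_def)
qed

lemma many_seconds_iff:
  assumes "\<zeta> \<in> space config_space"
  shows "\<zeta> \<in> many_seconds m \<longleftrightarrow> infinite {y. 1 \<le> y \<and> \<zeta> y = 2} \<or> m \<le> card {y. 1 \<le> y \<and> \<zeta> y = 2}"
    (is "_ \<longleftrightarrow> infinite ?Y \<or> _")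
proof
  assume "\<zeta> \<in> many_seconds m"
  then obtain n where "m \<le> card {y \<in> {1..n}. \<zeta> y = 2}"
    using seconds_eq_card[OF assms] by (auto simp: many_seconds_def)
  moreover have "finite ?Y \<Longrightarrow> card {y \<in> {1..n}. \<zeta> y = 2} \<le> card ?Y" by (intro card_mono) auto
  ultimately show "infinite ?Y \<or> m \<le> card ?Y" by linarith
next
  assume *: "infinite ?Y \<or> m \<le> card ?Y"
  have "\<exists>T. finite T \<and> card T = m \<and> T \<subseteq> ?Y"
  proof (cases "finite ?Y")
    case True
    with * have "m \<le> card ?Y" by (simp only: not_True_eq_False simp_thms)
    then obtain T where "T \<subseteq> ?Y" "card T = m" by (rule obtain_subset_with_card_n)
    with True show ?thesis by (auto intro: finite_subset)
  next
    case False
    then show ?thesis using infinite_arbitrarily_large[of ?Y m] by auto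
  qed
  then obtain T where T: "finite T" "card T = m" "T \<subseteq> ?Y" by (elim exE conjE)
  have "T \<subseteq> {y \<in> {1..Max (insert 0 T)}. \<zeta> y = 2}" using T by auto
  then have "card T \<le> card {y \<in> {1..Max (insert 0 T)}. \<zeta> y = 2}" by (intro card_mono) simp_all
  then have "m \<le> seconds (Max (insert 0 T)) \<zeta>"
    unfolding seconds_eq_card[OF assms] T(2) .
  then show "\<zeta> \<in> many_seconds m" using assms by (auto simp: many_seconds_def)
qed

lemma second_class_position_pos_iff:
  assumes "\<zeta> \<in> space config_space"
  shows "second_class_position \<zeta> > 0 \<longleftrightarrow> \<zeta> \<in> many_seconds 1"
proof -
  have "second_class_position \<zeta> > 0 \<longleftrightarrow> (\<exists>x\<ge>1. \<zeta> x = 2)"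
  proof (cases "\<exists>x\<ge>1. \<zeta> x = 2")
    case True
    then have "(LEAST x. x \<ge> 1 \<and> \<zeta> x = 2) \<ge> 1" by (metis (mono_tags, lifting) LeastI_ex)
    then show ?thesis using True by (simp add: second_class_position_def)
  next
    case False
    then have "second_class_position \<zeta> = - 1" unfolding second_class_position_def by (rule if_not_P)
    then show ?thesis using False by simp
  qed
  also have "\<dots> \<longleftrightarrow> \<zeta> \<in> many_seconds 1"
    unfolding many_seconds_iff[OF assms]
    by (auto simp: Suc_le_eq card_gt_0_iff dest!: infinite_imp_nonempty)
  finally show ?thesis .
qed

text \<open>Missing one of the events \<open>many_seconds K\<close> ensures finiteness, without
  which \<open>card\<close> would return 0.\<close>

lemma color_count_eq_iff:
  assumes "\<zeta> \<in> space config_space" "\<zeta> \<notin> many_seconds K"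
  shows "color_count 2 1 \<zeta> = m \<longleftrightarrow> \<zeta> \<in> many_seconds m - many_seconds (Suc m)"
proof -
  let ?Y = "{y. 1 \<le> y \<and> \<zeta> y = 2}"
  have "finite ?Y" using assms(2) many_seconds_iff[OF assms(1), of K] by (simp only: de_Morgan_disj not_not)
  then have "\<zeta> \<in> many_seconds j \<longleftrightarrow> j \<le> card ?Y" for j
    using many_seconds_iff[OF assms(1), of j] by (simp only: not_True_eq_False simp_thms)
  moreover have "color_count 2 1 \<zeta> = card ?Y"
    unfolding color_count_def by (intro arg_cong[where f = card]) auto
  ultimately show ?thesis by (simp only: Diff_iff) linarith
qed

text \<open>The Markov property at time 0 gives a conditional expectation that is almost surely
  constant, because the start is; integrating it yields the law at time \<open>t\<close>.\<close>

lemma half_line_tasep_law: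
  assumes "half_line_tasep \<alpha> \<eta>\<^sub>0 M X"
  obtains S where "tasep_semigroup \<alpha> S"
    "\<forall>t A. 0 \<le> t \<longrightarrow> A \<in> sets config_space \<longrightarrow>
       measure M {\<omega> \<in> space M. X t \<omega> \<in> A} = measure (S t \<eta>\<^sub>0) A"
proof -
  note process = assms[unfolded half_line_tasep_def]
  interpret prob_space M by (rule process[THEN conjunct1])
  have X: "X t \<in> M \<rightarrow>\<^sub>M config_space" if "0 \<le> t" for t
    using process[THEN conjunct2, THEN conjunct1] that by blast
  have X0: "AE \<omega> in M. X 0 \<omega> = \<eta>\<^sub>0"
    by (rule process[THEN conjunct2, THEN conjunct2, THEN conjunct1])
  have "\<exists>S. tasep_semigroup \<alpha> S \<and> (\<forall>s\<ge>0. \<forall>t\<ge>0. \<forall>A\<in>sets config_space.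
      AE \<omega> in M. real_cond_exp M (natural_filtration M X s) (\<lambda>\<omega>'. indicator A (X (s + t) \<omega>')) \<omega>
        = measure (S t (X s \<omega>)) A)"
    by (rule process[THEN conjunct2, THEN conjunct2, THEN conjunct2, THEN conjunct1])
  then obtain S where S: "tasep_semigroup \<alpha> S"
    and markov: "\<forall>s\<ge>0. \<forall>t\<ge>0. \<forall>A\<in>sets config_space.
      AE \<omega> in M. real_cond_exp M (natural_filtration M X s) (\<lambda>\<omega>'. indicator A (X (s + t) \<omega>')) \<omega>
        = measure (S t (X s \<omega>)) A"
    by (elim exE conjE)
  let ?F = "natural_filtration M X 0"
  have sub: "subalgebra M ?F"
    unfolding subalgebra_def natural_filtration_def
  proof (intro conjI)
    show "sets (sigma (space M) {X u -` A \<inter> space M | u A. 0 \<le> u \<and> u \<le> 0 \<and> A \<in> sets config_space}) \<subseteq> sets M"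
      using X by (subst sets_measure_of) (auto intro!: sets.sigma_sets_subset measurable_sets)
  qed (subst space_measure_of, auto)
  interpret finite_measure_subalgebra M ?F by unfold_locales (rule sub)
  have "measure M {\<omega> \<in> space M. X t \<omega> \<in> A} = measure (S t \<eta>\<^sub>0) A"
    if t: "0 \<le> t" and A: "A \<in> sets config_space" for t A
  proof -
    let ?f = "\<lambda>\<omega>. indicator A (X t \<omega>) :: real"
    have fm: "?f \<in> borel_measurable M" using X[OF t] A by measurable
    have i: "integrable M ?f"
      by (rule integrable_const_bound[where B = 1]) (use fm in auto)
    have "AE \<omega> in M. real_cond_exp M ?F ?f \<omega> = measure (S t (X 0 \<omega>)) A"
      using markov[rule_format, of 0 t A] t A by simp
    then have ae: "AE \<omega> in M. real_cond_exp M ?F ?f \<omega> = measure (S t \<eta>\<^sub>0) A"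
      using X0 by eventually_elim simp
    have "measure M {\<omega> \<in> space M. X t \<omega> \<in> A} = (\<integral>\<omega>. indicator {\<omega> \<in> space M. X t \<omega> \<in> A} \<omega> \<partial>M)"
      by (simp add: Int_absorb2 Collect_conj_eq)
    also have "\<dots> = (\<integral>\<omega>. ?f \<omega> \<partial>M)"
      by (intro Bochner_Integration.integral_cong) (auto simp: indicator_def)
    also have "\<dots> = (\<integral>\<omega>. real_cond_exp M ?F ?f \<omega> \<partial>M)"
      using real_cond_exp_int(2)[OF i] by simp
    also have "\<dots> = (\<integral>\<omega>. measure (S t \<eta>\<^sub>0) A \<partial>M)"
      using ae by (intro integral_cong_AE) auto
    finally show ?thesis by (simp add: prob_space)
  qed
  then show ?thesis by (intro that[OF S]) simp
qed

section \<open>Matrix ansatz\<close>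

text \<open>Fixing the irrelevant value at site \<open>0\<close> makes prepending a site commute exactly with the elementary maps.\<close>

definition config_Cons :: "enat \<Rightarrow> config \<Rightarrow> config" where
  "config_Cons a \<eta> = (\<lambda>x. if x = 0 then \<infinity> else if x = 1 then a else \<eta> (x - 1))"

text \<open>A representation of \<open>DE = D + E\<close> on polynomials. The right boundary vector is \<open>1\<close>, with \<open>\<beta> D 1 = 1\<close> for
  \<open>c = 1 / \<beta> - 1\<close>, and the left one is evaluation at \<open>(1 - \<alpha>) / \<alpha>\<close>, where \<open>\<alpha> E\<close> acts as the identity.\<close>

definition D_op :: "real \<Rightarrow> real poly \<Rightarrow> real poly" where
  "D_op c p = p + poly_shift 1 p + [: c * coeff p 0 :]"

definition E_op :: "real poly \<Rightarrow> real poly" where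
  "E_op p = p + pCons 0 p"

text \<open>With S the shift and X multiplication by the variable, S X is the identity and X p has
  no constant term, so the product of 1 + S + c (constant term) and 1 + X expands to the right
  side.\<close>

lemma DE_algebra: "D_op c (E_op p) = D_op c p + E_op p"
  unfolding D_op_def E_op_def
  by (rule poly_eqI, simp only: coeff_add coeff_poly_shift coeff_pCons) (simp split: nat.splits)

lemma D_op_linear: "D_op c (smult a p + smult b q) = smult a (D_op c p) + smult b (D_op c q)"
  by (rule poly_eqI)
     (simp add: D_op_def coeff_poly_shift coeff_pCons algebra_simps split: nat.splits)

lemma E_op_linear: "E_op (smult a p + smult b q) = smult a (E_op p) + smult b (E_op q)"
  by (rule poly_eqI) (simp add: E_op_def coeff_pCons algebra_simps split: nat.splits)

lemma D_op_add: "D_op c (p + q) = D_op c p + D_op c q"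
  using D_op_linear[of c 1 p 1 q] by simp

lemma D_op_diff: "D_op c (p - q) = D_op c p - D_op c q"
  using D_op_linear[of c 1 p "- 1" q] by simp

lemma D_op_smult: "D_op c (smult a p) = smult a (D_op c p)"
  using D_op_linear[of c a p 0 0] by simp

lemma E_op_add: "E_op (p + q) = E_op p + E_op q"
  using E_op_linear[of 1 p 1 q] by simp

lemma E_op_diff: "E_op (p - q) = E_op p - E_op q"
  using E_op_linear[of 1 p "- 1" q] by simp

lemma E_op_smult: "E_op (smult a p) = smult a (E_op p)"
  using E_op_linear[of a p 0 0] by simp

lemma D_op_0 [simp]: "D_op c 0 = 0" and E_op_0 [simp]: "E_op 0 = 0"
  by (simp_all add: D_op_def E_op_def)

lemma poly_shift_one: "z * poly (poly_shift 1 p) z = poly p z - coeff p 0"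
  for p :: "real poly"
proof -
  have "p = pCons (coeff p 0) (poly_shift 1 p)"
    by (rule poly_eqI) (simp add: coeff_poly_shift coeff_pCons split: nat.splits)
  then have "poly p z = coeff p 0 + z * poly (poly_shift 1 p) z" by (metis poly_pCons)
  then show ?thesis by simp
qed

text \<open>Evaluation is a left eigenvector of \<open>D_op\<close> up to the constant coefficient;
  the factor of this defect vanishes exactly for \<open>c = 1 / z\<close>.\<close>

lemma poly_D_op:
  assumes "z \<noteq> 0"
  shows "poly (D_op c p) z = (1 + 1 / z) * poly p z + (c - 1 / z) * coeff p 0"
proof -
  have e: "poly p z = coeff p 0 + z * poly (poly_shift 1 p) z" unfolding poly_shift_one by simp
  show ?thesis unfolding D_op_def poly_add e using assms by (simp add: field_simps)
qed

lemma poly_E_op: "poly (E_op p) z = (1 + z) * poly p z"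
  by (simp add: E_op_def algebra_simps)

text \<open>All configurations with colors 1 and \<infinity> on \<open>1, ..., L\<close>, each with
  its matrix product applied to the right vector; the first site is the outermost operator, and the
  sites beyond \<open>L\<close> are holes.\<close>

fun weights :: "real \<Rightarrow> nat \<Rightarrow> (config \<times> real poly) list" where
  "weights c 0 = [(\<lambda>_. \<infinity>, 1)]"
| "weights c (Suc L) = map (\<lambda>(\<eta>, p). (config_Cons 1 \<eta>, D_op c p)) (weights c L)
                     @ map (\<lambda>(\<eta>, p). (config_Cons \<infinity> \<eta>, E_op p)) (weights c L)"

definition ansatz :: "real \<Rightarrow> nat \<Rightarrow> (config \<Rightarrow> real) \<Rightarrow> real poly" where
  "ansatz c L g = (\<Sum>(\<eta>, p)\<leftarrow>weights c L. smult (g \<eta>) p)"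

lemma ansatz_0: "ansatz c 0 g = [: g (\<lambda>_. \<infinity>) :]"
  by (simp add: ansatz_def)

lemma ansatz_Suc:
  "ansatz c (Suc L) g = D_op c (ansatz c L (\<lambda>\<eta>. g (config_Cons 1 \<eta>)))
                   + E_op (ansatz c L (\<lambda>\<eta>. g (config_Cons \<infinity> \<eta>)))"
proof -
  have D: "(\<Sum>(\<eta>, p)\<leftarrow>map (\<lambda>(\<eta>, p). (config_Cons 1 \<eta>, D_op c p)) xs. smult (g \<eta>) p)
      = D_op c (\<Sum>(\<eta>, p)\<leftarrow>xs. smult (g (config_Cons 1 \<eta>)) p)" for xs
    by (induction xs) (auto simp: D_op_add D_op_smult)
  have E: "(\<Sum>(\<eta>, p)\<leftarrow>map (\<lambda>(\<eta>, p). (config_Cons \<infinity> \<eta>, E_op p)) xs. smult (g \<eta>) p)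
      = E_op (\<Sum>(\<eta>, p)\<leftarrow>xs. smult (g (config_Cons \<infinity> \<eta>)) p)" for xs
    by (induction xs) (auto simp: E_op_add E_op_smult)
  show ?thesis unfolding ansatz_def weights.simps sum_list_append map_append D E ..
qed

lemma ansatz_linear:
  "ansatz c L (\<lambda>\<eta>. a * g \<eta> + b * h \<eta>) = smult a (ansatz c L g) + smult b (ansatz c L h)"
proof -
  have "(\<Sum>(\<eta>, p)\<leftarrow>xs. smult (a * g \<eta> + b * h \<eta>) p)
      = smult a (\<Sum>(\<eta>, p)\<leftarrow>xs. smult (g \<eta>) p) + smult b (\<Sum>(\<eta>, p)\<leftarrow>xs. smult (h \<eta>) p)" for xs
    by (induction xs) (auto simp: smult_add_left smult_add_right)
  then show ?thesis unfolding ansatz_def .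
qed

lemma ansatz_zero [simp]: "ansatz c L (\<lambda>_. 0) = 0"
  using ansatz_linear[of c L 0 "\<lambda>_. 0" 0 "\<lambda>_. 0"] by simp

text \<open>Both operators preserve nonnegative coefficients when \<open>c\<close> is nonnegative.
  This makes the stationary weights nonnegative and each coefficient of \<open>ansatz\<close>
  monotone in the test function.\<close>

lemma weights_nonneg:
  assumes "0 \<le> c" "(\<eta>, p) \<in> set (weights c L)"
  shows "0 \<le> coeff p k"
  using assms(2)
proof (induction L arbitrary: \<eta> p k)
  case 0
  then show ?case by simp
next
  case (Suc L)
  then consider \<zeta> q where "(\<zeta>, q) \<in> set (weights c L)" "p = D_op c q"
    | \<zeta> q where "(\<zeta>, q) \<in> set (weights c L)" "p = E_op q" by auto
  then show ?case
  proof cases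
    case 1
    then show ?thesis using Suc.IH[OF 1(1)] assms(1)
      by (simp add: D_op_def coeff_poly_shift coeff_pCons split: nat.splits)
  next
    case 2
    then show ?thesis using Suc.IH[OF 2(1)] by (simp add: E_op_def coeff_pCons split: nat.splits)
  qed
qed

lemma ansatz_coeff_mono:
  assumes "0 \<le> c" "\<And>\<eta>. g \<eta> \<le> h \<eta>"
  shows "coeff (ansatz c L g) k \<le> coeff (ansatz c L h) k"
proof -
  have "(\<Sum>(\<eta>, p)\<leftarrow>xs. g \<eta> * coeff p k) \<le> (\<Sum>(\<eta>, p)\<leftarrow>xs. h \<eta> * coeff p k)"
    if "set xs \<subseteq> set (weights c L)" for xs
    using that assms weights_nonneg[OF assms(1), of _ _ L k]
    by (intro sum_list_mono) (auto intro!: mult_right_mono)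
  moreover have "coeff (\<Sum>(\<eta>, p)\<leftarrow>xs. smult (g \<eta>) p) k = (\<Sum>(\<eta>, p)\<leftarrow>xs. g \<eta> * coeff p k)"
    for xs and g :: "config \<Rightarrow> real"
    by (induction xs) auto
  ultimately show ?thesis by (simp add: ansatz_def)
qed

lemma poly_mono_coeff:
  fixes p :: "real poly"
  assumes "\<And>k. 0 \<le> coeff p k" "0 \<le> x" "x \<le> y"
  shows "poly p x \<le> poly p y"
  unfolding poly_altdef by (intro sum_mono mult_left_mono power_mono assms)

lemma poly_nonneg_coeff:
  fixes p :: "real poly"
  assumes "\<And>k. 0 \<le> coeff p k" "0 \<le> x"
  shows "0 \<le> poly p x"
  unfolding poly_altdef by (intro sum_nonneg mult_nonneg_nonneg zero_le_power assms)

definition bulk_gen where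
  "bulk_gen \<alpha> \<beta> L g \<eta>
     = (\<Sum>i\<in>{1..L}. chain_rate \<alpha> \<beta> L i * (g (chain_letter L i \<eta>) - g \<eta>))"

lemma chain_letter_Cons:
  assumes "1 \<le> i"
  shows "chain_letter (Suc L) (Suc i) (config_Cons a \<eta>) = config_Cons a (chain_letter L i \<eta>)"
  using assms
  by (intro ext) (auto simp: chain_letter_def letter_def exchange_def config_Cons_def)

lemma exchange_Cons:
  "exchange 1 (config_Cons a (config_Cons b \<eta>)) = config_Cons b (config_Cons a \<eta>)"
  by (intro ext) (auto simp: exchange_def config_Cons_def)

lemma bulk_gen_Cons:
  "bulk_gen \<alpha> \<beta> (Suc (Suc M)) g (config_Cons a \<eta>)
   = (if a < \<eta> 1 then g (exchange 1 (config_Cons a \<eta>)) - g (config_Cons a \<eta>) else 0)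
     + bulk_gen \<alpha> \<beta> (Suc M) (\<lambda>\<eta>. g (config_Cons a \<eta>)) \<eta>"
proof -
  have 1: "{1..Suc (Suc M)} = insert 1 (Suc ` {1..Suc M})"
    by (auto simp: image_iff Suc_le_eq gr0_conv_Suc) presburger+
  have 2: "1 \<notin> Suc ` {1..Suc M}" by auto
  have "letter 1 (config_Cons a \<eta>)
      = (if a < \<eta> 1 then exchange 1 (config_Cons a \<eta>) else config_Cons a \<eta>)"
    by (simp add: letter_def config_Cons_def)
  then have 3: "chain_rate \<alpha> \<beta> (Suc (Suc M)) 1
      * (g (chain_letter (Suc (Suc M)) 1 (config_Cons a \<eta>)) - g (config_Cons a \<eta>))
    = (if a < \<eta> 1 then g (exchange 1 (config_Cons a \<eta>)) - g (config_Cons a \<eta>) else 0)"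
    by (simp add: chain_rate_def chain_letter_def)
  show ?thesis
    unfolding bulk_gen_def 1 sum.insert[OF finite_imageI[OF finite_atLeastAtMost] 2] 3
    by (subst sum.reindex)
       (auto simp: chain_letter_Cons chain_rate_def intro!: sum.cong)
qed

text \<open>The matrix ansatz: summing the bulk and exit part of the generator against the weights
  telescopes, thanks to \<open>DE = D + E\<close>.\<close>

lemma ansatz_bulk_gen:
  assumes \<beta>: "\<beta> \<noteq> 0" and c: "c = 1 / \<beta> - 1"
  shows "ansatz c (Suc M) (bulk_gen \<alpha> \<beta> (Suc M) g)
    = ansatz c M (\<lambda>\<eta>. g (config_Cons \<infinity> \<eta>)) - ansatz c M (\<lambda>\<eta>. g (config_Cons 1 \<eta>))"
proof (induction M arbitrary: g)
  case 0
  have e: "(config_Cons a \<eta>)(Suc 0 := \<infinity>) = config_Cons \<infinity> \<eta>" for a \<eta>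
    by (auto simp: config_Cons_def)
  have "D_op c [:x:] = [:x / \<beta>:]" for x
    using \<beta> by (intro poly_eqI) (simp add: D_op_def c coeff_poly_shift coeff_pCons field_simps split: nat.splits)
  then show ?case
    using \<beta> by (simp add: ansatz_Suc ansatz_0 bulk_gen_def chain_rate_def chain_letter_def e)
next
  case (Suc M)
  let ?L = "Suc (Suc M)"
  let ?T = "\<lambda>a \<eta>. if a < \<eta> 1 then g (exchange 1 (config_Cons a \<eta>)) - g (config_Cons a \<eta>) else 0"
  let ?v = "\<lambda>a b. ansatz c M (\<lambda>\<eta>. g (config_Cons a (config_Cons b \<eta>)))"
  have T: "ansatz c (Suc M) (?T \<infinity>) = 0" "ansatz c (Suc M) (?T 1) = E_op (?v \<infinity> 1 - ?v 1 \<infinity>)"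
  proof -
    show "ansatz c (Suc M) (?T \<infinity>) = 0" by simp
    have 1: "?T 1 (config_Cons 1 \<eta>) = 0" for \<eta> by (simp add: config_Cons_def)
    have 2: "?T 1 (config_Cons \<infinity> \<eta>)
        = 1 * g (config_Cons \<infinity> (config_Cons 1 \<eta>)) + (- 1) * g (config_Cons 1 (config_Cons \<infinity> \<eta>))" for \<eta>
    proof -
      have "config_Cons \<infinity> \<eta> 1 = \<infinity>" by (simp add: config_Cons_def)
      then show ?thesis by (simp add: exchange_Cons[unfolded One_nat_def])
    qed
    have "ansatz c (Suc M) (?T 1) = D_op c (ansatz c M (\<lambda>\<eta>. ?T 1 (config_Cons 1 \<eta>)))
        + E_op (ansatz c M (\<lambda>\<eta>. ?T 1 (config_Cons \<infinity> \<eta>)))" by (rule ansatz_Suc)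
    also have "\<dots> = E_op (?v \<infinity> 1 - ?v 1 \<infinity>)"
      unfolding 1 2 ansatz_linear by simp
    finally show "ansatz c (Suc M) (?T 1) = E_op (?v \<infinity> 1 - ?v 1 \<infinity>)" .
  qed
  have B: "ansatz c (Suc M) (\<lambda>\<eta>. bulk_gen \<alpha> \<beta> ?L g (config_Cons a \<eta>))
      = ansatz c (Suc M) (?T a) + (?v a \<infinity> - ?v a 1)" for a
    unfolding bulk_gen_Cons
    using ansatz_linear[of c "Suc M" 1 "?T a" 1 "bulk_gen \<alpha> \<beta> (Suc M) (\<lambda>\<eta>. g (config_Cons a \<eta>))"]
      Suc.IH[of "\<lambda>\<eta>. g (config_Cons a \<eta>)"]
    by simp
  \<comment> \<open>The swap term enters as \<open>D_op\<close> of
    \<open>E_op (?v \<infinity> 1 - ?v 1 \<infinity>)\<close>; expanding by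
    \<open>DE_algebra\<close> cancels \<open>D_op (?v 1 \<infinity>)\<close> and
    \<open>E_op (?v \<infinity> 1)\<close> left by the induction hypothesis.\<close>
  show ?case
    unfolding ansatz_Suc[of c "Suc M"] B T
    unfolding ansatz_Suc[of c M] by (simp add: D_op_add D_op_diff E_op_diff DE_algebra)
qed

lemma chain_gen_eq_bulk_gen:
  assumes "1 \<le> L"
  shows "chain_gen \<alpha> \<beta> L g \<eta> = \<alpha> * (g (letter 0 \<eta>) - g \<eta>) + bulk_gen \<alpha> \<beta> L g \<eta>"
proof -
  have "{..L} = insert 0 {1..L}" by auto
  then show ?thesis
    using assms by (simp add: gen_def bulk_gen_def chain_rate_def chain_letter_def)
qed

text \<open>The injection contributes \<alpha> times \<open>E_op\<close> of a difference that is the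
  opposite of the telescoped remainder of the bulk, and at \<open>(1 - \<alpha>) / \<alpha>\<close>
  the operator \<open>E_op\<close> multiplies by \<open>1 / \<alpha>\<close>.\<close>

lemma stationary:
  assumes \<alpha>: "0 < \<alpha>" "\<alpha> < 1" and \<beta>: "\<beta> \<noteq> 0" and c: "c = 1 / \<beta> - 1" and L: "1 \<le> L"
  shows "poly (ansatz c L (chain_gen \<alpha> \<beta> L g)) ((1 - \<alpha>) / \<alpha>) = 0"
proof -
  let ?z = "(1 - \<alpha>) / \<alpha>"
  obtain M where M: "L = Suc M" using L by (cases L) auto
  let ?J = "\<lambda>\<eta>. g (letter 0 \<eta>) - g \<eta>"
  let ?g = "\<lambda>a \<eta>. g (config_Cons a \<eta>)"
  have "letter 0 (config_Cons 1 \<eta>) = config_Cons 1 \<eta>" for \<eta>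
    by (simp add: letter_def config_Cons_def)
  moreover have "letter 0 (config_Cons \<infinity> \<eta>) = config_Cons 1 \<eta>" for \<eta>
    by (auto simp: letter_def config_Cons_def inject_def)
  ultimately have J: "ansatz c L ?J = E_op (ansatz c M (?g 1) - ansatz c M (?g \<infinity>))"
    using ansatz_linear[of c M 1 "?g 1" "- 1" "?g \<infinity>"] by (simp add: M ansatz_Suc)
  have "ansatz c L (chain_gen \<alpha> \<beta> L g) = ansatz c L (\<lambda>\<eta>. \<alpha> * ?J \<eta> + 1 * bulk_gen \<alpha> \<beta> L g \<eta>)"
    by (intro arg_cong[where f = "ansatz c L"] ext) (simp add: chain_gen_eq_bulk_gen[OF L])
  also have "\<dots> = smult \<alpha> (ansatz c L ?J) + ansatz c L (bulk_gen \<alpha> \<beta> L g)"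
    unfolding ansatz_linear by simp
  also have "ansatz c L (bulk_gen \<alpha> \<beta> L g) = ansatz c M (?g \<infinity>) - ansatz c M (?g 1)"
    unfolding M by (rule ansatz_bulk_gen[OF \<beta> c])
  finally have eq: "ansatz c L (chain_gen \<alpha> \<beta> L g)
      = smult \<alpha> (ansatz c L ?J) + (ansatz c M (?g \<infinity>) - ansatz c M (?g 1))" .
  have "1 + ?z = 1 / \<alpha>" using \<alpha> by (simp add: field_simps)
  then show ?thesis
    unfolding eq J poly_add poly_diff poly_smult poly_E_op using \<alpha> by simp
qed

section \<open>Unnormalized stationary expectations\<close>

definition stat :: "real \<Rightarrow> real \<Rightarrow> nat \<Rightarrow> (config \<Rightarrow> real) \<Rightarrow> real" where
  "stat \<alpha> c L g = poly (ansatz c L g) ((1 - \<alpha>) / \<alpha>)"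

lemma stat_eq_sum: "stat \<alpha> c L g = (\<Sum>(\<eta>, p)\<leftarrow>weights c L. g \<eta> * poly p ((1 - \<alpha>) / \<alpha>))"
proof -
  have "poly (\<Sum>(\<eta>, p)\<leftarrow>xs. smult (g \<eta>) p) z = (\<Sum>(\<eta>, p)\<leftarrow>xs. g \<eta> * poly p z)" for xs z
    by (induction xs) auto
  then show ?thesis by (simp add: stat_def ansatz_def)
qed

lemma stat_linear: "stat \<alpha> c L (\<lambda>\<eta>. a * g \<eta> + b * h \<eta>) = a * stat \<alpha> c L g + b * stat \<alpha> c L h"
  by (simp add: stat_def ansatz_linear)

lemma stat_const: "stat \<alpha> c L (\<lambda>_. a) = a * stat \<alpha> c L (\<lambda>_. 1)"
  using stat_linear[of \<alpha> c L a "\<lambda>_. 1" 0 "\<lambda>_. 1"] by simp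

lemma stat_mono:
  assumes "0 < \<alpha>" "\<alpha> < 1" "0 \<le> c" "\<And>\<eta>. g \<eta> \<le> h \<eta>"
  shows "stat \<alpha> c L g \<le> stat \<alpha> c L h"
  unfolding stat_eq_sum
proof (rule sum_list_mono)
  fix x assume "x \<in> set (weights c L)"
  moreover obtain \<eta> p where "x = (\<eta>, p)" by (cases x)
  ultimately have "0 \<le> poly p ((1 - \<alpha>) / \<alpha>)"
    using weights_nonneg[OF assms(3), of \<eta> p L] assms by (intro poly_nonneg_coeff) auto
  then show "(case x of (\<eta>, p) \<Rightarrow> g \<eta> * poly p ((1 - \<alpha>) / \<alpha>))
      \<le> (case x of (\<eta>, p) \<Rightarrow> h \<eta> * poly p ((1 - \<alpha>) / \<alpha>))"
    using assms(4) \<open>x = (\<eta>, p)\<close> by (simp add: mult_right_mono)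
qed

lemma sums_sum_list:
  fixes f :: "'b \<Rightarrow> nat \<Rightarrow> real"
  assumes "\<And>x. x \<in> set xs \<Longrightarrow> f x sums s x"
  shows "(\<lambda>k. \<Sum>x\<leftarrow>xs. f x k) sums (\<Sum>x\<leftarrow>xs. s x)"
  using assms by (induction xs) (auto intro!: sums_add)

lemma stat_gen_pow:
  assumes "0 < \<alpha>" "\<alpha> < 1" "\<beta> \<noteq> 0" "c = 1 / \<beta> - 1" "1 \<le> L" "k \<noteq> 0"
  shows "stat \<alpha> c L ((chain_gen \<alpha> \<beta> L ^^ k) g) = 0"
proof -
  obtain j where "k = Suc j" using assms(6) by (cases k) auto
  then show ?thesis using stationary[OF assms(1-5)] by (simp add: stat_def)
qed

text \<open>All powers of the generator beyond the zeroth have stationary sum zero, and the weights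
  form a finite list, so the series may be summed term by term.\<close>

lemma stat_evol:
  assumes \<alpha>: "0 < \<alpha>" "\<alpha> < 1" and \<beta>: "0 < \<beta>" and c: "c = 1 / \<beta> - 1" and L: "1 \<le> L"
    and g: "\<And>\<eta>. \<bar>g \<eta>\<bar> \<le> B"
  shows "stat \<alpha> c L (chain_evol \<alpha> \<beta> L t g) = stat \<alpha> c L g"
proof -
  let ?G = "\<lambda>k. (chain_gen \<alpha> \<beta> L ^^ k) g"
  have nn: "\<And>i. i \<le> L \<Longrightarrow> 0 \<le> chain_rate \<alpha> \<beta> L i" using \<alpha> \<beta> by (simp add: chain_rate_nonneg)
  have 1: "(\<lambda>k. \<Sum>x\<leftarrow>weights c L. ?G k (fst x) / fact k * t ^ k * poly (snd x) ((1 - \<alpha>) / \<alpha>))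
      sums (\<Sum>x\<leftarrow>weights c L. chain_evol \<alpha> \<beta> L t g (fst x) * poly (snd x) ((1 - \<alpha>) / \<alpha>))"
    unfolding evol_def
    by (intro sums_sum_list sums_mult2 summable_sums evol_summable[OF nn g])
  have 2: "(\<Sum>x\<leftarrow>weights c L. ?G k (fst x) / fact k * t ^ k * poly (snd x) ((1 - \<alpha>) / \<alpha>))
      = (if k = 0 then stat \<alpha> c L g else 0)" for k
  proof -
    have "(\<Sum>x\<leftarrow>weights c L. ?G k (fst x) / fact k * t ^ k * poly (snd x) ((1 - \<alpha>) / \<alpha>))
        = t ^ k / fact k * stat \<alpha> c L (?G k)"
      unfolding stat_eq_sum sum_list_const_mult[symmetric]
      by (intro arg_cong[where f = sum_list] map_cong refl) (auto simp: field_simps)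
    then show ?thesis using stat_gen_pow[OF \<alpha> _ c L, of k g] \<beta> by (cases "k = 0") auto
  qed
  have "(\<lambda>k. if k = 0 then stat \<alpha> c L g else 0) sums stat \<alpha> c L (chain_evol \<alpha> \<beta> L t g)"
    using 1 unfolding 2 stat_eq_sum[of \<alpha> c L "chain_evol \<alpha> \<beta> L t g"] case_prod_beta .
  moreover have "(\<lambda>k. if k = 0 then stat \<alpha> c L g else 0) sums stat \<alpha> c L g"
    using sums_If_finite_set[of "{0::nat}" "\<lambda>_. stat \<alpha> c L g"] by simp
  ultimately show ?thesis by (rule sums_unique2)
qed

section \<open>Comparison with the Bernoulli product measure\<close>

fun bern :: "real \<Rightarrow> nat \<Rightarrow> (config \<Rightarrow> real) \<Rightarrow> real" where
  "bern \<alpha> 0 g = g (\<lambda>_. \<infinity>)"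
| "bern \<alpha> (Suc n) g = \<alpha> * bern \<alpha> n (\<lambda>\<eta>. g (config_Cons 1 \<eta>))
                     + (1 - \<alpha>) * bern \<alpha> n (\<lambda>\<eta>. g (config_Cons \<infinity> \<eta>))"

lemma depends_on_Cons:
  assumes "depends_on (Suc n) g"
  shows "depends_on n (\<lambda>\<eta>. g (config_Cons a \<eta>))"
  unfolding depends_on_def
proof (intro allI impI)
  fix \<eta> \<zeta> :: config assume "\<forall>x\<in>{1..n}. \<eta> x = \<zeta> x"
  then have "\<eta> (x - 1) = \<zeta> (x - 1)" if "x \<noteq> 1" "1 \<le> x" "x \<le> Suc n" for x
    by (rule bspec) (use that in auto)
  then show "g (config_Cons a \<eta>) = g (config_Cons a \<zeta>)"
    by (intro depends_onD[OF assms]) (simp add: config_Cons_def)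
qed

lemma depends_on_0: "depends_on 0 g \<Longrightarrow> g \<eta> = g \<zeta>"
  by (auto simp: depends_on_def)

lemma bern_const [simp]: "bern \<alpha> n (\<lambda>_. a) = a"
  by (induction n) (auto simp: algebra_simps)

lemma bern_depends_on:
  assumes "depends_on n g" "n \<le> L"
  shows "bern \<alpha> L g = bern \<alpha> n g"
  using assms
proof (induction n arbitrary: g L)
  case 0
  then have "g = (\<lambda>_. g (\<lambda>_. \<infinity>))" using depends_on_0 by (intro ext) auto
  from arg_cong[OF this, of "bern \<alpha> L"] show ?case by simp
next
  case (Suc n)
  then obtain M where M: "L = Suc M" "n \<le> M" by (cases L) auto
  show ?case
    unfolding M(1) bern.simps Suc.IH[OF depends_on_Cons[OF Suc.prems(1)] M(2)] ..
qed

lemma particles_Cons: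
  "particles (Suc n) (config_Cons a \<eta>) = of_bool (a < 2) + particles n \<eta>"
proof -
  have 1: "{0<..Suc n} = insert 1 (Suc ` {0<..n})"
  proof (intro set_eqI iffI)
    fix x assume "x \<in> {0<..Suc n}"
    then have "x = 1 \<or> x = Suc (x - 1) \<and> x - 1 \<in> {0<..n}" by auto
    then show "x \<in> insert 1 (Suc ` {0<..n})" by blast
  qed auto
  have "int (particles (Suc n) (config_Cons a \<eta>)) = of_bool (a < 2) + int (particles n \<eta>)"
  proof -
    have "(\<Sum>y\<in>Suc ` {0<..n}. of_bool (config_Cons a \<eta> y < 2)) = (\<Sum>y\<in>{0<..n}. of_bool (\<eta> y < 2) :: int)"
      unfolding sum.reindex[OF inj_on_subset[OF inj_Suc subset_UNIV]]
      by (intro sum.cong refl) (simp add: config_Cons_def)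
    moreover have "config_Cons a \<eta> 1 = a" by (simp add: config_Cons_def)
    moreover have "1 \<notin> Suc ` {0<..n}" by auto
    ultimately show ?thesis
      unfolding particles_eq_sum 1 by (subst sum.insert) (simp_all only: finite_imageI finite_greaterThanAtMost not_False_eq_True)
  qed
  then show ?thesis by (cases "a < 2") auto
qed

lemma bern_particles:
  "bern \<alpha> N (\<lambda>\<eta>. \<phi> (particles N \<eta>))
   = (\<Sum>n\<le>N. real (N choose n) * (\<alpha> ^ n * (1 - \<alpha>) ^ (N - n) * \<phi> n))"
proof (induction N arbitrary: \<phi>)
  case 0
  then show ?case by (simp add: particles_def)
next
  case (Suc N)
  define w where "w n = \<alpha> ^ n * (1 - \<alpha>) ^ (Suc N - n) * \<phi> n" for n
  have w: "\<alpha> * (real (N choose n) * (\<alpha> ^ n * (1 - \<alpha>) ^ (N - n) * \<phi> (Suc n)))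
      = real (N choose n) * w (Suc n)" for n
    by (simp add: w_def)
  have w': "(1 - \<alpha>) * (real (N choose n) * (\<alpha> ^ n * (1 - \<alpha>) ^ (N - n) * \<phi> n))
      = real (N choose n) * w n" if "n \<le> N" for n
    using that by (simp add: w_def Suc_diff_le)
  have p: "particles (Suc N) (config_Cons 1 \<eta>) = Suc (particles N \<eta>)"
    "particles (Suc N) (config_Cons \<infinity> \<eta>) = particles N \<eta>" for \<eta>
    by (simp_all add: particles_Cons)
  have "bern \<alpha> (Suc N) (\<lambda>\<eta>. \<phi> (particles (Suc N) \<eta>))
      = (\<Sum>n\<le>N. real (N choose n) * w (Suc n)) + (\<Sum>n\<le>N. real (N choose n) * w n)"
    unfolding bern.simps p Suc.IH[of \<phi>] Suc.IH[of "\<lambda>n. \<phi> (Suc n)"] sum_distrib_left w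
    by (intro arg_cong2[where f = "(+)"] refl sum.cong) (rule w', simp)
  also have "(\<Sum>n\<le>N. real (N choose n) * w n) = (\<Sum>n\<le>Suc N. real (N choose n) * w n)"
    by simp
  also have "\<dots> = w 0 + (\<Sum>n\<le>N. real (N choose Suc n) * w (Suc n))"
    unfolding sum.atMost_Suc_shift by simp
  also have "(\<Sum>n\<le>N. real (N choose n) * w (Suc n)) + \<dots>
      = w 0 + (\<Sum>n\<le>N. real (Suc N choose Suc n) * w (Suc n))"
    by (simp add: sum.distrib[symmetric] distrib_right)
  also have "\<dots> = (\<Sum>n\<le>Suc N. real (Suc N choose n) * w n)"
    unfolding sum.atMost_Suc_shift by simp
  finally show ?case unfolding w_def .
qed

text \<open>The first two coefficients are in the ratio \<alpha> to \<open>1 - \<alpha>\<close>, as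
  in \<open>bern\<close>; the last term measures the failure of the product form.\<close>

lemma stat_Suc:
  assumes "0 < \<alpha>" "\<alpha> < 1"
  shows "stat \<alpha> c (Suc L) g = 1 / (1 - \<alpha>) * stat \<alpha> c L (\<lambda>\<eta>. g (config_Cons 1 \<eta>))
    + 1 / \<alpha> * stat \<alpha> c L (\<lambda>\<eta>. g (config_Cons \<infinity> \<eta>))
    + (c - \<alpha> / (1 - \<alpha>)) * coeff (ansatz c L (\<lambda>\<eta>. g (config_Cons 1 \<eta>))) 0"
proof -
  have z: "(1 - \<alpha>) / \<alpha> \<noteq> 0" and eqs: "1 + \<alpha> / (1 - \<alpha>) = 1 / (1 - \<alpha>)" "1 + (1 - \<alpha>) / \<alpha> = 1 / \<alpha>"
    "1 / ((1 - \<alpha>) / \<alpha>) = \<alpha> / (1 - \<alpha>)"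
    using assms by (simp_all add: field_simps)
  show ?thesis unfolding stat_def ansatz_Suc poly_add poly_D_op[OF z] poly_E_op eqs by simp
qed

text \<open>This \<open>c\<close> belongs to the exit rate \<open>1 - \<alpha>\<close> and removes
  the defect in \<open>stat_Suc\<close>.\<close>

lemma stat_bernoulli:
  assumes "0 < \<alpha>" "\<alpha> < 1"
  shows "stat \<alpha> (\<alpha> / (1 - \<alpha>)) L g = (1 / (\<alpha> * (1 - \<alpha>))) ^ L * bern \<alpha> L g"
proof (induction L arbitrary: g)
  case 0
  then show ?case by (simp add: stat_def ansatz_0)
next
  case (Suc L)
  let ?k = "1 / (\<alpha> * (1 - \<alpha>))"
  have k: "1 / (1 - \<alpha>) = ?k * \<alpha>" "1 / \<alpha> = ?k * (1 - \<alpha>)" using assms by simp_all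
  show ?case
    unfolding stat_Suc[OF assms] Suc.IH bern.simps k power_Suc by (simp only: algebra_simps)
qed

text \<open>Ballot numbers: for \<open>c = 0\<close> the sum of the two operators makes two steps of
  a simple path, and the coefficient counts nonnegative paths with \<open>2 * L + 1\<close> steps
  from 0 to \<open>2 * k + 1\<close>. The difference of binomials is the reflection
  principle.\<close>

lemma coeff_ansatz_one:
  "coeff (ansatz 0 L (\<lambda>_. 1)) k
     = real ((2 * L + 1) choose (L + 1 + k)) - real ((2 * L + 1) choose (L + 2 + k))"
proof (induction L arbitrary: k)
  case 0
  then show ?case by (simp add: ansatz_0 coeff_pCons split: nat.splits)
next
  case (Suc L)
  let ?p = "ansatz 0 L (\<lambda>_. 1)" and ?C = "\<lambda>j. real ((2 * L + 1) choose j)"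
  have S: "coeff (ansatz 0 (Suc L) (\<lambda>_. 1)) k
      = 2 * coeff ?p k + coeff ?p (Suc k) + (case k of 0 \<Rightarrow> 0 | Suc j \<Rightarrow> coeff ?p j)"
    by (simp only: ansatz_Suc D_op_def E_op_def coeff_add coeff_poly_shift coeff_pCons)
       (simp split: nat.splits)
  have pascal: "real ((2 * Suc L + 1) choose (Suc (Suc j))) = ?C (Suc (Suc j)) + 2 * ?C (Suc j) + ?C j" for j
    by simp
  \<comment> \<open>At the wall \<open>k = 0\<close> the absent lower term would be the difference
    of these two binomials, which is zero.\<close>
  have sym: "?C L = ?C (Suc L)" using binomial_symmetric[of L "2 * L + 1"] by simp
  show ?case
  proof (cases k)
    case 0
    then show ?thesis
      using pascal[of L] pascal[of "Suc L"] sym unfolding S Suc.IH by simp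
  next
    case (Suc j)
    then show ?thesis
      using pascal[of "L + k"] pascal[of "Suc L + k"] unfolding S Suc.IH by simp
  qed
qed

lemma poly_ansatz_one: "poly (ansatz 0 L (\<lambda>_. 1)) 1 = real ((2 * L + 1) choose (L + 1))"
proof (induction L)
  case 0
  then show ?case by (simp add: ansatz_0)
next
  case (Suc L)
  have sym: "(2 * L + 1) choose L = (2 * L + 1) choose (Suc L)"
    using binomial_symmetric[of L "2 * L + 1"] by simp
  have "poly (ansatz 0 (Suc L) (\<lambda>_. 1)) 1 = 4 * poly (ansatz 0 L (\<lambda>_. 1)) 1 - coeff (ansatz 0 L (\<lambda>_. 1)) 0"
    by (simp add: ansatz_Suc poly_D_op poly_E_op)
  then show ?case unfolding Suc.IH coeff_ansatz_one using sym by simp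
qed

lemma coeff_ansatz_one_nonneg: "0 \<le> coeff (ansatz 0 L (\<lambda>_. 1)) k"
  using ansatz_coeff_mono[of 0 "\<lambda>_. 0" "\<lambda>_. 1" L k] by simp

text \<open>The coefficients are nonnegative, so the value grows from the point 1 to
  \<open>(1 - \<alpha>) / \<alpha>\<close>, which is at least 1 because
  \<open>\<alpha> \<le> 1/2\<close>.\<close>

lemma stat_one_ge:
  assumes "0 < \<alpha>" "\<alpha> \<le> 1/2"
  shows "real ((2 * L + 1) choose (L + 1)) \<le> stat \<alpha> 0 L (\<lambda>_. 1)"
  unfolding poly_ansatz_one[symmetric] stat_def
  by (rule poly_mono_coeff[OF coeff_ansatz_one_nonneg]) (use assms in \<open>auto simp: field_simps\<close>)

lemma stat_one_pos:
  assumes "0 < \<alpha>" "\<alpha> \<le> 1/2"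
  shows "0 < stat \<alpha> 0 L (\<lambda>_. 1)"
proof -
  have "0 < (2 * L + 1) choose (L + 1)" by (rule zero_less_binomial) simp
  then have "0 < real ((2 * L + 1) choose (L + 1))" by (simp only: of_nat_0_less_iff)
  then show ?thesis using stat_one_ge[OF assms, of L] by linarith
qed

text \<open>The constant coefficient is a Catalan number, \<open>2 / (L + 2)\<close> times the
  middle binomial coefficient that bounds the denominator from below.\<close>

lemma boundary_ratio_tendsto:
  assumes "0 < \<alpha>" "\<alpha> \<le> 1/2"
  shows "(\<lambda>L. coeff (ansatz 0 L (\<lambda>_. 1)) 0 / stat \<alpha> 0 L (\<lambda>_. 1)) \<longlonglongrightarrow> 0"
proof (rule tendsto_sandwich)
  show "\<forall>\<^sub>F L in sequentially. 0 \<le> coeff (ansatz 0 L (\<lambda>_. 1)) 0 / stat \<alpha> 0 L (\<lambda>_. 1)"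
    using coeff_ansatz_one_nonneg stat_one_pos[OF assms] by (intro always_eventually) (simp add: less_imp_le)
  show "\<forall>\<^sub>F L in sequentially. coeff (ansatz 0 L (\<lambda>_. 1)) 0 / stat \<alpha> 0 L (\<lambda>_. 1) \<le> 2 * inverse (real L + 2)"
  proof (intro always_eventually allI)
    fix L
    let ?C = "\<lambda>j. real ((2 * L + 1) choose j)"
    have "Suc (Suc L) * ((2 * L + 1) choose Suc (Suc L)) = (2 * L + 1) * ((2 * L) choose Suc L)"
      using Suc_times_binomial[of "Suc L" "2 * L"] by simp
    also have "\<dots> = (2 * L + 1 - Suc L) * ((2 * L + 1) choose Suc L)"
      using binomial_absorb_comp[of "2 * L + 1" "Suc L"] by simp
    finally have "real (Suc (Suc L) * ((2 * L + 1) choose Suc (Suc L))) = real (L * ((2 * L + 1) choose Suc L))"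
      by simp
    then have "real (L + 2) * ?C (L + 2) = real L * ?C (L + 1)" by (simp only: of_nat_mult) simp
    then have "real (L + 2) * (?C (L + 1) - ?C (L + 2)) = 2 * ?C (L + 1)" by (simp add: algebra_simps)
    then have "coeff (ansatz 0 L (\<lambda>_. 1)) 0 = 2 * inverse (real L + 2) * ?C (L + 1)"
      unfolding coeff_ansatz_one by (simp add: field_simps)
    also have "\<dots> \<le> 2 * inverse (real L + 2) * stat \<alpha> 0 L (\<lambda>_. 1)"
      using stat_one_ge[OF assms] by (intro mult_left_mono) auto
    finally show "coeff (ansatz 0 L (\<lambda>_. 1)) 0 / stat \<alpha> 0 L (\<lambda>_. 1) \<le> 2 * inverse (real L + 2)"
      using stat_one_pos[OF assms, of L] by (simp add: divide_le_eq)
  qed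
  show "(\<lambda>L. 2 * inverse (real L + 2)) \<longlonglongrightarrow> 0" 
    using tendsto_mult_left[OF LIMSEQ_Suc[OF LIMSEQ_inverse_real_of_nat], of 2]
    by (simp add: add.commute)
qed simp

text \<open>Divide \<open>stat_Suc\<close> for \<open>g\<close> and for the constant 1 by the
  normalization at \<open>L\<close>. The defects vanish, that of \<open>g\<close> being dominated by
  that of 1; the second quotient tends to \<open>1 / (\<alpha> * (1 - \<alpha>))\<close>, and what
  remains is the recursion of \<open>bern\<close>.\<close>

lemma stat_ratio_tendsto:
  assumes \<alpha>: "0 < \<alpha>" "\<alpha> \<le> 1/2"
    and g: "depends_on n g" "\<And>\<eta>. 0 \<le> g \<eta>" "\<And>\<eta>. g \<eta> \<le> 1"
  shows "(\<lambda>L. stat \<alpha> 0 L g / stat \<alpha> 0 L (\<lambda>_. 1)) \<longlonglongrightarrow> bern \<alpha> n g"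
  using g
proof (induction n arbitrary: g)
  case 0
  then have g0: "g = (\<lambda>_. g (\<lambda>_. \<infinity>))" using depends_on_0 by (intro ext) auto
  have "stat \<alpha> 0 L g / stat \<alpha> 0 L (\<lambda>_. 1) = g (\<lambda>_. \<infinity>)" for L
    by (subst g0, subst stat_const) (use stat_one_pos[OF \<alpha>, of L] in simp)
  then show ?case by simp
next
  case (Suc n)
  have \<alpha>1: "\<alpha> < 1" using \<alpha> by simp
  let ?Z = "\<lambda>L. stat \<alpha> 0 L (\<lambda>_. 1)"
  let ?g = "\<lambda>a \<eta>. g (config_Cons a \<eta>)"
  let ?e = "\<lambda>h L. coeff (ansatz 0 L h) 0 / ?Z L"
  have Z: "?Z L \<noteq> 0" for L using stat_one_pos[OF \<alpha>, of L] by simp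
  have IH: "(\<lambda>L. stat \<alpha> 0 L (?g a) / ?Z L) \<longlonglongrightarrow> bern \<alpha> n (?g a)" for a
    using Suc.prems by (intro Suc.IH depends_on_Cons)
  have e: "?e (?g 1) \<longlonglongrightarrow> 0"
  proof (rule tendsto_sandwich[OF _ _ tendsto_const boundary_ratio_tendsto[OF \<alpha>]]; intro always_eventually allI)
    fix L
    have "0 \<le> coeff (ansatz 0 L (?g 1)) 0"
      using ansatz_coeff_mono[of 0 "\<lambda>_. 0" "?g 1" L 0] Suc.prems by simp
    then show "0 \<le> ?e (?g 1) L" using stat_one_pos[OF \<alpha>, of L] by simp
    have "coeff (ansatz 0 L (?g 1)) 0 \<le> coeff (ansatz 0 L (\<lambda>_. 1)) 0"
      using Suc.prems by (intro ansatz_coeff_mono) auto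
    then show "?e (?g 1) L \<le> ?e (\<lambda>_. 1) L"
      using stat_one_pos[OF \<alpha>, of L] by (intro divide_right_mono) auto
  qed
  have ratio: "stat \<alpha> 0 (Suc L) h / ?Z L = 1 / (1 - \<alpha>) * (stat \<alpha> 0 L (\<lambda>\<eta>. h (config_Cons 1 \<eta>)) / ?Z L)
      + 1 / \<alpha> * (stat \<alpha> 0 L (\<lambda>\<eta>. h (config_Cons \<infinity> \<eta>)) / ?Z L)
      + (0 - \<alpha> / (1 - \<alpha>)) * ?e (\<lambda>\<eta>. h (config_Cons 1 \<eta>)) L" for h L
    unfolding stat_Suc[OF \<alpha>(1) \<alpha>1] by (simp add: add_divide_distrib diff_divide_distrib)
  have "(\<lambda>L. stat \<alpha> 0 (Suc L) g / ?Z L) \<longlonglongrightarrow> 1 / (1 - \<alpha>) * bern \<alpha> n (?g 1)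
      + 1 / \<alpha> * bern \<alpha> n (?g \<infinity>) + (0 - \<alpha> / (1 - \<alpha>)) * 0"
    unfolding ratio by (intro tendsto_add tendsto_mult_left IH e)
  moreover have "(\<lambda>L. ?Z (Suc L) / ?Z L) \<longlonglongrightarrow> 1 / (1 - \<alpha>) * 1 + 1 / \<alpha> * 1 + (0 - \<alpha> / (1 - \<alpha>)) * 0"
  proof -
    have "?Z L / ?Z L = 1" for L using Z by simp
    then show ?thesis unfolding ratio
      by (intro tendsto_add tendsto_mult_left boundary_ratio_tendsto[OF \<alpha>]) auto
  qed
  moreover have "1 / (1 - \<alpha>) * 1 + 1 / \<alpha> * 1 + (0 - \<alpha> / (1 - \<alpha>)) * 0 \<noteq> 0"
    using \<alpha> \<alpha>1 by (simp add: field_simps)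
  ultimately have "(\<lambda>L. (stat \<alpha> 0 (Suc L) g / ?Z L) / (?Z (Suc L) / ?Z L))
      \<longlonglongrightarrow> (1 / (1 - \<alpha>) * bern \<alpha> n (?g 1) + 1 / \<alpha> * bern \<alpha> n (?g \<infinity>) + (0 - \<alpha> / (1 - \<alpha>)) * 0)
        / (1 / (1 - \<alpha>) * 1 + 1 / \<alpha> * 1 + (0 - \<alpha> / (1 - \<alpha>)) * 0)"
    by (rule tendsto_divide)
  moreover have "(stat \<alpha> 0 (Suc L) g / ?Z L) / (?Z (Suc L) / ?Z L) = stat \<alpha> 0 (Suc L) g / ?Z (Suc L)" for L
    using Z[of L] by simp
  moreover have "(1 / (1 - \<alpha>) * bern \<alpha> n (?g 1) + 1 / \<alpha> * bern \<alpha> n (?g \<infinity>) + (0 - \<alpha> / (1 - \<alpha>)) * 0)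
        / (1 / (1 - \<alpha>) * 1 + 1 / \<alpha> * 1 + (0 - \<alpha> / (1 - \<alpha>)) * 0) = bern \<alpha> (Suc n) g"
  proof -
    have "1 / (1 - \<alpha>) * 1 + 1 / \<alpha> * 1 + (0 - \<alpha> / (1 - \<alpha>)) * 0 = 1 / (\<alpha> * (1 - \<alpha>))"
      using \<alpha> \<alpha>1 by (simp add: field_simps)
    then show ?thesis using \<alpha> \<alpha>1 by (simp add: field_simps)
  qed
  ultimately have "(\<lambda>L. stat \<alpha> 0 (Suc L) g / ?Z (Suc L)) \<longlonglongrightarrow> bern \<alpha> (Suc n) g" by (simp only:)
  then show ?case by (rule LIMSEQ_imp_Suc)
qed

section \<open>Comparison and convergence to equilibrium\<close>

definition dominated :: "nat \<Rightarrow> config \<Rightarrow> config \<Rightarrow> bool" where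
  "dominated L x y \<longleftrightarrow> (\<forall>s\<in>{1..L}. x s < 2 \<longrightarrow> y s < 2)"

text \<open>Apart from site \<open>i\<close>, no site loses a particle under letter
  \<open>i\<close>. Below \<open>L\<close> both chains use the same letter; at \<open>L\<close> the
  shorter chain has emptied that site anyway; beyond \<open>L\<close> the site is not
  compared.\<close>

lemma dominated_step:
  assumes "L \<le> R" "1 \<le> L" "dominated L x y" "i \<le> R"
  shows "dominated L (if i \<le> L then chain_letter L i x else x) (chain_letter R i y)"
proof -
  have d: "x s < 2 \<Longrightarrow> y s < 2" if "1 \<le> s" "s \<le> L" for s
    using assms(3) that by (auto simp: dominated_def)
  have "y s < 2 \<Longrightarrow> s \<noteq> i \<Longrightarrow> 1 \<le> s \<Longrightarrow> chain_letter R i y s < 2" for s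
    by (auto simp: chain_letter_def letter_less)
  then have up: "x s < 2 \<Longrightarrow> s \<noteq> i \<Longrightarrow> 1 \<le> s \<Longrightarrow> s \<le> L \<Longrightarrow> chain_letter R i y s < 2" for s
    using d by blast
  consider "i < L" | "i = L" | "L < i" by linarith
  then show ?thesis
  proof cases
    case 1
    then have i: "chain_letter L i x = letter i x" "chain_letter R i y = letter i y"
      using assms by (auto simp: chain_letter_def)
    have "letter i x s < 2 \<Longrightarrow> letter i y s < 2" if "1 \<le> s" "s \<le> L" for s
      using that 1 d[of s] d[of i] d[of "i + 1"] by (auto simp: letter_less split: if_splits)
    then show ?thesis using 1 i by (auto simp: dominated_def)
  next
    case 2
    then show ?thesis using up by (auto simp: dominated_def chain_letter_def split: if_splits)
  next
    case 3
    then show ?thesis using up by (auto simp: dominated_def)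
  qed
qed

lemma particles_mono: "dominated L x y \<Longrightarrow> N \<le> L \<Longrightarrow> particles N x \<le> particles N y"
  unfolding particles_def by (intro card_mono) (auto simp: dominated_def)

lemma dominated_empty: "dominated L empty_config y"
  by (auto simp: dominated_def empty_config_def)

text \<open>Exit rate 1 equals the rate of letter \<open>L\<close> in the longer chain, so both
  chains fit one list of rates, with the identity as the map beyond \<open>L\<close>.\<close>

lemma chain_gen_idle:
  assumes "1 \<le> L" "L < R"
  shows "chain_gen \<alpha> 1 L g = gen (chain_rate \<alpha> 1 R) (\<lambda>i x. if i \<le> L then chain_letter L i x else x) R g"
proof
  fix x
  let ?A = "\<lambda>i x. if i \<le> L then chain_letter L i x else x"
  have "gen (chain_rate \<alpha> 1 R) ?A R g x = (\<Sum>i\<le>L. chain_rate \<alpha> 1 R i * (g (?A i x) - g x))"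
    unfolding gen_def using assms by (intro sum.mono_neutral_right) auto
  also have "\<dots> = chain_gen \<alpha> 1 L g x"
    unfolding gen_def using assms by (intro sum.cong) (auto simp: chain_rate_def)
  finally show "chain_gen \<alpha> 1 L g x = gen (chain_rate \<alpha> 1 R) ?A R g x" ..
qed

text \<open>Letting particles exit at site \<open>L\<close> at full rate only removes particles, because the bond
  beyond \<open>L\<close> lets them pass at most at rate one.\<close>

lemma chain_evol_mono_length:
  assumes \<alpha>: "0 \<le> \<alpha>" and L: "1 \<le> L" "L < R" and t: "0 \<le> t"
    and g: "\<And>\<eta>. \<bar>g \<eta>\<bar> \<le> B" "\<And>x y. dominated L x y \<Longrightarrow> g x \<le> g y"
  shows "chain_evol \<alpha> 1 L t g empty_config \<le> chain_evol \<alpha> 1 R t g empty_config"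
proof -
  let ?A = "\<lambda>i x. if i \<le> L then chain_letter L i x else x"
  have nn: "\<And>i. 0 \<le> chain_rate \<alpha> 1 R i" using \<alpha> by (simp add: chain_rate_nonneg)
  have "chain_gen \<alpha> 1 L = gen (chain_rate \<alpha> 1 R) ?A R"
    by (rule ext) (rule chain_gen_idle[OF L])
  then have "chain_evol \<alpha> 1 L t g empty_config = evol (chain_rate \<alpha> 1 R) ?A R t g empty_config"
    by (simp add: evol_def)
  also have "\<dots> \<le> chain_evol \<alpha> 1 R t g empty_config"
    by (rule evol_mono[OF nn g(1) g(1) t, where Q = "dominated L"])
       (use L dominated_step[of L R] g(2) dominated_empty in auto)
  finally show ?thesis .
qed

section \<open>Ergodicity of one finite chain\<close>

lemma jump_pow_ge_word:
  assumes r: "\<And>i. i \<le> R \<Longrightarrow> 0 \<le> r i" and h: "\<And>x. 0 \<le> h x" and w: "set w \<subseteq> {..R}"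
  shows "(\<Prod>i\<leftarrow>w. r i) * h (fold A w x) \<le> (jump r A R ^^ length w) h x"
  using w
proof (induction w arbitrary: x)
  case (Cons i w)
  let ?K = "(jump r A R ^^ length w) h"
  have K: "0 \<le> ?K y" for y
  proof -
    have "0 \<le> (jump r A R ^^ k) h y" for k
      by (induction k arbitrary: y) (auto simp: jump_def h intro!: sum_nonneg mult_nonneg_nonneg r)
    then show ?thesis .
  qed
  have i: "i \<in> {..R}" using Cons.prems by auto
  have "r i * ((\<Prod>i\<leftarrow>w. r i) * h (fold A w (A i x))) \<le> r i * ?K (A i x)"
    using Cons.IH[of "A i x"] Cons.prems r[of i] by (intro mult_left_mono) auto
  \<comment> \<open>Of all words only \<open>w\<close> is kept; the other terms are
    nonnegative.\<close>
  also have "\<dots> \<le> (\<Sum>j\<le>R. r j * ?K (A j x))"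
    by (rule member_le_sum[OF i]) (use K r in auto)
  finally show ?case by (simp add: jump_def[of r A R ?K x] mult.assoc)
qed simp

lemma fold_letter_other:
  assumes "\<And>i. i \<in> set w \<Longrightarrow> m < i"
  shows "fold (chain_letter L) w x m = x m"
  using assms
proof (induction w arbitrary: x)
  case (Cons i w)
  have "m < i" using Cons.prems by simp
  then have "chain_letter L i x m = x m" by (auto simp: chain_letter_def letter_other)
  then show ?case using Cons by simp
qed simp

text \<open>With only holes to the right, a particle at \<open>m\<close> travels over the bonds
  \<open>m, ..., L - 1\<close> and leaves by the exit \<open>L\<close>.\<close>

lemma fold_letter_flush_site:
  assumes "1 \<le> m" "m \<le> L" "\<And>y. m < y \<Longrightarrow> y \<le> L \<Longrightarrow> x y = \<infinity>" "m \<le> y" "y \<le> L"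
  shows "fold (chain_letter L) [m..<Suc L] x y = \<infinity>"
  using assms
proof (induction "L - m" arbitrary: m x y)
  case 0
  then have "m = L" "y = L" by auto
  then show ?case by (simp add: chain_letter_def)
next
  case (Suc d)
  then have mL: "m < L" by simp
  let ?x = "chain_letter L m x"
  have e: "[m..<Suc L] = m # [Suc m..<Suc L]" using mL by (simp add: upt_conv_Cons)
  have l: "?x = letter m x" using mL by (simp add: chain_letter_def)
  have "x (m + 1) = \<infinity>" using Suc.prems mL by simp
  then have "?x m = \<infinity>"
    using Suc.prems(1) unfolding l by (auto simp: letter_def exchange_def)
  moreover have "?x y = \<infinity>" if "Suc m < y" "y \<le> L" for y
    unfolding l using that Suc.prems(3)[of y] by (simp add: letter_other)
  ultimately show ?case
  proof (cases "y = m")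
    case True
    have "fold (chain_letter L) [Suc m..<Suc L] ?x m = ?x m" by (rule fold_letter_other) auto
    then show ?thesis using \<open>?x m = \<infinity>\<close> True unfolding e by simp
  next
    case False
    have "fold (chain_letter L) [Suc m..<Suc L] ?x y = \<infinity>"
      by (rule Suc.hyps(1)) (use Suc.hyps(2) Suc.prems mL False \<open>\<And>y. Suc m < y \<Longrightarrow> y \<le> L \<Longrightarrow> ?x y = \<infinity>\<close> in auto)
    then show ?thesis unfolding e by simp
  qed
qed

text \<open>Sites are flushed from right to left, so that each one finds an empty way to the
  exit.\<close>

lemma flush_word:
  assumes "m \<le> L"
  shows "\<exists>w. set w \<subseteq> {..L} \<and> (\<forall>x y. L - m < y \<and> y \<le> L \<longrightarrow> fold (chain_letter L) w x y = \<infinity>)"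
  using assms
proof (induction m)
  case 0
  show ?case by (rule exI[of _ "[]"]) auto
next
  case (Suc m)
  then obtain w where w: "set w \<subseteq> {..L}"
    "\<And>x y. L - m < y \<Longrightarrow> y \<le> L \<Longrightarrow> fold (chain_letter L) w x y = \<infinity>" by auto
  show ?case
  proof (intro exI[of _ "w @ [L - m..<Suc L]"] conjI allI impI)
    show "set (w @ [L - m..<Suc L]) \<subseteq> {..L}" using w by auto
    fix x y assume "L - Suc m < y \<and> y \<le> L"
    then show "fold (chain_letter L) (w @ [L - m..<Suc L]) x y = \<infinity>"
      unfolding fold_append o_apply using Suc.prems
      by (intro fold_letter_flush_site w) auto
  qed
qed

lemma jump_const: "(jump r A R ^^ k) (\<lambda>_. a) x = (\<Sum>i\<le>R. r i) ^ k * a"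
proof (induction k arbitrary: x)
  case (Suc k)
  then have "(jump r A R ^^ k) (\<lambda>_. a) = (\<lambda>_. (\<Sum>i\<le>R. r i) ^ k * a)" by blast
  then show ?case
    by (simp add: jump_def[of r A R "\<lambda>_. (\<Sum>i\<le>R. r i) ^ k * a" x] sum_distrib_right[symmetric] mult.assoc)
qed simp

lemma jump_diff: "jump r A R (\<lambda>x. g x - h x) x = jump r A R g x - jump r A R h x"
  by (simp add: jump_def sum_subtractf right_diff_distrib)

lemma jump_pow_diff: "(jump r A R ^^ k) (\<lambda>x. g x - h x) x = (jump r A R ^^ k) g x - (jump r A R ^^ k) h x"
proof (induction k arbitrary: x)
  case (Suc k)
  then have "(jump r A R ^^ k) (\<lambda>x. g x - h x) = (\<lambda>x. (jump r A R ^^ k) g x - (jump r A R ^^ k) h x)"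
    by blast
  then show ?case by (simp add: jump_diff)
qed simp

lemma jump_pow_between:
  assumes r: "\<And>i. i \<le> R \<Longrightarrow> 0 \<le> r i" and h: "\<And>x. a \<le> h x" "\<And>x. h x \<le> b"
  shows "(\<Sum>i\<le>R. r i) ^ k * a \<le> (jump r A R ^^ k) h x" "(jump r A R ^^ k) h x \<le> (\<Sum>i\<le>R. r i) ^ k * b"
  using jump_pow_mono[OF r, where Q = "(=)" and A = A and A' = A and g = "\<lambda>_. a" and h = h]
    jump_pow_mono[OF r, where Q = "(=)" and A = A and A' = A and g = h and h = "\<lambda>_. b"] h
  by (auto simp: jump_const)

context
  fixes \<alpha> \<beta> :: real and L :: nat
  assumes \<alpha>: "0 < \<alpha>" and \<beta>: "0 < \<beta>" and L: "1 \<le> L"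
begin

lemma chain_rate_pos: "0 < chain_rate \<alpha> \<beta> L i"
  using \<alpha> \<beta> by (simp add: chain_rate_def)

abbreviation "total_rate \<equiv> \<Sum>i\<le>L. chain_rate \<alpha> \<beta> L i"
abbreviation "chain_jump \<equiv> jump (chain_rate \<alpha> \<beta> L) (chain_letter L) L"

lemma total_rate_pos: "0 < total_rate"
  by (intro sum_pos) (auto simp: chain_rate_pos)

lemma depends_on_jump_pow:
  assumes "depends_on L g"
  shows "depends_on L ((chain_jump ^^ k) g)"
proof (induction k)
  case (Suc k)
  show ?case unfolding depends_on_def
  proof (intro allI impI)
    fix \<eta> \<zeta> :: config assume eq: "\<forall>x\<in>{1..L}. \<eta> x = \<zeta> x"
    have "(chain_jump ^^ k) g (chain_letter L i \<eta>) = (chain_jump ^^ k) g (chain_letter L i \<zeta>)"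
      if "i \<le> L" for i
      using that eq by (intro depends_onD[OF Suc.IH])
        (auto simp: chain_letter_def intro!: letter_cong[of L])
    then show "(chain_jump ^^ Suc k) g \<eta> = (chain_jump ^^ Suc k) g \<zeta>"
      by (simp add: jump_def)
  qed
qed (use assms in simp)

text \<open>One fixed word empties the chain from every state, so all starting points give the empty
  state a common weight. Applying the word to the nonnegative functions \<open>h - a\<close> and
  \<open>b - h\<close> moves both bounds towards the value there.\<close>

lemma doeblin:
  "\<exists>\<epsilon> m. 0 < \<epsilon> \<and> \<epsilon> \<le> 1 \<and> (\<forall>h a b x. depends_on L h \<longrightarrow> (\<forall>x. a \<le> h x) \<longrightarrow> (\<forall>x. h x \<le> b) \<longrightarrow>
      total_rate ^ m * (a + \<epsilon> * (h (\<lambda>_. \<infinity>) - a)) \<le> (chain_jump ^^ m) h x \<and>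
      (chain_jump ^^ m) h x \<le> total_rate ^ m * (b - \<epsilon> * (b - h (\<lambda>_. \<infinity>))))"
proof -
  obtain w where w: "set w \<subseteq> {..L}"
    "\<And>x y. L - L < y \<Longrightarrow> y \<le> L \<Longrightarrow> fold (chain_letter L) w x y = \<infinity>"
    using flush_word[of L L] by auto
  let ?m = "length w"
  define e where "e = (\<Prod>i\<leftarrow>w. chain_rate \<alpha> \<beta> L i)"
  have e: "0 < e" unfolding e_def
    using chain_rate_pos by (induction w) auto
  have T: "0 < total_rate ^ ?m" using total_rate_pos by simp
  have r: "\<And>i. 0 \<le> chain_rate \<alpha> \<beta> L i" using chain_rate_pos by (simp add: less_imp_le)
  have pos: "e * h (\<lambda>_. \<infinity>) \<le> (chain_jump ^^ ?m) h x"
    if "depends_on L h" "\<And>x. 0 \<le> h x" for h x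
  proof -
    have "h (fold (chain_letter L) w x) = h (\<lambda>_. \<infinity>)"
      by (rule depends_onD[OF that(1)]) (use w(2) in auto)
    then show ?thesis
      using jump_pow_ge_word[of L "chain_rate \<alpha> \<beta> L" h w "chain_letter L" x] r that(2) w(1)
      by (simp add: e_def)
  qed
  \<comment> \<open>Tested on the constant 1: a single word weighs no more than all words of its
    length.\<close>
  have "e \<le> total_rate ^ ?m"
    using pos[of "\<lambda>_. 1" "\<lambda>_. \<infinity>"] by (simp add: jump_const depends_on_def)
  show ?thesis
  proof (intro exI[of _ "e / total_rate ^ ?m"] exI[of _ ?m] conjI allI impI)
    show "0 < e / total_rate ^ ?m" "e / total_rate ^ ?m \<le> 1" using e T \<open>e \<le> total_rate ^ ?m\<close> by auto
    fix h a b x assume "depends_on L h" "\<forall>x. a \<le> h x" "\<forall>x. h x \<le> b"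
    then have h: "depends_on L h" "\<And>x. a \<le> h x" "\<And>x. h x \<le> b" by auto
    have "depends_on L (\<lambda>x. h x - a)" "depends_on L (\<lambda>x. b - h x)"
      using h(1) by (auto simp: depends_on_def)
    then have "e * (h (\<lambda>_. \<infinity>) - a) \<le> (chain_jump ^^ ?m) (\<lambda>x. h x - a) x"
      "e * (b - h (\<lambda>_. \<infinity>)) \<le> (chain_jump ^^ ?m) (\<lambda>x. b - h x) x"
      using h(2,3) pos[of "\<lambda>x. h x - a" x] pos[of "\<lambda>x. b - h x" x] by auto
    then have "e * (h (\<lambda>_. \<infinity>) - a) + total_rate ^ ?m * a \<le> (chain_jump ^^ ?m) h x"
      "(chain_jump ^^ ?m) h x \<le> total_rate ^ ?m * b - e * (b - h (\<lambda>_. \<infinity>))"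
      unfolding jump_pow_diff jump_const by linarith+
    moreover have "total_rate ^ ?m * (a + e / total_rate ^ ?m * (h (\<lambda>_. \<infinity>) - a))
        = e * (h (\<lambda>_. \<infinity>) - a) + total_rate ^ ?m * a"
      "total_rate ^ ?m * (b - e / total_rate ^ ?m * (b - h (\<lambda>_. \<infinity>)))
        = total_rate ^ ?m * b - e * (b - h (\<lambda>_. \<infinity>))"
      using T less_imp_neq[OF total_rate_pos, symmetric]
      by (simp_all add: distrib_left right_diff_distrib)
    ultimately show "total_rate ^ ?m * (a + e / total_rate ^ ?m * (h (\<lambda>_. \<infinity>) - a)) \<le> (chain_jump ^^ ?m) h x"
      "(chain_jump ^^ ?m) h x \<le> total_rate ^ ?m * (b - e / total_rate ^ ?m * (b - h (\<lambda>_. \<infinity>)))"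
      by (simp_all only:)
  qed
qed

text \<open>Each block of \<open>m\<close> steps multiplies the width of the enclosing interval by
  \<open>1 - \<epsilon>\<close>, starting from \<open>2 * B\<close>, and further steps cannot leave
  it. All bounds are relative to powers of the total rate.\<close>

lemma jump_pow_contracts:
  assumes g: "depends_on L g" "\<And>\<eta>. \<bar>g \<eta>\<bar> \<le> B" and \<delta>: "0 < \<delta>"
  obtains k0 a b where "b - a < \<delta>"
    "\<And>k x. k0 \<le> k \<Longrightarrow> total_rate ^ k * a \<le> (chain_jump ^^ k) g x"
    "\<And>k x. k0 \<le> k \<Longrightarrow> (chain_jump ^^ k) g x \<le> total_rate ^ k * b"
proof -
  have r: "\<And>i. 0 \<le> chain_rate \<alpha> \<beta> L i" using chain_rate_pos by (simp add: less_imp_le)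
  obtain \<epsilon> m where \<epsilon>: "0 < \<epsilon>" "\<epsilon> \<le> 1" and
    "\<forall>h a b x. depends_on L h \<longrightarrow> (\<forall>x. a \<le> h x) \<longrightarrow> (\<forall>x. h x \<le> b) \<longrightarrow>
      total_rate ^ m * (a + \<epsilon> * (h (\<lambda>_. \<infinity>) - a)) \<le> (chain_jump ^^ m) h x \<and>
      (chain_jump ^^ m) h x \<le> total_rate ^ m * (b - \<epsilon> * (b - h (\<lambda>_. \<infinity>)))"
    using doeblin by (elim exE conjE)
  note D = this(3)[rule_format]
  have "\<exists>a b. b - a = (1 - \<epsilon>) ^ j * (2 * B) \<and>
      (\<forall>x. total_rate ^ (m * j) * a \<le> (chain_jump ^^ (m * j)) g x \<and>
           (chain_jump ^^ (m * j)) g x \<le> total_rate ^ (m * j) * b)" for j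
  proof (induction j)
    case 0
    show ?case
      by (rule exI[of _ "- B"], rule exI[of _ B]) (use g(2) in \<open>auto simp: abs_le_iff minus_le_iff\<close>)
  next
    case (Suc j)
    then obtain a b where ab: "b - a = (1 - \<epsilon>) ^ j * (2 * B)"
      "\<And>x. total_rate ^ (m * j) * a \<le> (chain_jump ^^ (m * j)) g x"
      "\<And>x. (chain_jump ^^ (m * j)) g x \<le> total_rate ^ (m * j) * b" by blast
    let ?T = "total_rate ^ (m * j)" and ?h = "(chain_jump ^^ (m * j)) g"
    have T: "0 < ?T" using total_rate_pos by simp
    define q where "q = ?h (\<lambda>_. \<infinity>) / ?T"
    have q: "?h (\<lambda>_. \<infinity>) = ?T * q" using less_imp_neq[OF total_rate_pos, symmetric] by (simp add: q_def)
    have pow: "(chain_jump ^^ (m * Suc j)) g = (chain_jump ^^ m) ?h" "total_rate ^ (m * Suc j) = total_rate ^ m * ?T"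
      by (simp_all add: funpow_add power_add)
    show ?case
    proof (rule exI[of _ "a + \<epsilon> * (q - a)"], rule exI[of _ "b - \<epsilon> * (b - q)"], intro conjI allI)
      have "b - \<epsilon> * (b - q) - (a + \<epsilon> * (q - a)) = (1 - \<epsilon>) * (b - a)" by (simp add: algebra_simps)
      then show "b - \<epsilon> * (b - q) - (a + \<epsilon> * (q - a)) = (1 - \<epsilon>) ^ Suc j * (2 * B)"
        using ab(1) by simp
      fix x
      note D' = D[OF depends_on_jump_pow[OF g(1)] ab(2,3), of x, unfolded q]
      show "total_rate ^ (m * Suc j) * (a + \<epsilon> * (q - a)) \<le> (chain_jump ^^ (m * Suc j)) g x"
        unfolding pow using D' by (simp add: algebra_simps)
      show "(chain_jump ^^ (m * Suc j)) g x \<le> total_rate ^ (m * Suc j) * (b - \<epsilon> * (b - q))"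
        unfolding pow using D' by (simp add: algebra_simps)
    qed
  qed
  then have ex: "\<exists>a b. b - a = (1 - \<epsilon>) ^ j * (2 * B) \<and>
      (\<forall>x. total_rate ^ (m * j) * a \<le> (chain_jump ^^ (m * j)) g x) \<and>
      (\<forall>x. (chain_jump ^^ (m * j)) g x \<le> total_rate ^ (m * j) * b)" for j by blast
  have "(\<lambda>j. (1 - \<epsilon>) ^ j * (2 * B)) \<longlonglongrightarrow> 0 * (2 * B)"
    using \<epsilon> by (intro tendsto_mult_right LIMSEQ_power_zero) auto
  then have "\<forall>\<^sub>F j in sequentially. (1 - \<epsilon>) ^ j * (2 * B) < \<delta>"
    using \<delta> by (intro order_tendstoD(2)[where y = 0]) auto
  then obtain j where j: "(1 - \<epsilon>) ^ j * (2 * B) < \<delta>" by (auto simp: eventually_sequentially)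
  obtain a b where ab: "b - a = (1 - \<epsilon>) ^ j * (2 * B)"
    "\<And>x. total_rate ^ (m * j) * a \<le> (chain_jump ^^ (m * j)) g x"
    "\<And>x. (chain_jump ^^ (m * j)) g x \<le> total_rate ^ (m * j) * b" using ex[of j] by blast
  show ?thesis
  proof (rule that[of b a "m * j"])
    show "b - a < \<delta>" using ab j by simp
    fix k x assume "m * j \<le> k"
    then obtain i where i: "k = i + m * j" by (metis le_add_diff_inverse2)
    have pow: "(chain_jump ^^ k) g = (chain_jump ^^ i) ((chain_jump ^^ (m * j)) g)"
      "total_rate ^ k * c = total_rate ^ i * (total_rate ^ (m * j) * c)" for c
      by (simp_all add: i funpow_add power_add)
    show "total_rate ^ k * a \<le> (chain_jump ^^ k) g x" "(chain_jump ^^ k) g x \<le> total_rate ^ k * b"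
      unfolding pow by (rule jump_pow_between[OF r ab(2,3)])+
  qed
qed

lemma stat_jump_pow:
  assumes "\<alpha> < 1" "c = 1 / \<beta> - 1"
  shows "stat \<alpha> c L ((chain_jump ^^ k) g) = total_rate ^ k * stat \<alpha> c L g"
proof (induction k)
  case (Suc k)
  let ?h = "(chain_jump ^^ k) g"
  have "(chain_jump ^^ Suc k) g = (\<lambda>x. 1 * chain_gen \<alpha> \<beta> L ?h x + total_rate * ?h x)"
    by (intro ext) (simp add: jump_eq_gen)
  moreover have "stat \<alpha> c L (chain_gen \<alpha> \<beta> L ?h) = 0"
    unfolding stat_def using stationary[OF \<alpha> assms(1) _ assms(2) L] \<beta> by simp
  ultimately show ?case using Suc.IH by (simp only: stat_linear) simp
qed simp

text \<open>\<open>evol\<close> averages the normalized powers of \<open>jump\<close> over a Poisson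
  number of steps. From \<open>k0\<close> steps on they are within \<open>e / 2\<close> of the
  stationary value, and fewer steps become unlikely.\<close>

lemma chain_evol_tendsto_stat:
  assumes \<alpha>1: "\<alpha> < 1" and c: "c = 1 / \<beta> - 1" "0 \<le> c" and Z: "0 < stat \<alpha> c L (\<lambda>_. 1)"
    and g: "depends_on L g" "\<And>\<eta>. \<bar>g \<eta>\<bar> \<le> B"
  shows "((\<lambda>t. chain_evol \<alpha> \<beta> L t g x) \<longlongrightarrow> stat \<alpha> c L g / stat \<alpha> c L (\<lambda>_. 1)) at_top"
proof (rule tendstoI)
  fix e :: real assume e: "0 < e"
  have r: "\<And>i. 0 \<le> chain_rate \<alpha> \<beta> L i" using chain_rate_pos by (simp add: less_imp_le)
  let ?\<mu> = "stat \<alpha> c L g / stat \<alpha> c L (\<lambda>_. 1)"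
  have bound: "b1 \<le> ?\<mu>" if "\<And>x. total_rate ^ k * b1 \<le> (chain_jump ^^ k) g x" for b1 k
  proof -
    have "stat \<alpha> c L (\<lambda>_. total_rate ^ k * b1) \<le> total_rate ^ k * stat \<alpha> c L g"
      unfolding stat_jump_pow[OF \<alpha>1 c(1), symmetric] by (rule stat_mono[OF \<alpha> \<alpha>1 c(2) that])
    then have "total_rate ^ k * (b1 * stat \<alpha> c L (\<lambda>_. 1)) \<le> total_rate ^ k * stat \<alpha> c L g"
      unfolding stat_const[of _ _ _ "total_rate ^ k * b1"] by (simp add: mult.assoc)
    then have "b1 * stat \<alpha> c L (\<lambda>_. 1) \<le> stat \<alpha> c L g" using total_rate_pos by simp
    then show ?thesis using Z by (simp add: le_divide_eq)
  qed
  have bound': "?\<mu> \<le> b1" if "\<And>x. (chain_jump ^^ k) g x \<le> total_rate ^ k * b1" for b1 k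
  proof -
    have "total_rate ^ k * stat \<alpha> c L g \<le> stat \<alpha> c L (\<lambda>_. total_rate ^ k * b1)"
      unfolding stat_jump_pow[OF \<alpha>1 c(1), symmetric] by (rule stat_mono[OF \<alpha> \<alpha>1 c(2) that])
    then have "total_rate ^ k * stat \<alpha> c L g \<le> total_rate ^ k * (b1 * stat \<alpha> c L (\<lambda>_. 1))"
      unfolding stat_const[of _ _ _ "total_rate ^ k * b1"] by (simp add: mult.assoc)
    then have "stat \<alpha> c L g \<le> b1 * stat \<alpha> c L (\<lambda>_. 1)" using total_rate_pos by simp
    then show ?thesis using Z by (simp add: divide_le_eq)
  qed
  have "0 < e / 2" using e by simp
  then obtain k0 a b where ab: "b - a < e / 2"
    "\<And>k x. k0 \<le> k \<Longrightarrow> total_rate ^ k * a \<le> (chain_jump ^^ k) g x"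
    "\<And>k x. k0 \<le> k \<Longrightarrow> (chain_jump ^^ k) g x \<le> total_rate ^ k * b"
    by (rule jump_pow_contracts[OF g]) (rule that)
  \<comment> \<open>By stationarity, an interval that encloses all starting points also encloses the
    stationary value.\<close>
  have \<mu>: "a \<le> ?\<mu>" "?\<mu> \<le> b" using bound[OF ab(2)[of k0]] bound'[OF ab(3)[of k0]] by simp_all
  have gB: "g \<eta> \<le> B" "- B \<le> g \<eta>" for \<eta> using g(2)[of \<eta>] by linarith+
  have B: "total_rate ^ k * (- B) \<le> (chain_jump ^^ k) g x" "(chain_jump ^^ k) g x \<le> total_rate ^ k * B" for k x
    by (rule jump_pow_between[OF r gB(2) gB(1)])+
  have \<mu>B: "- B \<le> ?\<mu>" "?\<mu> \<le> B"
    using bound[of 0 "- B"] bound'[of 0 B] gB by simp_all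
  define d where "d k = (chain_jump ^^ k) g x - total_rate ^ k * ?\<mu>" for k
  have d: "\<bar>d k\<bar> \<le> total_rate ^ k * (e / 2 + (if k < k0 then 2 * B else 0))" for k
  proof (cases "k < k0")
    case True
    have "\<bar>d k\<bar> \<le> total_rate ^ k * (2 * B)"
    proof -
      have "total_rate ^ k * ?\<mu> \<le> total_rate ^ k * B" "total_rate ^ k * (- B) \<le> total_rate ^ k * ?\<mu>"
        using \<mu>B total_rate_pos by (intro mult_left_mono; simp)+
      then show ?thesis using B[where k = k and x = x] unfolding d_def by (simp only: abs_le_iff) linarith
    qed
    also have "\<dots> \<le> total_rate ^ k * (e / 2 + 2 * B)" using e total_rate_pos by (intro mult_left_mono) auto
    finally show ?thesis using True by simp
  next
    case False
    then have k: "k0 \<le> k" by simp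
    have "total_rate ^ k * ?\<mu> \<le> total_rate ^ k * b" "total_rate ^ k * a \<le> total_rate ^ k * ?\<mu>"
      using \<mu> total_rate_pos by (intro mult_left_mono; simp)+
    then have "\<bar>d k\<bar> \<le> total_rate ^ k * b - total_rate ^ k * a"
      using ab(2,3)[OF k, of x] unfolding d_def by linarith
    also have "\<dots> = total_rate ^ k * (b - a)" by (simp add: right_diff_distrib)
    also have "\<dots> \<le> total_rate ^ k * (e / 2)" using ab(1) total_rate_pos by (intro mult_left_mono) auto
    finally show ?thesis using False by simp
  qed
  \<comment> \<open>\<open>2 * B\<close> times the probability that a Poisson variable of mean
    \<open>total_rate * t\<close> is below \<open>k0\<close>.\<close>
  define E where "E t = 2 * B * (\<Sum>k<k0. (total_rate * t) ^ k / exp (total_rate * t) / fact k)" for t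
  have main: "\<bar>chain_evol \<alpha> \<beta> L t g x - ?\<mu>\<bar> \<le> e / 2 + E t" if t: "0 \<le> t" for t
  proof -
    have s1: "(\<lambda>k. d k / fact k * t ^ k)
        sums (exp (total_rate * t) * chain_evol \<alpha> \<beta> L t g x - exp (total_rate * t) * ?\<mu>)"
    proof -
      have "(\<lambda>k. (total_rate * t) ^ k /\<^sub>R fact k * ?\<mu>) sums (exp (total_rate * t) * ?\<mu>)"
        by (intro sums_mult2 exp_converges)
      from sums_diff[OF evol_sums_jump[OF r g(2)] this]
      show ?thesis by (simp add: d_def power_mult_distrib field_simps)
    qed
    have s2: "(\<lambda>k. (total_rate * t) ^ k /\<^sub>R fact k * (e / 2)
          + (if k < k0 then 2 * B * ((total_rate * t) ^ k / fact k) else 0))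
        sums (exp (total_rate * t) * (e / 2) + (\<Sum>k<k0. 2 * B * ((total_rate * t) ^ k / fact k)))"
      using sums_If_finite_set[of "{..<k0}" "\<lambda>k. 2 * B * ((total_rate * t) ^ k / fact k)"]
      by (intro sums_add sums_mult2 exp_converges) simp
    have le: "\<bar>d k / fact k * t ^ k\<bar> \<le> (total_rate * t) ^ k /\<^sub>R fact k * (e / 2)
          + (if k < k0 then 2 * B * ((total_rate * t) ^ k / fact k) else 0)" for k
    proof -
      have "\<bar>d k / fact k * t ^ k\<bar> = \<bar>d k\<bar> * (t ^ k / fact k)" using t by (simp add: abs_mult)
      also have "\<dots> \<le> total_rate ^ k * (e / 2 + (if k < k0 then 2 * B else 0)) * (t ^ k / fact k)"
        using d t by (intro mult_right_mono) auto
      also have "\<dots> = (total_rate * t) ^ k /\<^sub>R fact k * (e / 2)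
          + (if k < k0 then 2 * B * ((total_rate * t) ^ k / fact k) else 0)"
        by (simp add: power_mult_distrib field_simps)
      finally show ?thesis .
    qed
    have sum_eq: "(\<Sum>k<k0. 2 * B * ((total_rate * t) ^ k / fact k)) = exp (total_rate * t) * E t"
      unfolding E_def sum_distrib_left by (intro sum.cong) auto
    have rhs: "exp (total_rate * t) * (e / 2) + exp (total_rate * t) * E t = exp (total_rate * t) * (e / 2 + E t)"
      by (simp only: distrib_left)
    let ?X = "chain_evol \<alpha> \<beta> L t g x"
    have "exp (total_rate * t) * (?X - ?\<mu>) \<le> exp (total_rate * t) * (e / 2 + E t)"
      using sums_le[OF abs_le_D1[OF le] s1 s2] unfolding sum_eq rhs right_diff_distrib .
    then have "?X - ?\<mu> \<le> e / 2 + E t" by (simp only: mult_le_cancel_left_pos[OF exp_gt_zero])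
    moreover have "exp (total_rate * t) * (?\<mu> - ?X) \<le> exp (total_rate * t) * (e / 2 + E t)"
      using sums_le[OF abs_le_D2[OF le] sums_minus[OF s1] s2]
      unfolding sum_eq rhs right_diff_distrib minus_diff_eq .
    then have "?\<mu> - ?X \<le> e / 2 + E t" by (simp only: mult_le_cancel_left_pos[OF exp_gt_zero])
    ultimately show ?thesis by (simp only: abs_le_iff minus_diff_eq)
  qed
  have "filterlim (\<lambda>t. total_rate * t) at_top at_top"
    using total_rate_pos by (intro filterlim_tendsto_pos_mult_at_top[OF tendsto_const] filterlim_ident)
  then have "(E \<longlongrightarrow> 2 * B * (\<Sum>k<k0. 0 / fact k)) at_top"
    unfolding E_def[abs_def]
    by (intro tendsto_mult_left tendsto_sum tendsto_divide tendsto_const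
        filterlim_compose[OF tendsto_power_div_exp_0]) auto
  then have "\<forall>\<^sub>F t in at_top. E t < e / 2" using e by (intro order_tendstoD(2)[where y = 0]) auto
  then show "\<forall>\<^sub>F t in at_top. dist (chain_evol \<alpha> \<beta> L t g x) ?\<mu> < e"
    using eventually_ge_at_top[of 0]
  proof eventually_elim
    case (elim t)
    then show ?case using main[of t] by (simp add: dist_real_def)
  qed
qed

end

section \<open>Limits\<close>

lemma dominated_mono: "dominated L x y \<Longrightarrow> n \<le> L \<Longrightarrow> dominated n x y"
  by (auto simp: dominated_def)

text \<open>The empty state is the least one, so the expectation from it is at most the stationary
  average, which is constant in time and equals \<open>bern\<close> for exit rate
  \<open>1 - \<alpha>\<close>.\<close>

lemma empty_upper_bound:
  assumes S: "tasep_semigroup \<alpha> S" and \<alpha>: "0 < \<alpha>" "\<alpha> < 1" and t: "0 \<le> t"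
    and g: "depends_on n g" "\<And>\<eta>. \<bar>g \<eta>\<bar> \<le> B" "\<And>x y. dominated n x y \<Longrightarrow> g x \<le> g y"
  shows "(\<integral>\<xi>. g \<xi> \<partial>S t empty_config) \<le> bern \<alpha> n g"
proof (rule LIMSEQ_le_const2)
  show "(\<lambda>R. chain_evol \<alpha> (1 - \<alpha>) R t g empty_config) \<longlonglongrightarrow> (\<integral>\<xi>. g \<xi> \<partial>S t empty_config)"
    by (rule chain_evol_tendsto[OF S _ _ _ empty_config_in_space g(1,2) t]) (use \<alpha> in auto)
  show "\<exists>k. \<forall>R\<ge>k. chain_evol \<alpha> (1 - \<alpha>) R t g empty_config \<le> bern \<alpha> n g"
  proof (intro exI[of _ "max 1 n"] allI impI)
    fix R assume R: "max 1 n \<le> R"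
    let ?c = "\<alpha> / (1 - \<alpha>)" and ?a = "chain_evol \<alpha> (1 - \<alpha>) R t g empty_config"
    have nn: "\<And>i. 0 \<le> chain_rate \<alpha> (1 - \<alpha>) R i" using \<alpha> by (simp add: chain_rate_nonneg)
    have le: "?a \<le> chain_evol \<alpha> (1 - \<alpha>) R t g \<eta>" for \<eta>
    proof (rule evol_mono[OF nn g(2) g(2) t, where Q = "dominated R"])
      show "dominated R (chain_letter R i x) (chain_letter R i y)" if "i \<le> R" "dominated R x y" for i x y
        using dominated_step[of R R x y i] R that by simp
      show "g x \<le> g y" if "dominated R x y" for x y
        using g(3) dominated_mono[OF that] R by simp
    qed (rule dominated_empty)
    have "?a * stat \<alpha> ?c R (\<lambda>_. 1) = stat \<alpha> ?c R (\<lambda>_. ?a)" by (rule stat_const[symmetric])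
    also have "\<dots> \<le> stat \<alpha> ?c R (chain_evol \<alpha> (1 - \<alpha>) R t g)"
      using \<alpha> by (intro stat_mono le) auto
    also have "\<dots> = stat \<alpha> ?c R g"
      using \<alpha> R by (intro stat_evol[OF \<alpha> _ _ _ g(2)]) (auto simp: field_simps)
    finally have "?a * stat \<alpha> ?c R (\<lambda>_. 1) \<le> stat \<alpha> ?c R g" .
    then have "(1 / (\<alpha> * (1 - \<alpha>))) ^ R * ?a \<le> (1 / (\<alpha> * (1 - \<alpha>))) ^ R * bern \<alpha> n g"
      using bern_depends_on[OF g(1), of R \<alpha>] R
      unfolding stat_bernoulli[OF \<alpha>] by (simp add: mult.commute)
    moreover have "0 < (1 / (\<alpha> * (1 - \<alpha>))) ^ R" using \<alpha> by simp
    ultimately show "?a \<le> bern \<alpha> n g" by (simp only: mult_le_cancel_left_pos)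
  qed
qed

text \<open>By \<open>chain_evol_mono_length\<close> the values from the empty state increase with
  the chain length, and the semigroup is their limit.\<close>

lemma empty_lower_bound:
  assumes S: "tasep_semigroup \<alpha> S" and \<alpha>: "0 \<le> \<alpha>" "\<alpha> \<le> 1" and t: "0 \<le> t"
    and L: "1 \<le> L" "n \<le> L"
    and g: "depends_on n g" "\<And>\<eta>. \<bar>g \<eta>\<bar> \<le> B" "\<And>x y. dominated n x y \<Longrightarrow> g x \<le> g y"
  shows "chain_evol \<alpha> 1 L t g empty_config \<le> (\<integral>\<xi>. g \<xi> \<partial>S t empty_config)"
proof (rule LIMSEQ_le_const)
  show "(\<lambda>R. chain_evol \<alpha> 1 R t g empty_config) \<longlonglongrightarrow> (\<integral>\<xi>. g \<xi> \<partial>S t empty_config)"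
    by (rule chain_evol_tendsto[OF S \<alpha> _ empty_config_in_space g(1,2) t]) simp
  show "\<exists>k. \<forall>R\<ge>k. chain_evol \<alpha> 1 L t g empty_config \<le> chain_evol \<alpha> 1 R t g empty_config"
  proof (intro exI[of _ "Suc L"] allI impI)
    fix R assume "Suc L \<le> R"
    then show "chain_evol \<alpha> 1 L t g empty_config \<le> chain_evol \<alpha> 1 R t g empty_config"
      using g(3) dominated_mono L
      by (intro chain_evol_mono_length[OF \<alpha>(1) L(1) _ t g(2)]) (auto intro: dominated_mono)
  qed
qed

text \<open>From below, a length \<open>L\<close> is fixed first so that the stationary value is
  close to \<open>bern\<close>, and only then does time tend to infinity; the bound from above holds
  at each time.\<close>

lemma empty_limit:
  assumes S: "tasep_semigroup \<alpha> S" and \<alpha>: "0 < \<alpha>" "\<alpha> \<le> 1/2"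
    and g: "depends_on n g" "\<And>\<eta>. 0 \<le> g \<eta>" "\<And>\<eta>. g \<eta> \<le> 1"
      "\<And>x y. dominated n x y \<Longrightarrow> g x \<le> g y"
  shows "((\<lambda>t. \<integral>\<xi>. g \<xi> \<partial>S t empty_config) \<longlongrightarrow> bern \<alpha> n g) at_top"
proof (rule order_tendstoI)
  have \<alpha>1: "\<alpha> < 1" using \<alpha> by simp
  have gB: "\<bar>g \<eta>\<bar> \<le> 1" for \<eta> using g(2,3)[of \<eta>] by simp
  fix a
  { assume a: "bern \<alpha> n g < a"
    show "\<forall>\<^sub>F t in at_top. (\<integral>\<xi>. g \<xi> \<partial>S t empty_config) < a"
      using eventually_ge_at_top[of 0]
    proof eventually_elim
      case (elim t)
      from empty_upper_bound[OF S \<alpha>(1) \<alpha>1 elim g(1) gB g(4)] a show ?case by simp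
    qed }
  { assume a: "a < bern \<alpha> n g"
    have "\<forall>\<^sub>F L in sequentially. a < stat \<alpha> 0 L g / stat \<alpha> 0 L (\<lambda>_. 1)"
      using order_tendstoD(1)[OF stat_ratio_tendsto[OF \<alpha> g(1-3)] a] .
    then have "\<forall>\<^sub>F L in sequentially. a < stat \<alpha> 0 L g / stat \<alpha> 0 L (\<lambda>_. 1) \<and> max 1 n \<le> L"
      using eventually_ge_at_top[of "max 1 n"] by eventually_elim simp
    then obtain L where L: "a < stat \<alpha> 0 L g / stat \<alpha> 0 L (\<lambda>_. 1)" "max 1 n \<le> L"
      using eventually_happens'[OF sequentially_bot] by blast
    have L1: "1 \<le> L" "n \<le> L" using L(2) by simp_all
    have "((\<lambda>t. chain_evol \<alpha> 1 L t g empty_config) \<longlongrightarrow> stat \<alpha> 0 L g / stat \<alpha> 0 L (\<lambda>_. 1)) at_top"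
      by (rule chain_evol_tendsto_stat[OF \<alpha>(1) zero_less_one L1(1) \<alpha>1 _ _ stat_one_pos[OF \<alpha>]
            depends_on_mono[OF g(1) L1(2)] gB]) simp_all
    from order_tendstoD(1)[OF this L(1)]
    show "\<forall>\<^sub>F t in at_top. a < (\<integral>\<xi>. g \<xi> \<partial>S t empty_config)"
      using eventually_ge_at_top[of 0]
    proof eventually_elim
      case (elim t)
      from empty_lower_bound[OF S _ _ elim(2) L1 g(1) gB g(4)] elim(1) \<alpha> show ?case by simp
    qed }
qed

lemma bern_const_diff: "bern \<alpha> n (\<lambda>\<eta>. a - g \<eta>) = a - bern \<alpha> n g"
proof (induction n arbitrary: g)
  case (Suc n)
  show ?case unfolding bern.simps Suc.IH by (simp add: algebra_simps)
qed simp

text \<open>The event is decreasing, so \<open>empty_limit\<close> is applied to its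
  complement.\<close>

lemma empty_particles_limit:
  assumes S: "tasep_semigroup \<alpha> S" and \<alpha>: "0 < \<alpha>" "\<alpha> \<le> 1/2"
  shows "((\<lambda>t. \<integral>\<xi>. of_bool (particles N \<xi> \<le> j) \<partial>S t empty_config) \<longlongrightarrow>
    (\<Sum>n\<le>N. real (N choose n) * (\<alpha> ^ n * (1 - \<alpha>) ^ (N - n) * of_bool (n \<le> j)))) at_top"
proof -
  let ?g = "\<lambda>\<xi>. of_bool (j < particles N \<xi>) :: real"
  have dep: "depends_on N ?g" by (rule depends_on_particles[where \<phi> = "\<lambda>k. of_bool (j < k)"])
  have compl: "of_bool (k \<le> j) = 1 - (of_bool (j < k) :: real)" for k by (simp add: of_bool_def)
  have "((\<lambda>t. \<integral>\<xi>. ?g \<xi> \<partial>S t empty_config) \<longlongrightarrow> bern \<alpha> N ?g) at_top"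
    by (rule empty_limit[OF S \<alpha> dep]) (use particles_mono in \<open>auto simp: of_bool_def intro: less_le_trans\<close>)
  then have 1: "((\<lambda>t. 1 - (\<integral>\<xi>. ?g \<xi> \<partial>S t empty_config)) \<longlongrightarrow> 1 - bern \<alpha> N ?g) at_top"
    by (intro tendsto_diff tendsto_const)
  have 2: "\<forall>\<^sub>F t in at_top. 1 - (\<integral>\<xi>. ?g \<xi> \<partial>S t empty_config)
      = (\<integral>\<xi>. of_bool (particles N \<xi> \<le> j) \<partial>S t empty_config)"
    using eventually_ge_at_top[of 0]
  proof eventually_elim
    case (elim t)
    interpret prob_space "S t empty_config"
      by (rule tasep_semigroup_kernel(1)[OF S elim empty_config_in_space])
    have "integrable (S t empty_config) ?g"
      by (rule tasep_semigroup_integrable(1)[OF S elim empty_config_in_space depends_on_measurable[OF dep], of 1])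
         simp
    then show ?case unfolding compl by (simp add: prob_space)
  qed
  have 3: "1 - bern \<alpha> N ?g
      = (\<Sum>n\<le>N. real (N choose n) * (\<alpha> ^ n * (1 - \<alpha>) ^ (N - n) * of_bool (n \<le> j)))"
    unfolding bern_const_diff[symmetric] compl[symmetric]
    using bern_particles[of \<alpha> N "\<lambda>k. of_bool (k \<le> j)"] .
  show ?thesis using Lim_transform_eventually[OF 1 2] unfolding 3 .
qed

section \<open>Surviving second-class particles for the two initial states\<close>

lemma init_shock_in_space: "init_shock M1 M2 \<in> space config_space"
  by (auto simp: init_shock_def config_space_def space_PiM)

lemma init_second_in_space: "init_second M1 M2 \<in> space config_space"
  by (auto simp: init_second_def config_space_def space_PiM)

lemma tail_weight_le:
  assumes "\<And>x. N < x \<Longrightarrow> \<eta> x = \<infinity>"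
  shows "tail_weight R \<eta> \<le> (\<Sum>x\<in>{1..N}. 2 ^ x)"
proof -
  have "tail_weight R \<eta> \<le> (\<Sum>x\<in>{1..R}. if x \<in> {1..N} then 2 ^ x else 0)"
    unfolding tail_weight_def
  proof (rule sum_mono)
    fix x assume "x \<in> {1..R}"
    then show "of_bool (2 \<le> \<eta> x \<and> \<eta> x \<noteq> \<infinity>) * 2 ^ x \<le> (if x \<in> {1..N} then 2 ^ x else (0::real))"
      using assms[of x] by (cases "N < x") auto
  qed
  also have "\<dots> = (\<Sum>x\<in>{1..R} \<inter> {1..N}. 2 ^ x)" by (rule sum.inter_restrict[symmetric]) simp
  also have "\<dots> \<le> (\<Sum>x\<in>{1..N}. 2 ^ x)" by (intro sum_mono2) auto
  finally show ?thesis .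
qed

lemma measure_many_seconds_init_shock:
  assumes S: "tasep_semigroup \<alpha> S" and \<alpha>: "0 \<le> \<alpha>" "\<alpha> \<le> 1" and t: "0 \<le> t"
  shows "measure (S t (init_shock M1 M2)) (many_seconds 1)
    = (\<integral>\<xi>. of_bool (particles (M1 + M2 + 1) \<xi> \<le> M1) \<partial>S t empty_config)"
proof (rule measure_many_seconds[OF S \<alpha> init_shock_in_space t])
  show "tail_weight R (init_shock M1 M2) \<le> (\<Sum>x\<in>{1..M1 + M2 + 1}. 2 ^ x)" for R
    by (rule tail_weight_le) (simp add: init_shock_def)
  show "depends_on (M1 + M2 + 1) (\<lambda>\<xi>. of_bool (particles (M1 + M2 + 1) \<xi> \<le> M1))"
    by (rule depends_on_particles[where \<phi> = "\<lambda>k. of_bool (k \<le> M1)"])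
  show "chain_evol \<alpha> 0 R t (\<lambda>\<eta>. of_bool (1 \<le> seconds R \<eta>)) (init_shock M1 M2)
      = chain_evol \<alpha> 0 R t (\<lambda>\<xi>. of_bool (particles (M1 + M2 + 1) \<xi> \<le> M1)) empty_config"
    if "M1 + M2 + 1 \<le> R" for R
  proof -
    have "of_bool (1 \<le> seconds R \<eta>) = (of_bool (1 \<le> int (seconds R \<eta>)) :: real)" for \<eta>
      by (simp add: of_bool_def)
    moreover have "of_bool (1 \<le> (of_bool b :: int)) = (of_bool b :: real)" for b by (cases b) auto
    ultimately show ?thesis
      using evol_seconds_init_shock[OF that, of \<alpha> t "\<lambda>k. of_bool (1 \<le> k)"] by simp
  qed
  show "\<bar>of_bool (particles (M1 + M2 + 1) \<xi> \<le> M1)\<bar> \<le> (1::real)" for \<xi> by simp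
qed

lemma measure_many_seconds_init_second:
  assumes S: "tasep_semigroup \<alpha> S" and \<alpha>: "0 \<le> \<alpha>" "\<alpha> \<le> 1" and t: "0 \<le> t"
  shows "measure (S t (init_second M1 M2)) (many_seconds m)
    = (\<integral>\<xi>. of_bool (m \<le> M2 + 1 \<and> m + particles (M1 + M2 + 1) \<xi> \<le> M1 + M2 + 1) \<partial>S t empty_config)"
proof (rule measure_many_seconds[OF S \<alpha> init_second_in_space t])
  let ?N = "M1 + M2 + 1"
  show "tail_weight R (init_second M1 M2) \<le> (\<Sum>x\<in>{1..?N}. 2 ^ x)" for R
    by (rule tail_weight_le) (simp add: init_second_def)
  show "depends_on ?N (\<lambda>\<xi>. of_bool (m \<le> M2 + 1 \<and> m + particles ?N \<xi> \<le> ?N))"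
    by (rule depends_on_particles[where \<phi> = "\<lambda>k. of_bool (m \<le> M2 + 1 \<and> m + k \<le> ?N)"])
  show "chain_evol \<alpha> 0 R t (\<lambda>\<eta>. of_bool (m \<le> seconds R \<eta>)) (init_second M1 M2)
      = chain_evol \<alpha> 0 R t (\<lambda>\<xi>. of_bool (m \<le> M2 + 1 \<and> m + particles ?N \<xi> \<le> ?N)) empty_config"
    if "?N \<le> R" for R
  proof -
    have "of_bool (m \<le> seconds R \<eta>) = (of_bool (int m \<le> int (seconds R \<eta>)) :: real)" for \<eta>
      by simp
    moreover have "(int m \<le> min (int (M2 + 1)) (int ?N - int (particles ?N \<xi>)))
        \<longleftrightarrow> m \<le> M2 + 1 \<and> m + particles ?N \<xi> \<le> ?N" for \<xi>
      by linarith
    ultimately show ?thesis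
      using evol_seconds_init_second[OF that, of \<alpha> t "\<lambda>k. of_bool (int m \<le> k)"] by (simp only:)
  qed
  show "\<bar>of_bool (m \<le> M2 + 1 \<and> m + particles ?N \<xi> \<le> ?N)\<bar> \<le> (1::real)" for \<xi> by simp
qed

text \<open>As \<open>card\<close> is 0 on infinite sets, for \<open>m = 0\<close> the event also
  contains the configurations with infinitely many second-class particles, which are added by
  hand.\<close>

lemma color_count_event_sets:
  "{\<zeta> \<in> space config_space. color_count 2 1 \<zeta> = m} \<in> sets config_space"
proof -
  have "{\<zeta> \<in> space config_space. finite {y. 1 \<le> y \<and> \<zeta> y = 2}} = (\<Union>k. space config_space - many_seconds k)"
  proof (intro set_eqI iffI)
    fix \<zeta> assume "\<zeta> \<in> {\<zeta> \<in> space config_space. finite {y. 1 \<le> y \<and> \<zeta> y = 2}}"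
    then have a: "\<zeta> \<in> space config_space" "finite {y. 1 \<le> y \<and> \<zeta> y = 2}" by simp_all
    then have "\<zeta> \<notin> many_seconds (Suc (card {y. 1 \<le> y \<and> \<zeta> y = 2}))"
      unfolding many_seconds_iff[OF a(1)] by (simp only: not_True_eq_False simp_thms not_less_eq_eq order.refl)
    with a(1) show "\<zeta> \<in> (\<Union>k. space config_space - many_seconds k)"
      by (intro UN_I[OF UNIV_I] DiffI)
  next
    fix \<zeta> assume "\<zeta> \<in> (\<Union>k. space config_space - many_seconds k)"
    then obtain k where k: "\<zeta> \<in> space config_space" "\<zeta> \<notin> many_seconds k" by (elim UN_E DiffE)
    then show "\<zeta> \<in> {\<zeta> \<in> space config_space. finite {y. 1 \<le> y \<and> \<zeta> y = 2}}"
      unfolding many_seconds_iff[OF k(1)] by (simp only: mem_Collect_eq de_Morgan_disj not_not simp_thms)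
  qed
  moreover have "(\<Union>k. space config_space - many_seconds k) \<in> sets config_space"
    by (intro sets.countable_UN image_subsetI sets.compl_sets many_seconds_sets)
  ultimately have fin: "{\<zeta> \<in> space config_space. finite {y. 1 \<le> y \<and> \<zeta> y = 2}} \<in> sets config_space"
    by (simp only:)
  let ?F = "{\<zeta> \<in> space config_space. finite {y. 1 \<le> y \<and> \<zeta> y = 2}}"
  have cc: "color_count 2 1 \<zeta> = card {y. 1 \<le> y \<and> \<zeta> y = 2}" for \<zeta>
    unfolding color_count_def by (intro arg_cong[where f = card]) auto
  have eq: "{\<zeta> \<in> space config_space. color_count 2 1 \<zeta> = m} = (?F \<inter> (many_seconds m - many_seconds (Suc m)))
      \<union> (if m = 0 then space config_space - ?F else {})"
  proof (rule set_eqI)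
    fix \<zeta>
    show "\<zeta> \<in> {\<zeta> \<in> space config_space. color_count 2 1 \<zeta> = m} \<longleftrightarrow>
      \<zeta> \<in> (?F \<inter> (many_seconds m - many_seconds (Suc m)))
        \<union> (if m = 0 then space config_space - ?F else {})"
    proof (cases "\<zeta> \<in> space config_space")
      case True
      define c where "c = card {y. 1 \<le> y \<and> \<zeta> y = 2}"
      define fin where "fin \<longleftrightarrow> finite {y. 1 \<le> y \<and> \<zeta> y = 2}"
      have M: "\<zeta> \<in> many_seconds j \<longleftrightarrow> \<not> fin \<or> j \<le> c" for j
        unfolding many_seconds_iff[OF True] fin_def c_def ..
      have F: "\<zeta> \<in> ?F \<longleftrightarrow> fin" using True by (simp only: mem_Collect_eq fin_def simp_thms)
      have inf: "fin \<or> c = 0" unfolding fin_def c_def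
        by (cases "finite {y. 1 \<le> y \<and> \<zeta> y = 2}") (simp_all only: card.infinite simp_thms)
      have "\<zeta> \<in> {\<zeta> \<in> space config_space. color_count 2 1 \<zeta> = m} \<longleftrightarrow> c = m"
        using True by (simp only: mem_Collect_eq cc c_def simp_thms)
      also have "\<dots> \<longleftrightarrow> fin \<and> m \<le> c \<and> \<not> Suc m \<le> c \<or> m = 0 \<and> \<not> fin"
        using inf by (cases fin; simp only: simp_thms) linarith+
      also have "\<dots> \<longleftrightarrow> \<zeta> \<in> (?F \<inter> (many_seconds m - many_seconds (Suc m)))
          \<union> (if m = 0 then space config_space - ?F else {})"
        unfolding Un_iff Int_iff Diff_iff M F using True
        by (cases "m = 0"; cases fin) (simp_all only: if_True if_False Diff_iff F empty_iff simp_thms)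
      finally show ?thesis .
    next
      case False
      then show ?thesis by (simp add: many_seconds_def)
    qed
  qed
  have "(if m = 0 then space config_space - ?F else {}) \<in> sets config_space"
    using sets.compl_sets[OF fin]
    by (cases "m = 0") (simp_all only: if_True if_False simp_thms sets.empty_sets)
  then show ?thesis
    unfolding eq by (intro sets.Un sets.Int sets.Diff fin many_seconds_sets)
qed

text \<open>Duality gives \<open>many_seconds (M2 + 2)\<close> measure zero, so almost surely the
  count is finite and \<open>color_count_eq_iff\<close> applies.\<close>

lemma measure_color_count:
  assumes S: "tasep_semigroup \<alpha> S" and \<alpha>: "0 \<le> \<alpha>" "\<alpha> \<le> 1" and t: "0 \<le> t"
  shows "measure (S t (init_second M1 M2)) {\<zeta> \<in> space config_space. color_count 2 1 \<zeta> = m}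
    = measure (S t (init_second M1 M2)) (many_seconds m)
      - measure (S t (init_second M1 M2)) (many_seconds (Suc m))"
proof -
  let ?S = "S t (init_second M1 M2)"
  note K = tasep_semigroup_kernel[OF S t init_second_in_space[of M1 M2]]
  interpret prob_space ?S by (rule K)
  have sp: "space ?S = space config_space" using K(2) by (rule sets_eq_imp_space_eq)
  have ms: "many_seconds j \<in> sets ?S" for j using K(2) many_seconds_sets by simp
  let ?E = "{\<zeta> \<in> space config_space. color_count 2 1 \<zeta> = m}"
  have eq: "\<zeta> \<in> ?E \<longleftrightarrow> \<zeta> \<in> many_seconds m - many_seconds (Suc m)"
    if "\<zeta> \<in> space config_space" "\<zeta> \<notin> many_seconds (M2 + 2)" for \<zeta>
    using color_count_eq_iff[OF that, of m] that(1) by simp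
  have "measure ?S (many_seconds (M2 + 2)) = 0"
    unfolding measure_many_seconds_init_second[OF S \<alpha> t] by simp
  then have null: "many_seconds (M2 + 2) \<in> null_sets ?S"
    using ms by (auto simp: null_sets_def emeasure_eq_measure)
  have Em: "?E \<in> sets ?S" unfolding K(2) by (rule color_count_event_sets)
  have "measure ?S ?E = measure ?S (many_seconds m - many_seconds (Suc m))"
  proof (rule measure_eq_AE)
    show "AE \<zeta> in ?S. \<zeta> \<in> ?E \<longleftrightarrow> \<zeta> \<in> many_seconds m - many_seconds (Suc m)"
      using AE_not_in[OF null] AE_space
    proof eventually_elim
      case (elim \<zeta>)
      then show ?case using eq[of \<zeta>] sp by simp
    qed
  qed (use Em ms in auto)
  also have "\<dots> = measure ?S (many_seconds m) - measure ?S (many_seconds (Suc m))"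
    by (rule finite_measure_Diff) (use ms in \<open>auto simp: many_seconds_def intro: Suc_leD\<close>)
  finally show ?thesis .
qed

lemma second_class_limit:
  assumes \<alpha>: "0 < \<alpha>" "\<alpha> \<le> 1/2" and X: "half_line_tasep \<alpha> (init_shock M1 M2) P X"
  shows "((\<lambda>t. measure P {\<omega> \<in> space P. second_class_position (X t \<omega>) > 0}) \<longlongrightarrow>
    (\<Sum>n=0..M1. real ((M1 + M2 + 1) choose n) * \<alpha> ^ n * (1 - \<alpha>) ^ (M1 + M2 + 1 - n))) at_top"
proof -
  let ?N = "M1 + M2 + 1"
  obtain S where S: "tasep_semigroup \<alpha> S" and law: "\<forall>t A. 0 \<le> t \<longrightarrow> A \<in> sets config_space \<longrightarrow>
      measure P {\<omega> \<in> space P. X t \<omega> \<in> A} = measure (S t (init_shock M1 M2)) A"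
    using half_line_tasep_law[OF X] .
  have meas: "X t \<in> P \<rightarrow>\<^sub>M config_space" if "0 \<le> t" for t
    using X[unfolded half_line_tasep_def, THEN conjunct2, THEN conjunct1] that by blast
  have "\<forall>\<^sub>F t in at_top. (\<integral>\<xi>. of_bool (particles ?N \<xi> \<le> M1) \<partial>S t empty_config)
      = measure P {\<omega> \<in> space P. second_class_position (X t \<omega>) > 0}"
    using eventually_ge_at_top[of 0]
  proof eventually_elim
    case (elim t)
    have "{\<omega> \<in> space P. second_class_position (X t \<omega>) > 0} = {\<omega> \<in> space P. X t \<omega> \<in> many_seconds 1}"
      by (intro Collect_cong conj_cong refl second_class_position_pos_iff measurable_space[OF meas[OF elim]])
    then show ?case
      using law[rule_format, OF elim many_seconds_sets] measure_many_seconds_init_shock[OF S _ _ elim, of M1 M2] \<alpha> by simp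
  qed
  from Lim_transform_eventually[OF empty_particles_limit[OF S \<alpha>, of ?N M1] this]
  have "((\<lambda>t. measure P {\<omega> \<in> space P. second_class_position (X t \<omega>) > 0}) \<longlongrightarrow>
    (\<Sum>n\<le>?N. real (?N choose n) * (\<alpha> ^ n * (1 - \<alpha>) ^ (?N - n) * of_bool (n \<le> M1)))) at_top" .
  also have "(\<Sum>n\<le>?N. real (?N choose n) * (\<alpha> ^ n * (1 - \<alpha>) ^ (?N - n) * of_bool (n \<le> M1)))
      = (\<Sum>n=0..M1. real (?N choose n) * \<alpha> ^ n * (1 - \<alpha>) ^ (?N - n))"
    by (rule sum.mono_neutral_cong_right) auto
  finally show ?thesis .
qed

text \<open>As \<open>m \<le> M2\<close>, the truncation at \<open>M2 + 1\<close> does not bind, so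
  exactly \<open>m\<close> survivors correspond to exactly \<open>M1 + M2 + 1 - m\<close> particles:
  a difference of two cumulative binomials.\<close>

lemma surviving_number_limit:
  assumes \<alpha>: "0 < \<alpha>" "\<alpha> \<le> 1/2" and X: "half_line_tasep \<alpha> (init_second M1 M2) P X"
    and m: "m \<le> M2"
  shows "((\<lambda>t. measure P {\<omega> \<in> space P. color_count 2 1 (X t \<omega>) = m}) \<longlongrightarrow>
    real ((M1 + M2 + 1) choose (M1 + M2 + 1 - m)) * \<alpha> ^ (M1 + M2 + 1 - m) * (1 - \<alpha>) ^ m) at_top"
proof -
  let ?N = "M1 + M2 + 1" and ?i = "init_second M1 M2"
  obtain S where S: "tasep_semigroup \<alpha> S" and law: "\<forall>t A. 0 \<le> t \<longrightarrow> A \<in> sets config_space \<longrightarrow>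
      measure P {\<omega> \<in> space P. X t \<omega> \<in> A} = measure (S t ?i) A"
    using half_line_tasep_law[OF X] .
  have meas: "X t \<in> P \<rightarrow>\<^sub>M config_space" if "0 \<le> t" for t
    using X[unfolded half_line_tasep_def, THEN conjunct2, THEN conjunct1] that by blast
  define k where "k = ?N - m"
  \<comment> \<open>Here \<open>k\<close> is positive, so \<open>k - 1\<close> is a true
    predecessor.\<close>
  have k: "Suc (k - 1) = k" "k \<le> ?N" "?N - k = m" using m by (auto simp: k_def)
  let ?I = "\<lambda>j t. \<integral>\<xi>. of_bool (particles ?N \<xi> \<le> j) \<partial>S t empty_config"
  let ?p = "\<lambda>j. \<Sum>n\<le>?N. real (?N choose n) * (\<alpha> ^ n * (1 - \<alpha>) ^ (?N - n) * of_bool (n \<le> j))"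
  have 1: "\<forall>\<^sub>F t in at_top. ?I k t - ?I (k - 1) t
      = measure P {\<omega> \<in> space P. color_count 2 1 (X t \<omega>) = m}"
    using eventually_ge_at_top[of 0]
  proof eventually_elim
    case (elim t)
    have a: "measure (S t ?i) (many_seconds m) = ?I k t"
      "measure (S t ?i) (many_seconds (Suc m)) = ?I (k - 1) t"
    proof -
      have "m \<le> M2 + 1 \<and> m + q \<le> ?N \<longleftrightarrow> q \<le> k" "Suc m \<le> M2 + 1 \<and> Suc m + q \<le> ?N \<longleftrightarrow> q \<le> k - 1" for q
        using m by (auto simp: k_def)
      then show "measure (S t ?i) (many_seconds m) = ?I k t"
        "measure (S t ?i) (many_seconds (Suc m)) = ?I (k - 1) t"
        using measure_many_seconds_init_second[OF S _ _ elim, of M1 M2] \<alpha> by (simp_all only:)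
    qed
    have "{\<omega> \<in> space P. color_count 2 1 (X t \<omega>) = m}
        = {\<omega> \<in> space P. X t \<omega> \<in> {\<zeta> \<in> space config_space. color_count 2 1 \<zeta> = m}}"
      using measurable_space[OF meas[OF elim]] by auto
    then have "measure P {\<omega> \<in> space P. color_count 2 1 (X t \<omega>) = m}
        = measure (S t ?i) {\<zeta> \<in> space config_space. color_count 2 1 \<zeta> = m}"
      using law[rule_format, OF elim color_count_event_sets] by simp
    also have "\<dots> = ?I k t - ?I (k - 1) t"
      unfolding a[symmetric] by (rule measure_color_count[OF S _ _ elim]) (use \<alpha> in auto)
    finally show ?case ..
  qed
  have 2: "((\<lambda>t. ?I k t - ?I (k - 1) t) \<longlongrightarrow> ?p k - ?p (k - 1)) at_top"
    by (intro tendsto_diff empty_particles_limit[OF S \<alpha>])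
  have "?p k - ?p (k - 1) = (\<Sum>n\<le>?N. if n = k then real (?N choose k) * (\<alpha> ^ k * (1 - \<alpha>) ^ (?N - k)) else 0)"
    unfolding sum_subtractf[symmetric] using k(1)
    by (intro sum.cong refl) (auto simp: of_bool_def)
  also have "\<dots> = real (?N choose k) * (\<alpha> ^ k * (1 - \<alpha>) ^ m)"
    unfolding sum.delta[OF finite_atMost] k(3) using k(2) by (simp only: atMost_iff if_True)
  finally have 3: "?p k - ?p (k - 1) = real (?N choose k) * \<alpha> ^ k * (1 - \<alpha>) ^ m" by simp
  show ?thesis using Lim_transform_eventually[OF 2 1] unfolding 3 unfolding k_def .
qed

theorem theorem1p2:
  fixes M1 M2 :: nat and \<alpha> :: real
    and P :: "'a measure" and \<eta> :: "real \<Rightarrow> 'a \<Rightarrow> config"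
    and P' :: "'b measure" and \<eta>' :: "real \<Rightarrow> 'b \<Rightarrow> config"
  assumes "M1 \<ge> 1" and "M2 \<ge> 1"
    and "0 < \<alpha>" and "\<alpha> < 1" and "\<alpha> \<le> 1/2"
    and "half_line_tasep \<alpha> (init_shock M1 M2) P \<eta>"
    and "half_line_tasep \<alpha> (init_second M1 M2) P' \<eta>'"
  shows "((\<lambda>t. measure P {\<omega> \<in> space P. second_class_position (\<eta> t \<omega>) > 0}) \<longlongrightarrow>
            (\<Sum>n=0..M1. real ((M1 + M2 + 1) choose n) * \<alpha> ^ n * (1 - \<alpha>) ^ (M1 + M2 + 1 - n)))
          at_top \<and>
         (\<forall>m\<le>M2. ((\<lambda>t. measure P' {\<omega> \<in> space P'. color_count 2 1 (\<eta>' t \<omega>) = m}) \<longlongrightarrow>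
            real ((M1 + M2 + 1) choose (M1 + M2 + 1 - m)) * \<alpha> ^ (M1 + M2 + 1 - m) * (1 - \<alpha>) ^ m)
          at_top)"
  by (intro conjI allI impI second_class_limit[OF assms(3,5,6)] surviving_number_limit[OF assms(3,5,7)])

end
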